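(* Let $0<|q|<1$ and let $n=1,2,3,\dots$. Then $$\vartheta_3(0,q)^{2n}\,\Delta(q)^{(2n)^2}=4^{-n(n-1)}q^{-n^2/2}\prod_{r=1}^{n}\bigl((2r-1)!\bigr)^{-2}\sum_{\substack{y_1,\dots,y_n\ge1\ (\text{all odd})\\ m_1>m_2>\cdots>m_n\ge1\ (\text{all odd})}}(-1)^{\frac12(-n+y_1+\cdots+y_n)}(m_1m_2\cdots m_n)^2$$ $$\cdot q^{\frac12(m_1y_1+\cdots+m_ny_n)}\prod_{1\le r<s\le n}\left(m_r^2-m_s^2\right)^2,$$ where the $y_i,m_i$ range over integers satisfying the indicated conditions.
   Context: $\vartheta_3(0,q):=\sum_{j=-\infty}^{\infty}q^{j^2}$ and $\Delta(q):=\sum_{j=0}^{\infty}q^{j(j+1)/2}$. In every term the total exponent $\frac12(m_1y_1+\cdots+m_ny_n-n^2)$ of $q$ is an integer, so no choice of $q^{1/2}$ matters. *)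

theory Defs
  imports "HOL-Analysis.Analysis"
begin

definition theta3_zero :: "complex \<Rightarrow> complex" where
  "theta3_zero q = (\<Sum>\<^sub>\<infinity>j::int. q powi (j\<^sup>2))"

definition Delta :: "complex \<Rightarrow> complex" where
  "Delta q = (\<Sum>j. q ^ (j * (j + 1) div 2))"

text \<open>A tuple indexed by \<open>{1..n}\<close> is an extensional function on \<open>{1..n}\<close>, so that each
  tuple is counted exactly once. Positive odd integers are the odd elements of \<^typ>\<open>nat\<close>.\<close>

definition odd_tuples :: "nat \<Rightarrow> (nat \<Rightarrow> nat) set" where
  "odd_tuples n = {1..n} \<rightarrow>\<^sub>E {k. odd k}"

definition decreasing_odd_tuples :: "nat \<Rightarrow> (nat \<Rightarrow> nat) set" where
  "decreasing_odd_tuples n = {m \<in> odd_tuples n. \<forall>r\<in>{1..n}. \<forall>s\<in>{1..n}. r < s \<longrightarrow> m r > m s}"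

text \<open>The summand, with \<open>w\<close> in the role of \<open>q\<^sup>1\<^sup>/\<^sup>2\<close>. The exponent of \<open>-1\<close> involves no
  truncation: all \<open>y r\<close> are odd, so their sum is at least \<open>n\<close> and has the parity of \<open>n\<close>.\<close>

definition summand :: "nat \<Rightarrow> complex \<Rightarrow> (nat \<Rightarrow> nat) \<Rightarrow> (nat \<Rightarrow> nat) \<Rightarrow> complex" where
  "summand n w y m =
     (-1) ^ (((\<Sum>r=1..n. y r) - n) div 2)
     * (\<Prod>r=1..n. of_nat (m r))\<^sup>2
     * w ^ (\<Sum>r=1..n. m r * y r)
     * (\<Prod>(r, s)\<in>{(r, s). 1 \<le> r \<and> r < s \<and> s \<le> n}. ((of_nat (m r))\<^sup>2 - (of_nat (m s))\<^sup>2)\<^sup>2)"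

end

theory Submission
  imports Defs "HOL-Complex_Analysis.Laurent_Convergence" "Jordan_Normal_Form.Determinant"
begin

text \<open>
  Summing over the \<open>y\<^sub>i\<close> and applying an infinite Cauchy-Binet formula turns the right-hand side into the
  Hankel determinant of the moments \<open>\<Sum> m\<^bsup>2e+2\<^esup> w\<^sup>m / (1 + w\<^bsup>2m\<^esup>)\<close> over odd \<open>m\<close>, which are the Taylor
  coefficients of the Fourier series of the Jacobi function \<open>cn\<close>. Following Stieltjes and Rogers, the
  addition theorem writes \<open>cn(x - y) - cn(x + y)\<close> as \<open>A g(x) g(y) / (1 - h(x) h(y))\<close> with
  \<open>g\<close> and \<open>h\<close> proportional to \<open>sn dn\<close> and \<open>sn\<^sup>2\<close>; expanding the geometric series gives a triangular
  factorisation of the Hankel matrix. All theta identities are instances of one product formula for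
  theta series, together with invariance under \<open>q \<mapsto> q\<^sup>2\<close> for Jacobi's derivative formula.
\<close>

section \<open>Theta series and their product formula\<close>

text \<open>The right-hand side dictates the kernel. The factor (m_1 ... m_n)^2 next to a squared
  Vandermonde product in the m_r^2 calls for moments with m^(2 i + 1) m^(2 k + 1). These are the
  odd-odd Taylor coefficients of sin(m x) sin(m y), hence the difference of cn at x - y and x + y
  instead of cn(x + y) alone. The diagonal of the triangular factor consists of the leading Taylor
  coefficients of g h^j, so besides the addition theorem only three constants matter: the derivative
  of theta_1 at 0, the factor between \<open>G\<close> and theta_1 theta_3, and the factor between
  the Fourier series and theta_2 / theta_4. The last one is extracted from a pole on the boundary of
  the annulus of convergence. Half-integral powers of q occur in the single Fourier coefficients, so
  a square root w of q is fixed throughout.\<close>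

lemma summable_on_int_split:
  fixes f :: "int \<Rightarrow> 'a :: {real_normed_vector, banach}"
  assumes "(\<lambda>n. f (int n)) summable_on UNIV" "(\<lambda>n. f (- int n)) summable_on UNIV"
  shows "f summable_on UNIV"
proof -
  have 1: "f summable_on {0..}"
    using assms(1) by (subst summable_on_reindex_bij_witness[of _ int nat UNIV "\<lambda>n. f (int n)"]) auto
  have "f summable_on {..0}"
    using assms(2)
    by (subst summable_on_reindex_bij_witness[of _ "\<lambda>n. - int n" "\<lambda>j. nat (-j)" UNIV "\<lambda>n. f (- int n)"]) auto
  then have "f summable_on {..<0}"
    by (rule summable_on_subset_banach) auto
  with 1 have "f summable_on ({0..} \<union> {..<0})"
    by (intro summable_on_Un_disjoint) auto
  moreover have "{0..} \<union> {..<0} = (UNIV :: int set)" by auto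
  ultimately show ?thesis by simp
qed

text \<open>The term is the n-th power of \<open>r ^ n * exp c\<close>, which tends to 0, so the
  Gaussian factor beats any exponential growth.\<close>

lemma summable_power_square_exp:
  fixes r c :: real
  assumes "0 \<le> r" "r < 1"
  shows "summable (\<lambda>n. r ^ (n\<^sup>2) * exp (c * real n))"
proof (rule summable_comparison_test_ev)
  have "(\<lambda>n. r ^ n * exp c) \<longlonglongrightarrow> 0 * exp c"
    using assms by (intro tendsto_intros LIMSEQ_realpow_zero)
  then have "eventually (\<lambda>n. r ^ n * exp c < 1/2) sequentially"
    by (rule order_tendstoD) simp
  then show "eventually (\<lambda>n. norm (r ^ (n\<^sup>2) * exp (c * real n)) \<le> (1/2) ^ n) sequentially"
  proof eventually_elim
    case (elim n)
    have "r ^ (n\<^sup>2) * exp (c * real n) = (r ^ n * exp c) ^ n"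
      by (simp add: power2_eq_square power_mult power_mult_distrib exp_of_nat2_mult)
    also have "\<dots> \<le> (1/2) ^ n"
      using elim assms by (intro power_mono) auto
    finally show ?case using assms by simp
  qed
qed (rule summable_geometric, simp)

text \<open>The common majorant of the theta series: \<open>norm_powi_le_exp\<close> bounds the
  powers of any nonzero argument by such an exponential in |j|.\<close>

lemma summable_on_gaussian:
  fixes v :: complex and c :: real
  assumes "norm v < 1"
  shows "(\<lambda>j::int. norm (v powi (j\<^sup>2)) * exp (c * real_of_int \<bar>j\<bar>)) summable_on UNIV"
proof -
  have *: "(\<lambda>n. norm v ^ (n\<^sup>2) * exp (c * real n)) summable_on UNIV"
    using summable_power_square_exp[of "norm v" c] assms
    by (intro norm_summable_imp_summable_on) (auto simp: abs_mult)
  have "norm (v powi ((int n)\<^sup>2)) = norm v ^ (n\<^sup>2)" for n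
    by (metis norm_power of_nat_power power_int_of_nat)
  with * show ?thesis
    by (intro summable_on_int_split) auto
qed

lemma norm_powi_le_exp:
  fixes z :: complex
  assumes "z \<noteq> 0"
  shows "norm (z powi j) \<le> exp (\<bar>ln (norm z)\<bar> * real_of_int \<bar>j\<bar>)"
proof -
  have "norm (z powi j) = norm z powi j" by (simp add: norm_power_int)
  also have "\<dots> = exp (of_int j * ln (norm z))"
    using assms by (simp add: powr_real_of_int' [symmetric] powr_def)
  also have "\<dots> \<le> exp (\<bar>ln (norm z)\<bar> * real_of_int \<bar>j\<bar>)"
    using abs_ge_self[of "of_int j * ln (norm z)"] by (simp add: abs_mult mult.commute)
  finally show ?thesis .
qed

lemma summable_on_prod_mult:
  fixes f :: "'a \<Rightarrow> complex" and g :: "'b \<Rightarrow> complex"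
  assumes "f summable_on A" "g summable_on B"
  shows "(\<lambda>(a, b). f a * g b) summable_on A \<times> B"
proof -
  have f: "(\<lambda>a. norm (f a)) summable_on A" and g: "(\<lambda>b. norm (g b)) summable_on B"
    using assms by (simp_all add: summable_on_iff_abs_summable_on_complex)
  have "(\<lambda>p. norm (case p of (a, b) \<Rightarrow> f a * g b)) summable_on A \<times> B"
    unfolding Infinite_Sum.abs_summable_on_Sigma_iff
    using f g by (auto simp: norm_mult infsum_cmult_right' infsum_nonneg intro!: summable_on_cmult_right summable_on_cmult_left)
  then show ?thesis by (simp add: summable_on_iff_abs_summable_on_complex)
qed

lemma infsum_prod_mult:
  fixes f :: "'a \<Rightarrow> complex" and g :: "'b \<Rightarrow> complex"
  assumes "f summable_on A" "g summable_on B"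
  shows "(\<Sum>\<^sub>\<infinity>(a, b)\<in>A \<times> B. f a * g b) = infsum f A * infsum g B"
  using infsum_Sigma'_banach[OF summable_on_prod_mult[OF assms]]
  by (simp add: infsum_cmult_right' infsum_cmult_left')

text \<open>Pairs with even sum are exactly (s + d, s - d), those with odd sum exactly (s + d + 1, s
  - d). On both classes a^2 + b^2 separates into a function of s plus a function of d.\<close>

lemma infsum_parity_split:
  fixes f :: "int \<Rightarrow> int \<Rightarrow> complex"
  assumes "(\<lambda>(a, b). f a b) summable_on UNIV"
  shows "(\<Sum>\<^sub>\<infinity>(a, b). f a b) = (\<Sum>\<^sub>\<infinity>(s, d). f (s + d) (s - d)) + (\<Sum>\<^sub>\<infinity>(s, d). f (s + d + 1) (s - d))"
proof -
  let ?E = "{(a, b). even (a + b :: int)}" and ?O = "{(a, b). odd (a + b :: int)}"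
  have "(\<Sum>\<^sub>\<infinity>(a, b)\<in>?E. f a b) = (\<Sum>\<^sub>\<infinity>(s, d). f (s + d) (s - d))"
  proof (rule infsum_reindex_bij_witness[of _ "\<lambda>(s, d). (s + d, s - d)" "\<lambda>(a, b). ((a + b) div 2, (a - b) div 2)"], goal_cases)
    case (1 x)
    then show ?case by (cases x) (auto; presburger)
  next
    case (5 x)
    then obtain a b where [simp]: "x = (a, b)" "even (a + b)" by auto
    have "(a + b) div 2 + (a - b) div 2 = a" "(a + b) div 2 - (a - b) div 2 = b"
      using \<open>even (a + b)\<close> by presburger+
    then show ?case by simp
  qed auto
  moreover have "(\<Sum>\<^sub>\<infinity>(a, b)\<in>?O. f a b) = (\<Sum>\<^sub>\<infinity>(s, d). f (s + d + 1) (s - d))"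
  proof (rule infsum_reindex_bij_witness[of _ "\<lambda>(s, d). (s + d + 1, s - d)" "\<lambda>(a, b). ((a + b - 1) div 2, (a - b - 1) div 2)"], goal_cases)
    case (1 x)
    then show ?case by (cases x) (auto; presburger)
  next
    case (5 x)
    then obtain a b where [simp]: "x = (a, b)" "odd (a + b)" by auto
    have "(a + b - 1) div 2 + (a - b - 1) div 2 + 1 = a" "(a + b - 1) div 2 - (a - b - 1) div 2 = b"
      using \<open>odd (a + b)\<close> by presburger+
    then show ?case by simp
  qed auto
  moreover have "(\<Sum>\<^sub>\<infinity>(a, b)\<in>?E \<union> ?O. f a b) = (\<Sum>\<^sub>\<infinity>(a, b)\<in>?E. f a b) + (\<Sum>\<^sub>\<infinity>(a, b)\<in>?O. f a b)"
    by (intro infsum_Un_disjoint summable_on_subset_banach[OF assms]) auto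
  moreover have "?E \<union> ?O = UNIV" by auto
  ultimately show ?thesis by simp
qed

text \<open>With x = e^(2 i z) this is theta_3(z) at nome v. The arguments -x, v x and -v x give
  theta_4, theta_2 and theta_1 up to elementary factors, so one set of identities serves all
  four.\<close>

definition theta :: "complex \<Rightarrow> complex \<Rightarrow> complex" where
  "theta v x = (\<Sum>\<^sub>\<infinity>j::int. v powi (j\<^sup>2) * x powi j)"

lemma theta_summable:
  fixes v x :: complex
  assumes "norm v < 1" "x \<noteq> 0"
  shows "(\<lambda>j::int. v powi (j\<^sup>2) * x powi j) summable_on UNIV"
proof -
  have "(\<lambda>j::int. norm (v powi (j\<^sup>2) * x powi j)) summable_on UNIV"
    by (rule Infinite_Sum.abs_summable_on_comparison_test'[OF summable_on_gaussian[OF assms(1), of "\<bar>ln (norm x)\<bar>"]])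
       (use norm_powi_le_exp[OF assms(2)] in \<open>auto simp: norm_mult intro!: mult_left_mono\<close>)
  then show ?thesis by (rule abs_summable_summable)
qed

lemma theta_inverse: "theta v (inverse x) = theta v x"
  unfolding theta_def
  by (rule infsum_reindex_bij_witness[of _ uminus uminus]) (auto simp: power_int_minus power_int_inverse)

text \<open>The exponents j^2 and j have the same parity.\<close>

lemma theta_minus: "theta (- v) x = theta v (- x)"
proof -
  have "(- v) powi (j\<^sup>2) * x powi j = v powi (j\<^sup>2) * (- x) powi j" for j :: int
    by (cases "even j") (auto simp: power_int_minus_left)
  then show ?thesis by (simp add: theta_def)
qed

text \<open>Completing the square: j^2 + 2 j = (j + 1)^2 - 1.\<close>

lemma theta_shift:
  assumes "v \<noteq> 0" "x \<noteq> 0"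
  shows "theta v (v\<^sup>2 * x) = theta v x / (v * x)"
proof -
  have "theta v x / (v * x) = (\<Sum>\<^sub>\<infinity>j::int. v powi (j\<^sup>2) * x powi j * inverse (v * x))"
    by (simp add: theta_def infsum_cmult_left' divide_inverse)
  also have "\<dots> = (\<Sum>\<^sub>\<infinity>j::int. v powi (j\<^sup>2) * (v\<^sup>2 * x) powi j)"
  proof (rule infsum_reindex_bij_witness[of _ "\<lambda>j. j + 1" "\<lambda>j. j - 1"], goal_cases)
    case (5 j)
    have e: "(j - 1)\<^sup>2 + 2 * (j - 1) = j\<^sup>2 - 1" by (simp add: power2_eq_square algebra_simps)
    have "v powi ((j - 1)\<^sup>2) * (v\<^sup>2 * x) powi (j - 1) = v powi ((j - 1)\<^sup>2 + 2 * (j - 1)) * x powi (j - 1)"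
      using assms power_int_mult[of v 2 "j - 1"] by (simp add: power_int_mult_distrib power_int_add)
    also have "\<dots> = v powi (j\<^sup>2) * x powi j * inverse (v * x)"
      unfolding e using assms by (simp add: power_int_diff field_simps)
    finally show ?case .
  qed auto
  finally show ?thesis by (simp add: theta_def)
qed

text \<open>The shift carries -1/v to -v with a change of sign, while \<open>theta_inverse\<close>
  identifies the two values; hence the value is its own negative.\<close>

lemma theta_zero:
  assumes "v \<noteq> 0"
  shows "theta v (- v) = 0"
proof -
  have "theta v (- v) = theta v (v\<^sup>2 * (- inverse v))"
    using assms by (simp add: power2_eq_square field_simps)
  also have "\<dots> = - theta v (inverse (- v))"
    using assms by (subst theta_shift) auto
  also have "\<dots> = - theta v (- v)"
    by (subst theta_inverse) simp
  finally show ?thesis by simp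
qed

text \<open>From (s + d)^2 + (s - d)^2 = 2 s^2 + 2 d^2 the nome gets squared and the arguments
  become product and quotient. The odd class adds 2 s + 2 d + 1 to the exponent, absorbed by the
  factor v x and by scaling the arguments with v^2.\<close>

lemma theta_mult:
  assumes "norm v < 1" "v \<noteq> 0" "x \<noteq> 0" "y \<noteq> 0"
  shows "theta v x * theta v y =
    theta (v\<^sup>2) (x * y) * theta (v\<^sup>2) (x / y) + v * x * theta (v\<^sup>2) (v\<^sup>2 * (x * y)) * theta (v\<^sup>2) (v\<^sup>2 * (x / y))"
proof -
  have v2: "norm (v\<^sup>2) < 1" using assms by (simp add: norm_power power_less_one_iff)
  note sm = theta_summable[OF v2]
  define f where "f a b = (v powi (a\<^sup>2) * x powi a) * (v powi (b\<^sup>2) * y powi b)" for a b :: int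
  have fs: "(\<lambda>(a, b). f a b) summable_on UNIV"
    using summable_on_prod_mult[OF theta_summable[of v x] theta_summable[of v y]] assms
    by (simp add: f_def)
  have "theta v x * theta v y = (\<Sum>\<^sub>\<infinity>(a, b). f a b)"
    using infsum_prod_mult[OF theta_summable[of v x] theta_summable[of v y]] assms
    by (simp add: f_def theta_def)
  also have "\<dots> = (\<Sum>\<^sub>\<infinity>(s, d). f (s + d) (s - d)) + (\<Sum>\<^sub>\<infinity>(s, d). f (s + d + 1) (s - d))"
    by (rule infsum_parity_split[OF fs])
  also have "(\<lambda>(s, d). f (s + d) (s - d)) =
      (\<lambda>(s, d). ((v\<^sup>2) powi (s\<^sup>2) * (x * y) powi s) * ((v\<^sup>2) powi (d\<^sup>2) * (x / y) powi d))"
  proof (intro ext, clarify)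
    fix s d :: int
    have e: "(s + d)\<^sup>2 + (s - d)\<^sup>2 = 2 * s\<^sup>2 + 2 * d\<^sup>2" by (simp add: power2_eq_square algebra_simps)
    have "f (s + d) (s - d) = v powi ((s + d)\<^sup>2 + (s - d)\<^sup>2) * x powi (s + d) * y powi (s - d)"
      using assms by (simp add: f_def power_int_add)
    also have "\<dots> = ((v\<^sup>2) powi (s\<^sup>2) * (x * y) powi s) * ((v\<^sup>2) powi (d\<^sup>2) * (x / y) powi d)"
      unfolding e using assms
      by (simp add: power_int_add power_int_mult power_int_mult_distrib power_int_diff power_int_divide_distrib)
    finally show "f (s + d) (s - d) = \<dots>" .
  qed
  also have "(\<lambda>(s, d). f (s + d + 1) (s - d)) =
      (\<lambda>(s, d). v * x * (((v\<^sup>2) powi (s\<^sup>2) * (v\<^sup>2 * (x * y)) powi s) * ((v\<^sup>2) powi (d\<^sup>2) * (v\<^sup>2 * (x / y)) powi d)))"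
  proof (intro ext, clarify)
    fix s d :: int
    have e: "(s + d + 1)\<^sup>2 + (s - d)\<^sup>2 = 2 * s\<^sup>2 + 2 * d\<^sup>2 + 2 * s + 2 * d + 1"
      by (simp add: power2_eq_square algebra_simps)
    have "f (s + d + 1) (s - d) = v powi ((s + d + 1)\<^sup>2 + (s - d)\<^sup>2) * x powi (s + d + 1) * y powi (s - d)"
      using assms by (simp add: f_def power_int_add)
    also have "\<dots> = v * x * (((v\<^sup>2) powi (s\<^sup>2) * (v\<^sup>2 * (x * y)) powi s) * ((v\<^sup>2) powi (d\<^sup>2) * (v\<^sup>2 * (x / y)) powi d))"
      unfolding e using assms
      by (simp add: power_int_add power_int_mult power_int_mult_distrib power_int_diff power_int_divide_distrib)
    finally show "f (s + d + 1) (s - d) = \<dots>" .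
  qed
  also have "(\<Sum>\<^sub>\<infinity>(s, d). ((v\<^sup>2) powi (s\<^sup>2) * (x * y) powi s) * ((v\<^sup>2) powi (d\<^sup>2) * (x / y) powi d)) =
      theta (v\<^sup>2) (x * y) * theta (v\<^sup>2) (x / y)"
    using infsum_prod_mult[OF sm[of "x * y"] sm[of "x / y"]] assms by (simp add: theta_def)
  also have "(\<Sum>\<^sub>\<infinity>(s, d). v * x * (((v\<^sup>2) powi (s\<^sup>2) * (v\<^sup>2 * (x * y)) powi s) * ((v\<^sup>2) powi (d\<^sup>2) * (v\<^sup>2 * (x / y)) powi d))) =
      v * x * (theta (v\<^sup>2) (v\<^sup>2 * (x * y)) * theta (v\<^sup>2) (v\<^sup>2 * (x / y)))"
    using infsum_prod_mult[OF sm[of "v\<^sup>2 * (x * y)"] sm[of "v\<^sup>2 * (x / y)"]] assms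
    by (simp add: theta_def case_prod_unfold infsum_cmult_right')
  finally show ?thesis by (simp add: mult.assoc)
qed

text \<open>Each exponential is expanded and the sums are interchanged. The hypothesis on
  \<open>r\<close> makes the double series absolutely convergent for |x| < r, because the norms in
  row k add up to \<open>norm (c k) * exp (norm (l k) * norm x)\<close>.\<close>

lemma fourier_has_fps_expansion:
  fixes c l :: "'a \<Rightarrow> complex" and r :: real
  assumes r: "r > 0" and sm: "(\<lambda>k. norm (c k) * exp (r * norm (l k))) summable_on A"
  shows "(\<lambda>x. \<Sum>\<^sub>\<infinity>k\<in>A. c k * exp (l k * x)) has_fps_expansion Abs_fps (\<lambda>p. (\<Sum>\<^sub>\<infinity>k\<in>A. c k * l k ^ p) / fact p)"
proof (rule has_fps_expansionI)
  have "eventually (\<lambda>u::complex. u \<in> ball 0 r) (nhds 0)"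
    using r by (intro eventually_nhds_in_open) auto
  then show "\<forall>\<^sub>F u in nhds 0. (\<lambda>p. fps_nth (Abs_fps (\<lambda>p. (\<Sum>\<^sub>\<infinity>k\<in>A. c k * l k ^ p) / fact p)) p * u ^ p)
      sums (\<Sum>\<^sub>\<infinity>k\<in>A. c k * exp (l k * u))"
  proof eventually_elim
    case (elim u)
    then have u: "norm u < r" by simp
    define f where "f k p = c k * ((l k * u) ^ p / fact p)" for k p
    have hs: "((\<lambda>p. norm (f k p)) has_sum (norm (c k) * exp (norm (l k) * norm u))) UNIV" for k
    proof -
      have "(\<lambda>p. (norm (l k) * norm u) ^ p / fact p) sums exp (norm (l k) * norm u)"
        using exp_converges[of "norm (l k) * norm u"] by (simp add: field_simps)
      then have "((\<lambda>p. (norm (l k) * norm u) ^ p / fact p) has_sum exp (norm (l k) * norm u)) UNIV"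
        by (intro sums_nonneg_imp_has_sum) auto
      then have "((\<lambda>p. norm (c k) * ((norm (l k) * norm u) ^ p / fact p)) has_sum (norm (c k) * exp (norm (l k) * norm u))) UNIV"
        by (rule has_sum_cmult_right)
      then show ?thesis by (simp add: f_def norm_mult norm_divide norm_power)
    qed
    have hs': "(f k has_sum (c k * exp (l k * u))) UNIV" for k
    proof (rule norm_summable_imp_has_sum)
      show "summable (\<lambda>p. norm (f k p))"
        using hs[of k] has_sum_imp_sums sums_summable by blast
      show "f k sums (c k * exp (l k * u))"
        using sums_mult[OF exp_converges[of "l k * u"], of "c k"]
        by (simp add: f_def[abs_def] scaleR_conv_of_real field_simps)
    qed
    have "(\<lambda>k. norm (c k) * exp (norm (l k) * norm u)) summable_on A"
    proof (rule summable_on_comparison_test[OF sm])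
      fix k
      have "norm (l k) * norm u \<le> r * norm (l k)"
        using u by (subst mult.commute, intro mult_right_mono) auto
      then show "norm (c k) * exp (norm (l k) * norm u) \<le> norm (c k) * exp (r * norm (l k))"
        by (intro mult_left_mono) auto
    qed auto
    then have "(\<lambda>kp. norm (case kp of (k, p) \<Rightarrow> f k p)) summable_on A \<times> UNIV"
      by (intro summable_on_SigmaI[where g = "\<lambda>k. norm (c k) * exp (norm (l k) * norm u)"]) (use hs in auto)
    then have S: "(\<lambda>(k, p). f k p) summable_on A \<times> UNIV"
      by (rule abs_summable_summable)
    have S': "(\<lambda>(p, k). f k p) summable_on UNIV \<times> A"
      using S summable_on_swap[of "\<lambda>(k, p). f k p" A UNIV] by simp
    have "(\<lambda>p. \<Sum>\<^sub>\<infinity>k\<in>A. f k p) summable_on UNIV"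
      using summable_on_Sigma_banach[OF S'] by simp
    then have "(\<lambda>p. \<Sum>\<^sub>\<infinity>k\<in>A. f k p) sums (\<Sum>\<^sub>\<infinity>p. \<Sum>\<^sub>\<infinity>k\<in>A. f k p)"
      by (intro has_sum_imp_sums) simp
    also have "(\<Sum>\<^sub>\<infinity>p. \<Sum>\<^sub>\<infinity>k\<in>A. f k p) = (\<Sum>\<^sub>\<infinity>k\<in>A. \<Sum>\<^sub>\<infinity>p. f k p)"
      using infsum_swap_banach[OF S'] .
    also have "(\<Sum>\<^sub>\<infinity>k\<in>A. \<Sum>\<^sub>\<infinity>p. f k p) = (\<Sum>\<^sub>\<infinity>k\<in>A. c k * exp (l k * u))"
      by (simp add: infsumI[OF hs'])
    also have "(\<lambda>p. \<Sum>\<^sub>\<infinity>k\<in>A. f k p) = (\<lambda>p. fps_nth (Abs_fps (\<lambda>p. (\<Sum>\<^sub>\<infinity>k\<in>A. c k * l k ^ p) / fact p)) p * u ^ p)"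
    proof
      fix p
      have *: "f k p = c k * l k ^ p * (u ^ p / fact p)" for k
        by (simp add: f_def power_mult_distrib)
      show "(\<Sum>\<^sub>\<infinity>k\<in>A. f k p) = fps_nth (Abs_fps (\<lambda>p. (\<Sum>\<^sub>\<infinity>k\<in>A. c k * l k ^ p) / fact p)) p * u ^ p"
        unfolding * infsum_cmult_left' by simp
    qed
    finally show ?case .
  qed
qed

lemma has_fps_expansion_nth_0: "f has_fps_expansion F \<Longrightarrow> fps_nth F 0 = f 0"
  for f :: "complex \<Rightarrow> complex"
  using has_fps_expansion_imp_0_eq_fps_nth_0[of f F] by simp

lemma has_fps_expansion_has_deriv:
  fixes f :: "complex \<Rightarrow> complex"
  assumes "f has_fps_expansion F"
  shows "(f has_field_derivative fps_nth F 1) (at 0)"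
proof -
  obtain s where s: "open s" "0 \<in> s" "f holomorphic_on s"
    using has_fps_expansion_imp_holomorphic[OF assms] by metis
  then have "(f has_field_derivative deriv f 0) (at 0)"
    using holomorphic_derivI by blast
  moreover have "deriv f 0 = fps_nth F 1"
    using has_fps_expansion_nth_0[OF has_fps_expansion_deriv[OF assms]] by simp
  ultimately show ?thesis by simp
qed

text \<open>Theta constants are power series in the nome with repeated exponents. Terms of positive
  exponent carry a factor v, so together they are at most |v| / r times the majorant at r; only the
  exponent 0 survives.\<close>

lemma tendsto_power_family_0:
  fixes c :: "'a \<Rightarrow> complex" and e :: "'a \<Rightarrow> nat" and r :: real
  assumes r: "r > 0" and sm: "(\<lambda>j. norm (c j) * r ^ e j) summable_on UNIV" and fin: "finite {j. e j = 0}"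
  shows "((\<lambda>v. \<Sum>\<^sub>\<infinity>j. c j * v ^ e j) \<longlongrightarrow> (\<Sum>j\<in>{j. e j = 0}. c j)) (at 0)"
proof -
  define S where "S = {j. e j = 0}"
  define B where "B = (\<Sum>\<^sub>\<infinity>j. norm (c j) * r ^ e j) / r"
  have bd: "norm ((\<Sum>\<^sub>\<infinity>j. c j * v ^ e j) - (\<Sum>j\<in>S. c j)) \<le> norm v * B" if v: "norm v < r" for v
  proof -
    have le: "norm (c j * v ^ e j) \<le> norm (c j) * r ^ e j" for j
      using v by (auto simp: norm_mult norm_power intro!: mult_left_mono power_mono)
    have sv: "(\<lambda>j. c j * v ^ e j) summable_on UNIV"
      by (rule abs_summable_summable, rule Infinite_Sum.abs_summable_on_comparison_test'[OF sm le])
    have "(\<Sum>\<^sub>\<infinity>j. c j * v ^ e j) = (\<Sum>\<^sub>\<infinity>j\<in>S. c j * v ^ e j) + (\<Sum>\<^sub>\<infinity>j\<in>-S. c j * v ^ e j)"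
      by (subst infsum_Un_disjoint [symmetric]) (auto intro: summable_on_subset_banach[OF sv])
    also have "(\<Sum>\<^sub>\<infinity>j\<in>S. c j * v ^ e j) = (\<Sum>j\<in>S. c j)"
      using fin by (subst infsum_finite) (auto simp: S_def)
    finally have "(\<Sum>\<^sub>\<infinity>j. c j * v ^ e j) - (\<Sum>j\<in>S. c j) = (\<Sum>\<^sub>\<infinity>j\<in>-S. c j * v ^ e j)" by simp
    also have "norm \<dots> \<le> (\<Sum>\<^sub>\<infinity>j\<in>-S. norm v / r * (norm (c j) * r ^ e j))"
    proof (rule norm_infsum_le)
      show "((\<lambda>j. c j * v ^ e j) has_sum (\<Sum>\<^sub>\<infinity>j\<in>-S. c j * v ^ e j)) (-S)"
        by (intro has_sum_infsum summable_on_subset_banach[OF sv]) auto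
      show "((\<lambda>j. norm v / r * (norm (c j) * r ^ e j)) has_sum (\<Sum>\<^sub>\<infinity>j\<in>-S. norm v / r * (norm (c j) * r ^ e j))) (-S)"
        by (intro has_sum_infsum summable_on_cmult_right summable_on_subset_banach[OF sm]) auto
      fix j assume "j \<in> -S"
      then obtain m where m: "e j = Suc m" by (cases "e j") (auto simp: S_def)
      have "norm (c j * v ^ e j) = norm (c j) * norm v * norm v ^ m"
        by (simp add: m norm_mult norm_power)
      also have "\<dots> \<le> norm (c j) * norm v * r ^ m"
        using v by (intro mult_left_mono power_mono) auto
      also have "\<dots> = norm v / r * (norm (c j) * r ^ e j)"
        using r by (simp add: m)
      finally show "norm (c j * v ^ e j) \<le> norm v / r * (norm (c j) * r ^ e j)" .
    qed
    also have "\<dots> \<le> (\<Sum>\<^sub>\<infinity>j. norm v / r * (norm (c j) * r ^ e j))"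
      using r by (intro infsum_mono2 summable_on_cmult_right summable_on_subset_banach[OF sm]) auto
    also have "\<dots> = norm v * B" unfolding infsum_cmult_right' by (simp add: B_def)
    finally show ?thesis .
  qed
  have "eventually (\<lambda>v::complex. v \<in> ball 0 r) (at 0)"
    using r by (intro eventually_at_in_open') auto
  then have ev: "eventually (\<lambda>v::complex. norm ((\<Sum>\<^sub>\<infinity>j. c j * v ^ e j) - (\<Sum>j\<in>S. c j)) \<le> norm v * B) (at 0)"
    by eventually_elim (use bd in auto)
  have "((\<lambda>v. norm v * B) \<longlongrightarrow> 0 * B) (at (0::complex))"
    by (intro tendsto_mult tendsto_norm_zero tendsto_ident_at tendsto_const)
  then have "((\<lambda>v. norm v * B) \<longlongrightarrow> 0) (at (0::complex))" by simp
  then have "((\<lambda>v. (\<Sum>\<^sub>\<infinity>j. c j * v ^ e j) - (\<Sum>j\<in>S. c j)) \<longlongrightarrow> 0) (at 0)"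
    by (rule Lim_null_comparison[OF ev])
  then show ?thesis unfolding S_def by (rule Lim_null[THEN iffD2])
qed

section \<open>Theta constants\<close>

text \<open>The offset \<open>m\<close> is 0 for theta_3 and theta_4, and 1 for theta_1 and theta_2,
  whose frequencies are odd.\<close>

lemma theta_has_fps_expansion:
  assumes v: "norm v < 1" and a: "a \<noteq> 0"
  shows "(\<lambda>x. exp (of_int m * \<i> * x) * theta v (a * exp (2 * \<i> * x))) has_fps_expansion
    Abs_fps (\<lambda>p. (\<Sum>\<^sub>\<infinity>j::int. v powi (j\<^sup>2) * a powi j * (of_int (2 * j + m) * \<i>) ^ p) / fact p)"
proof -
  have "(\<lambda>j::int. norm (v powi (j\<^sup>2) * a powi j) * exp (1 * norm (of_int (2 * j + m) * \<i>))) summable_on UNIV"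
  proof (rule summable_on_comparison_test)
    show "(\<lambda>j::int. exp \<bar>of_int m\<bar> * (norm (v powi (j\<^sup>2)) * exp ((\<bar>ln (norm a)\<bar> + 2) * real_of_int \<bar>j\<bar>))) summable_on UNIV"
      by (intro summable_on_cmult_right summable_on_gaussian v)
    fix j :: int
    have "norm (v powi (j\<^sup>2) * a powi j) * exp (1 * norm (of_int (2 * j + m) * \<i>)) \<le>
        (norm (v powi (j\<^sup>2)) * exp (\<bar>ln (norm a)\<bar> * real_of_int \<bar>j\<bar>)) * exp (2 * real_of_int \<bar>j\<bar> + \<bar>of_int m\<bar>)"
    proof (intro mult_mono)
      show "norm (v powi (j\<^sup>2) * a powi j) \<le> norm (v powi (j\<^sup>2)) * exp (\<bar>ln (norm a)\<bar> * real_of_int \<bar>j\<bar>)"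
        using norm_powi_le_exp[OF a, of j] by (simp add: norm_mult mult_left_mono)
      have "norm (of_int (2 * j + m) * \<i>) = \<bar>real_of_int (2 * j + m)\<bar>"
        unfolding norm_mult norm_of_int by simp
      also have "\<dots> \<le> 2 * real_of_int \<bar>j\<bar> + \<bar>of_int m\<bar>" by simp
      finally show "exp (1 * norm (of_int (2 * j + m) * \<i>)) \<le> exp (2 * real_of_int \<bar>j\<bar> + \<bar>of_int m\<bar>)" by simp
    qed auto
    also have "\<dots> = exp \<bar>of_int m\<bar> * (norm (v powi (j\<^sup>2)) * exp ((\<bar>ln (norm a)\<bar> + 2) * real_of_int \<bar>j\<bar>))"
      by (simp add: exp_add algebra_simps)
    finally show "norm (v powi (j\<^sup>2) * a powi j) * exp (1 * norm (of_int (2 * j + m) * \<i>)) \<le> \<dots>" .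
  qed auto
  then have "(\<lambda>x. \<Sum>\<^sub>\<infinity>j::int. v powi (j\<^sup>2) * a powi j * exp (of_int (2 * j + m) * \<i> * x)) has_fps_expansion
    Abs_fps (\<lambda>p. (\<Sum>\<^sub>\<infinity>j::int. v powi (j\<^sup>2) * a powi j * (of_int (2 * j + m) * \<i>) ^ p) / fact p)"
    by (intro fourier_has_fps_expansion[of 1]) simp_all
  also have "(\<lambda>x. \<Sum>\<^sub>\<infinity>j::int. v powi (j\<^sup>2) * a powi j * exp (of_int (2 * j + m) * \<i> * x)) =
    (\<lambda>x. exp (of_int m * \<i> * x) * theta v (a * exp (2 * \<i> * x)))"
  proof
    fix x
    have "exp (of_int (2 * j + m) * \<i> * x) = exp (of_int m * \<i> * x) * exp (2 * \<i> * x) powi j" for j :: int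
      by (simp add: exp_power_int algebra_simps flip: exp_add)
    then have "(\<Sum>\<^sub>\<infinity>j::int. v powi (j\<^sup>2) * a powi j * exp (of_int (2 * j + m) * \<i> * x)) =
      (\<Sum>\<^sub>\<infinity>j::int. exp (of_int m * \<i> * x) * (v powi (j\<^sup>2) * (a * exp (2 * \<i> * x)) powi j))"
      by (intro infsum_cong) (simp add: power_int_mult_distrib)
    also have "\<dots> = exp (of_int m * \<i> * x) * theta v (a * exp (2 * \<i> * x))"
      by (simp only: infsum_cmult_right' theta_def)
    finally show "(\<Sum>\<^sub>\<infinity>j::int. v powi (j\<^sup>2) * a powi j * exp (of_int (2 * j + m) * \<i> * x)) = \<dots>" .
  qed
  finally show ?thesis .
qed

text \<open>i theta_1 without its factor q^(1/4), as a function of x; \<open>theta1_prime\<close> is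
  theta_1'(0) with the same factor removed.\<close>

definition theta1 :: "complex \<Rightarrow> complex \<Rightarrow> complex" where
  "theta1 v x = exp (\<i> * x) * theta v (- v * exp (2 * \<i> * x))"

definition theta1_prime :: "complex \<Rightarrow> complex" where
  "theta1_prime v = (\<Sum>\<^sub>\<infinity>j::int. of_int (2 * j + 1) * (v powi (j\<^sup>2) * (- v) powi j))"

lemma theta1_0: "v \<noteq> 0 \<Longrightarrow> theta1 v 0 = 0"
  by (simp add: theta1_def theta_zero)

lemma theta1_has_fps_expansion:
  assumes "norm v < 1" "v \<noteq> 0"
  shows "\<exists>F. theta1 v has_fps_expansion F \<and> fps_nth F 0 = 0 \<and> fps_nth F 1 = \<i> * theta1_prime v"
proof -
  let ?F = "Abs_fps (\<lambda>p. (\<Sum>\<^sub>\<infinity>j::int. v powi (j\<^sup>2) * (- v) powi j * (of_int (2 * j + 1) * \<i>) ^ p) / fact p)"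
  have 1: "theta1 v has_fps_expansion ?F"
    using theta_has_fps_expansion[of v "-v" 1] assms by (simp add: theta1_def[abs_def])
  have "fps_nth ?F 1 = (\<Sum>\<^sub>\<infinity>j::int. \<i> * (of_int (2 * j + 1) * (v powi (j\<^sup>2) * (- v) powi j)))"
    by (simp add: algebra_simps)
  also have "\<dots> = \<i> * theta1_prime v"
    by (simp only: infsum_cmult_right' theta1_prime_def)
  finally show ?thesis
    using 1 has_fps_expansion_nth_0[OF 1] theta1_0[OF assms(2)] by auto
qed

lemma theta1_has_deriv:
  assumes "norm v < 1" "v \<noteq> 0"
  shows "(theta1 v has_field_derivative \<i> * theta1_prime v) (at 0)"
  using theta1_has_fps_expansion[OF assms] has_fps_expansion_has_deriv by metis

section \<open>Relations between the theta constants at nomes v and v^2\<close>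

lemma theta_1_mult_theta_m1:
  assumes "norm v < 1" "v \<noteq> 0"
  shows "theta v 1 * theta v (-1) = (theta (v\<^sup>2) (-1))\<^sup>2"
  \<comment> \<open>The cross term vanishes by \<open>theta_zero\<close> at nome v^2.\<close>
  using theta_mult[of v 1 "-1"] assms by (simp add: theta_zero power2_eq_square)

text \<open>The instance x = y = v of \<open>theta_mult\<close>: after a shift its two terms
  coincide, whence the 2.\<close>

lemma theta_self_square:
  assumes "norm v < 1" "v \<noteq> 0"
  shows "(theta v v)\<^sup>2 = 2 * theta (v\<^sup>2) (v\<^sup>2) * theta (v\<^sup>2) 1"
proof -
  have "theta (v\<^sup>2) (v\<^sup>2 * (v * v)) = theta (v\<^sup>2) 1 / v\<^sup>2"
    using theta_shift[of "v\<^sup>2" 1] assms by (simp add: power2_eq_square)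
  then show ?thesis
    using theta_mult[of v v v] assms by (simp add: power2_eq_square)
qed

text \<open>Derivatives at 0 are compared in theta_1(x) theta_2(x) = theta_1(2 x) theta_4(0), the
  right-hand side at nome v^2, up to elementary factors. The 2 is the inner derivative.\<close>

lemma theta1_prime_mult_theta:
  assumes v: "norm v < 1" "v \<noteq> 0"
  shows "theta1_prime v * theta v v = 2 * theta1_prime (v\<^sup>2) * theta (v\<^sup>2) (-1)"
proof -
  have v2: "norm (v\<^sup>2) < 1" "v\<^sup>2 \<noteq> 0" using v by (auto simp: norm_power power_less_one_iff)
  define f where "f x = exp (\<i> * x) * theta v (v * exp (2 * \<i> * x))" for x
  have f: "f has_fps_expansion Abs_fps (\<lambda>p. (\<Sum>\<^sub>\<infinity>j::int. v powi (j\<^sup>2) * v powi j * (of_int (2 * j + 1) * \<i>) ^ p) / fact p)"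
    using theta_has_fps_expansion[of v v 1] v by (simp add: f_def[abs_def])
  have eq: "theta1 v x * f x = theta1 (v\<^sup>2) (2 * x) * theta (v\<^sup>2) (-1)" for x
  proof -
    let ?E = "exp (2 * \<i> * x)"
    have "theta v (- v * ?E) * theta v (v * ?E) = theta (v\<^sup>2) (- v * ?E * (v * ?E)) * theta (v\<^sup>2) (-1)"
      using theta_mult[of v "- v * ?E" "v * ?E"] v v2 by (simp add: theta_zero)
    moreover have "- v * ?E * (v * ?E) = - v\<^sup>2 * exp (2 * \<i> * (2 * x))"
    proof -
      have "exp (2 * \<i> * (2 * x)) = ?E * ?E" by (simp flip: exp_add)
      then show ?thesis by (simp add: power2_eq_square)
    qed
    moreover have "exp (\<i> * x) * exp (\<i> * x) = exp (\<i> * (2 * x))"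
      by (simp add: algebra_simps flip: exp_add)
    ultimately show ?thesis unfolding theta1_def f_def
      by (smt (verit, ccfv_threshold) mult.assoc mult.left_commute)
  qed
  have "((\<lambda>x. theta1 v x * f x) has_field_derivative \<i> * theta1_prime v * f 0) (at 0)"
    using DERIV_mult[OF theta1_has_deriv[OF v] has_fps_expansion_has_deriv[OF f]]
    by (simp add: theta1_0 v)
  moreover have "((\<lambda>x. theta1 (v\<^sup>2) (2 * x) * theta (v\<^sup>2) (-1)) has_field_derivative
     (\<i> * theta1_prime (v\<^sup>2) * 2) * theta (v\<^sup>2) (-1)) (at 0)"
    by (rule DERIV_cmult_right, rule DERIV_chain2[where g = "\<lambda>x. 2 * x"])
       (use theta1_has_deriv[OF v2] in \<open>auto intro!: derivative_eq_intros\<close>)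
  ultimately have "\<i> * theta1_prime v * f 0 = (\<i> * theta1_prime (v\<^sup>2) * 2) * theta (v\<^sup>2) (-1)"
    unfolding eq by (rule DERIV_unique)
  then show ?thesis by (simp add: f_def)
qed

text \<open>The bound j^2 - |j| covers both exponents j^2 and j^2 + j, and exp (2 |j| + 1) covers
  coefficients of size 1 and |2 j + 1|, so one statement serves all four constants.\<close>

lemma tendsto_gaussian_0:
  fixes c :: "int \<Rightarrow> complex" and e :: "int \<Rightarrow> nat"
  assumes c: "\<And>j. norm (c j) \<le> exp (2 * \<bar>real_of_int j\<bar> + 1)" and e: "\<And>j. int (e j) \<ge> j\<^sup>2 - \<bar>j\<bar>"
  shows "((\<lambda>v. \<Sum>\<^sub>\<infinity>j. c j * v ^ e j) \<longlongrightarrow> (\<Sum>j\<in>{j. e j = 0}. c j)) (at 0)"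
proof (rule tendsto_power_family_0)
  show "(1/2::real) > 0" by simp
  have "\<bar>j\<bar> \<le> 1" if "e j = 0" for j
  proof (rule ccontr)
    assume "\<not> \<bar>j\<bar> \<le> 1"
    then have "\<bar>j\<bar> * 1 < \<bar>j\<bar> * \<bar>j\<bar>" by (intro mult_strict_left_mono) auto
    then have "j\<^sup>2 - \<bar>j\<bar> > 0" by (simp add: power2_eq_square)
    with e[of j] that show False by simp
  qed
  then have "{j. e j = 0} \<subseteq> {-1..1}" by (auto simp: abs_le_iff)
  then show "finite {j. e j = 0}" by (rule finite_subset) simp
  show "(\<lambda>j. norm (c j) * (1/2::real) ^ e j) summable_on UNIV"
  proof (rule summable_on_comparison_test)
    show "(\<lambda>j. exp 1 * (norm ((1/2::complex) powi (j\<^sup>2)) * exp (3 * real_of_int \<bar>j\<bar>))) summable_on UNIV"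
      by (intro summable_on_cmult_right summable_on_gaussian) simp
    fix j :: int
    have "(1/2::real) ^ e j = (1/2) powi int (e j)" by simp
    also have "\<dots> \<le> (1/2) powi (j\<^sup>2 - \<bar>j\<bar>)" using e[of j] by (intro power_int_decreasing) auto
    also have "\<dots> = (1/2) powi (j\<^sup>2) * 2 ^ nat \<bar>j\<bar>"
    proof -
      have "(1/2::real) powi (j\<^sup>2 - \<bar>j\<bar>) = (1/2) powi (j\<^sup>2) / (1/2) powi \<bar>j\<bar>"
        by (rule power_int_diff) simp
      also have "(1/2::real) powi \<bar>j\<bar> = (1/2) ^ nat \<bar>j\<bar>" by (simp add: power_int_def)
      finally show ?thesis by (simp add: power_divide)
    qed
    also have "(2::real) ^ nat \<bar>j\<bar> \<le> exp 1 ^ nat \<bar>j\<bar>"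
      using exp_ge_add_one_self[of 1] by (intro power_mono) auto
    also have "exp (1::real) ^ nat \<bar>j\<bar> = exp (real_of_int \<bar>j\<bar>)"
      by (simp flip: exp_of_nat_mult)
    finally have "(1/2::real) ^ e j \<le> (1/2) powi (j\<^sup>2) * exp (real_of_int \<bar>j\<bar>)" by simp
    then have "norm (c j) * (1/2::real) ^ e j \<le> exp (2 * \<bar>real_of_int j\<bar> + 1) * ((1/2) powi (j\<^sup>2) * exp (real_of_int \<bar>j\<bar>))"
      by (intro mult_mono c) auto
    also have "\<dots> = exp 1 * (norm ((1/2::complex) powi (j\<^sup>2)) * exp (3 * real_of_int \<bar>j\<bar>))"
      by (simp add: norm_power_int norm_divide exp_add algebra_simps flip: exp_add)
    finally show "norm (c j) * (1/2::real) ^ e j \<le> \<dots>" .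
  qed auto
qed

lemma powi_square_mult_powi:
  fixes v :: complex
  assumes "v \<noteq> 0"
  shows "v powi (j\<^sup>2) * v powi j = v ^ nat (j\<^sup>2 + j)"
proof -
  have "j\<^sup>2 + j \<ge> 0"
    using mult_nonneg_nonneg[of j "j + 1"] mult_nonpos_nonpos[of j "j + 1"]
    by (cases "j \<ge> 0") (auto simp: power2_eq_square algebra_simps)
  then show ?thesis using assms by (simp flip: power_int_add power_int_of_nat)
qed

lemma powi_square: "(v::complex) powi (j\<^sup>2) = v ^ nat (j\<^sup>2)"
  by (metis power_int_def zero_le_power2)

lemma nat_square_add_eq_0: "{j::int. nat (j\<^sup>2 + j) = 0} = {0, -1}"
proof -
  have "nat (j\<^sup>2 + j) = 0 \<longleftrightarrow> j = 0 \<or> j = -1" for j :: int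
  proof
    assume "nat (j\<^sup>2 + j) = 0"
    then have "j * (j + 1) \<le> 0" by (simp add: power2_eq_square algebra_simps)
    then have "j \<le> 0" "j \<ge> -1" by (auto simp: mult_le_0_iff)
    then show "j = 0 \<or> j = -1" by auto
  qed auto
  then show ?thesis by auto
qed

lemma le_exp_2_add_1: "1 \<le> exp (2 * \<bar>x\<bar> + 1)" "\<bar>2 * x + 1\<bar> \<le> exp (2 * \<bar>x\<bar> + 1)" for x :: real
  using exp_ge_add_one_self[of "2 * \<bar>x\<bar> + 1"] by auto

lemma tendsto_theta_1: "((\<lambda>v. theta v 1) \<longlongrightarrow> 1) (at 0)"
proof -
  have "{j::int. nat (j\<^sup>2) = 0} = {0}" by auto
  then show ?thesis
    using tendsto_gaussian_0[of "\<lambda>_. 1" "\<lambda>j. nat (j\<^sup>2)"] le_exp_2_add_1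
    by (simp add: theta_def powi_square)
qed

lemma tendsto_theta_m1: "((\<lambda>v. theta v (-1)) \<longlongrightarrow> 1) (at 0)"
proof -
  have "{j::int. nat (j\<^sup>2) = 0} = {0}" by auto
  then show ?thesis
    using tendsto_gaussian_0[of "\<lambda>j. (-1) powi j" "\<lambda>j. nat (j\<^sup>2)"] le_exp_2_add_1
    by (simp add: theta_def powi_square norm_power_int mult.commute)
qed

lemma tendsto_theta_self: "((\<lambda>v. theta v v) \<longlongrightarrow> 2) (at 0)"
proof -
  have "int (nat (j\<^sup>2 + j)) \<ge> j\<^sup>2 - \<bar>j\<bar>" for j :: int by linarith
  then have "((\<lambda>v. \<Sum>\<^sub>\<infinity>j::int. 1 * v ^ nat (j\<^sup>2 + j)) \<longlongrightarrow> (2::complex)) (at 0)"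
    using tendsto_gaussian_0[of "\<lambda>_. 1" "\<lambda>j. nat (j\<^sup>2 + j)"] le_exp_2_add_1
    unfolding nat_square_add_eq_0 by simp
  \<comment> \<open>At v = 0 the two sides differ: the term j = -1 is 1 on the left, but 0 in
    \<open>theta 0 0\<close>. The limit ignores that point.\<close>
  moreover have "eventually (\<lambda>v::complex. (\<Sum>\<^sub>\<infinity>j::int. 1 * v ^ nat (j\<^sup>2 + j)) = theta v v) (at 0)"
    by (subst eventually_at_filter) (auto simp: theta_def powi_square_mult_powi)
  ultimately show ?thesis by (rule Lim_transform_eventually)
qed

lemma tendsto_theta1_prime: "(theta1_prime \<longlongrightarrow> 2) (at 0)"
proof -
  let ?c = "\<lambda>j::int. of_int (2 * j + 1) * (-1) powi j :: complex"
  have e: "int (nat (j\<^sup>2 + j)) \<ge> j\<^sup>2 - \<bar>j\<bar>" for j :: int by linarith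
  have c: "norm (?c j) \<le> exp (2 * \<bar>real_of_int j\<bar> + 1)" for j
  proof -
    have "norm (?c j) = \<bar>2 * real_of_int j + 1\<bar>"
      unfolding norm_mult norm_of_int norm_power_int by simp
    then show ?thesis using le_exp_2_add_1 by simp
  qed
  have "((\<lambda>v. \<Sum>\<^sub>\<infinity>j::int. ?c j * v ^ nat (j\<^sup>2 + j)) \<longlongrightarrow> (2::complex)) (at 0)"
    using tendsto_gaussian_0[of ?c "\<lambda>j. nat (j\<^sup>2 + j)", OF c e]
    unfolding nat_square_add_eq_0 by simp
  moreover have "(\<Sum>\<^sub>\<infinity>j::int. ?c j * v ^ nat (j\<^sup>2 + j)) = theta1_prime v" if "v \<noteq> 0" for v
  proof -
    have "?c j * v ^ nat (j\<^sup>2 + j) = of_int (2 * j + 1) * (v powi (j\<^sup>2) * (- v) powi j)" for j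
      using that powi_square_mult_powi[of v j, symmetric] power_int_mult_distrib[of "-1" v j] by simp
    then show ?thesis unfolding theta1_prime_def by presburger
  qed
  then have "eventually (\<lambda>v. (\<Sum>\<^sub>\<infinity>j::int. ?c j * v ^ nat (j\<^sup>2 + j)) = theta1_prime v) (at 0)"
    by (subst eventually_at_filter) auto
  ultimately show ?thesis by (rule Lim_transform_eventually)
qed

section \<open>Iterated squaring of the nome: nonvanishing and Jacobi's derivative formula\<close>

lemma norm_square_lt_1: "norm v < 1 \<Longrightarrow> norm (v\<^sup>2) < 1" for v :: complex
  by (simp add: norm_power power_less_one_iff)

lemma filterlim_iterated_square:
  fixes v :: complex
  assumes "norm v < 1" "v \<noteq> 0"
  shows "filterlim (\<lambda>k. v ^ (2 ^ k)) (at 0) sequentially"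
proof -
  have "(\<lambda>k. v ^ (2 ^ k)) \<longlonglongrightarrow> 0"
  proof (rule filterlim_compose[OF LIMSEQ_power_zero])
    show "filterlim (\<lambda>k. 2 ^ k :: nat) sequentially sequentially"
      by (rule filterlim_subseq) (simp add: strict_mono_def)
  qed (use assms in auto)
  then show ?thesis using assms by (auto simp: filterlim_at)
qed

text \<open>The nomes v, v^2, v^4, ... tend to 0, so an invariant function equals its limit
  there.\<close>

lemma iterated_square_invariant:
  fixes f :: "complex \<Rightarrow> complex" and v l :: complex
  assumes step: "\<And>u. norm u < 1 \<Longrightarrow> u \<noteq> 0 \<Longrightarrow> f (u\<^sup>2) = f u" and lim: "(f \<longlongrightarrow> l) (at 0)"
    and v: "norm v < 1" "v \<noteq> 0"
  shows "f v = l"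
proof -
  have "f (v ^ (2 ^ k)) = f v" for k
  proof (induction k)
    case (Suc k)
    have "f (v ^ 2 ^ Suc k) = f ((v ^ 2 ^ k)\<^sup>2)" by (simp add: mult.commute flip: power_mult)
    also have "\<dots> = f (v ^ 2 ^ k)" using v by (intro step) (auto simp: norm_power power_less_one_iff)
    finally show ?case using Suc by simp
  qed simp
  then have "(\<lambda>k. f v) \<longlonglongrightarrow> l"
    using filterlim_compose[OF lim filterlim_iterated_square[OF v]] by simp
  then show ?thesis by (simp add: LIMSEQ_const_iff)
qed

text \<open>A zero would propagate along v, v^2, v^4, ..., against the nonzero limit at 0.\<close>

lemma nonzero_iterated_square:
  fixes f :: "complex \<Rightarrow> complex" and v l :: complex
  assumes step: "\<And>u. norm u < 1 \<Longrightarrow> u \<noteq> 0 \<Longrightarrow> f u = 0 \<Longrightarrow> f (u\<^sup>2) = 0" and lim: "(f \<longlongrightarrow> l) (at 0)"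
    and v: "norm v < 1" "v \<noteq> 0" and "l \<noteq> 0"
  shows "f v \<noteq> 0"
proof
  assume z: "f v = 0"
  have "f (v ^ (2 ^ k)) = 0" for k
  proof (induction k)
    case (Suc k)
    have "f (v ^ 2 ^ Suc k) = f ((v ^ 2 ^ k)\<^sup>2)" by (simp add: mult.commute flip: power_mult)
    also have "\<dots> = 0" using v Suc by (intro step) (auto simp: norm_power power_less_one_iff)
    finally show ?case .
  qed (use z in simp)
  then have "(\<lambda>k. 0) \<longlonglongrightarrow> l"
    using filterlim_compose[OF lim filterlim_iterated_square[OF v]] by simp
  then show False using \<open>l \<noteq> 0\<close> by (simp add: LIMSEQ_const_iff)
qed

text \<open>The order of the three results matters: a zero of theta_4 reproduces itself under
  squaring, theta_3 divides a square of theta_4, and the step for theta_2 has to cancel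
  theta_3.\<close>

lemma theta_m1_nonzero:
  assumes "norm v < 1" "v \<noteq> 0" shows "theta v (-1) \<noteq> 0"
  by (rule nonzero_iterated_square[where f = "\<lambda>v. theta v (-1)", OF _ tendsto_theta_m1 assms])
     (use theta_1_mult_theta_m1 in force)+

lemma theta_1_nonzero:
  assumes "norm v < 1" "v \<noteq> 0" shows "theta v 1 \<noteq> 0"
  using theta_m1_nonzero[of "v\<^sup>2"] theta_1_mult_theta_m1[OF assms] assms norm_square_lt_1 by force

lemma theta_self_nonzero:
  assumes "norm v < 1" "v \<noteq> 0" shows "theta v v \<noteq> 0"
proof (rule nonzero_iterated_square[where f = "\<lambda>v. theta v v", OF _ tendsto_theta_self assms])
  fix u :: complex assume "norm u < 1" "u \<noteq> 0" "theta u u = 0"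
  then show "theta (u\<^sup>2) (u\<^sup>2) = 0"
    using theta_self_square[of u] theta_1_nonzero[of "u\<^sup>2"] norm_square_lt_1 by force
qed simp

text \<open>Jacobi's identity \<open>\<theta>\<^sub>1' = \<theta>\<^sub>2 \<theta>\<^sub>3 \<theta>\<^sub>4\<close>: the quotient of both sides is invariant under
  \<open>v \<mapsto> v\<^sup>2\<close> by the Landen-type relations above, and tends to \<open>1\<close> as \<open>v \<rightarrow> 0\<close>.\<close>

theorem theta1_prime_eq:
  assumes "norm v < 1" "v \<noteq> 0"
  shows "theta1_prime v = theta v v * theta v 1 * theta v (-1)"
proof -
  define f where "f v = theta1_prime v / (theta v v * theta v 1 * theta v (-1))" for v
  have "f v = 1"
  proof (rule iterated_square_invariant[OF _ _ assms])
    fix u :: complex assume u: "norm u < 1" "u \<noteq> 0"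
    then have u2: "norm (u\<^sup>2) < 1" "u\<^sup>2 \<noteq> 0" using norm_square_lt_1 by auto
    note nz = theta_m1_nonzero[OF u] theta_1_nonzero[OF u] theta_self_nonzero[OF u]
      theta_m1_nonzero[OF u2] theta_1_nonzero[OF u2] theta_self_nonzero[OF u2]
    have "f u = (theta1_prime u * theta u u) / ((theta u u)\<^sup>2 * (theta u 1 * theta u (-1)))"
      using nz by (simp add: f_def power2_eq_square)
    also have "\<dots> = f (u\<^sup>2)"
      unfolding theta1_prime_mult_theta[OF u] theta_self_square[OF u] theta_1_mult_theta_m1[OF u] f_def
      using nz by (simp add: field_simps power2_eq_square)
    finally show "f (u\<^sup>2) = f u" ..
  next
    have "(f \<longlongrightarrow> 2 / (2 * 1 * 1)) (at 0)"
      unfolding f_def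
      by (intro tendsto_intros tendsto_theta1_prime tendsto_theta_self tendsto_theta_1 tendsto_theta_m1) auto
    then show "(f \<longlongrightarrow> 1) (at 0)" by simp
  qed
  then show ?thesis
    using theta_m1_nonzero[OF assms] theta_1_nonzero[OF assms] theta_self_nonzero[OF assms]
    by (simp add: f_def field_simps)
qed

section \<open>Theta functions and the Fourier series of cn\<close>

lemma summable_on_geometric_int:
  fixes \<rho> :: real
  assumes "0 \<le> \<rho>" "\<rho> < 1"
  shows "(\<lambda>k::int. \<rho> ^ nat \<bar>2 * k + 1\<bar>) summable_on UNIV"
proof (rule summable_on_comparison_test)
  have "(\<lambda>n::nat. \<rho> ^ n) summable_on UNIV"
    using assms summable_geometric[of \<rho>]
    by (intro norm_summable_imp_summable_on) (auto simp: abs_mult)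
  then show "(\<lambda>k::int. \<rho> ^ nat \<bar>k\<bar>) summable_on UNIV"
    by (intro summable_on_int_split) auto
  show "\<rho> ^ nat \<bar>2 * k + 1\<bar> \<le> \<rho> ^ nat \<bar>k\<bar>" for k :: int
    using assms by (intro power_decreasing) auto
qed (use assms in auto)

locale nome =
  fixes w q :: complex
  assumes q_def: "q = w\<^sup>2" and w_nonzero: "w \<noteq> 0" and norm_w: "norm w < 1"
begin

lemma q_nonzero: "q \<noteq> 0" and norm_q: "norm q < 1"
  using norm_w w_nonzero norm_square_lt_1 by (auto simp: q_def)

text \<open>At \<open>z = e\<^sup>i\<^sup>x\<close>, \<open>th3\<close> and \<open>th4\<close> are \<open>\<theta>\<^sub>3\<close> and \<open>\<theta>\<^sub>4\<close>, while \<open>t1\<close> and \<open>t2\<close> are \<open>i \<theta>\<^sub>1\<close> and \<open>\<theta>\<^sub>2\<close>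
  without the factor \<open>q\<^sup>1\<^sup>/\<^sup>4\<close>, so that no further roots of \<open>q\<close> are needed. The function \<open>G\<close> is
  proportional to \<open>\<theta>\<^sub>1 \<theta>\<^sub>3\<close>, the numerator of \<open>sn dn\<close>; being a single theta series of nome \<open>i w\<close>, it makes
  \<open>G_mult\<close> an instance of \<open>theta_mult\<close>.\<close>

definition th4 where "th4 z = theta q (- (z\<^sup>2))"
definition th3 where "th3 z = theta q (z\<^sup>2)"
definition t2 where "t2 z = z * theta q (q * z\<^sup>2)"
definition t1 where "t1 z = z * theta q (- q * z\<^sup>2)"
definition G where "G z = z * theta (\<i> * w) (- \<i> * w * z\<^sup>2)"

text \<open>Divided by \<open>th4 (z * y) * th4 (z / y)\<close>, the right-hand side is theta_2 /
  theta_4 at the sum of the two angles minus its value at their difference: this is the numerator of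
  the addition theorem.\<close>

lemma G_mult:
  assumes "z \<noteq> 0" "y \<noteq> 0"
  shows "G z * G y = t2 (z * y) * th4 (z / y) - t2 (z / y) * th4 (z * y)"
proof -
  have v: "norm (\<i> * w) < 1" "\<i> * w \<noteq> 0" "(\<i> * w)\<^sup>2 = - q"
    using norm_w w_nonzero by (auto simp: norm_mult q_def power_mult_distrib)
  have xy: "- \<i> * w * z\<^sup>2 * (- \<i> * w * y\<^sup>2) = - (q * (z * y)\<^sup>2)"
    by (simp add: q_def power2_eq_square algebra_simps)
  have x_y: "- \<i> * w * z\<^sup>2 / (- \<i> * w * y\<^sup>2) = (z / y)\<^sup>2"
    using w_nonzero by (simp add: power_divide)
  have "theta (\<i> * w) (- \<i> * w * z\<^sup>2) * theta (\<i> * w) (- \<i> * w * y\<^sup>2) =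
     theta (- q) (- (q * (z * y)\<^sup>2)) * theta (- q) ((z / y)\<^sup>2)
     + (\<i> * w) * (- \<i> * w * z\<^sup>2) * theta (- q) (- q * (- (q * (z * y)\<^sup>2))) * theta (- q) (- q * (z / y)\<^sup>2)"
    using theta_mult[OF v(1,2), of "- \<i> * w * z\<^sup>2" "- \<i> * w * y\<^sup>2"] assms w_nonzero
    unfolding v(3) xy x_y by simp
  also have "(\<i> * w) * (- \<i> * w * z\<^sup>2) = q * z\<^sup>2" by (simp add: q_def power2_eq_square algebra_simps)
  \<comment> \<open>The nome is (i w)^2 = -q; \<open>theta_minus\<close> moves its sign into the
    argument, and a shift by q^2 remains.\<close>
  also have "theta (- q) (- q * (- (q * (z * y)\<^sup>2))) = theta q (q\<^sup>2 * (- ((z * y)\<^sup>2)))"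
    by (simp add: theta_minus power2_eq_square mult.assoc)
  also have "\<dots> = th4 (z * y) / (- q * (z * y)\<^sup>2)"
    using assms q_nonzero by (subst theta_shift) (auto simp: th4_def)
  also have "theta (- q) (- (q * (z * y)\<^sup>2)) = theta q (q * (z * y)\<^sup>2)" by (simp add: theta_minus)
  also have "theta (- q) ((z / y)\<^sup>2) = th4 (z / y)" by (simp add: theta_minus th4_def)
  also have "theta (- q) (- q * (z / y)\<^sup>2) = theta q (q * (z / y)\<^sup>2)" by (simp add: theta_minus)
  finally have *: "theta (\<i> * w) (- \<i> * w * z\<^sup>2) * theta (\<i> * w) (- \<i> * w * y\<^sup>2) =
     theta q (q * (z * y)\<^sup>2) * th4 (z / y) + q * z\<^sup>2 * (th4 (z * y) / (- q * (z * y)\<^sup>2)) * theta q (q * (z / y)\<^sup>2)" .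
  have "G z * G y = z * y * (theta (\<i> * w) (- \<i> * w * z\<^sup>2) * theta (\<i> * w) (- \<i> * w * y\<^sup>2))"
    by (simp add: G_def)
  also have "\<dots> = z * y * theta q (q * (z * y)\<^sup>2) * th4 (z / y)
      + z * y * (q * z\<^sup>2 / (- q * (z * y)\<^sup>2)) * theta q (q * (z / y)\<^sup>2) * th4 (z * y)"
    unfolding * by (simp add: algebra_simps)
  also have "z * y * (q * z\<^sup>2 / (- q * (z * y)\<^sup>2)) = - (z / y)"
    using assms q_nonzero by (simp add: field_simps power2_eq_square)
  finally show ?thesis by (simp add: t2_def)
qed

section \<open>The addition formula for theta_4\<close>

definition thE where "thE z = theta (q\<^sup>2) (z ^ 4)"
definition thO where "thO z = z\<^sup>2 * theta (q\<^sup>2) (q\<^sup>2 * z ^ 4)"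

text \<open>\<open>thE\<close> and \<open>thO\<close> are theta_3 and theta_2 of twice the angle at
  nome q^2, the latter without q^(1/2). In them, products at z y and z / y become bilinear
  forms.\<close>

lemma th4_mult:
  assumes "z \<noteq> 0" "y \<noteq> 0"
  shows "th4 (z * y) * th4 (z / y) = thE z * thE y - q * thO z * thO y"
proof -
  have e: "- ((z * y)\<^sup>2) * - ((z / y)\<^sup>2) = z ^ 4" "- ((z * y)\<^sup>2) / - ((z / y)\<^sup>2) = y ^ 4"
    using assms by (simp_all add: field_simps power2_eq_square power4_eq_xxxx)
  show ?thesis
    using theta_mult[OF norm_q q_nonzero, of "- ((z * y)\<^sup>2)" "- ((z / y)\<^sup>2)"] assms
    unfolding e by (simp add: th4_def thE_def thO_def algebra_simps)
qed

lemma t1_mult: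
  assumes "z \<noteq> 0" "y \<noteq> 0"
  shows "t1 (z * y) * t1 (z / y) = thO z * thE y - thE z * thO y"
proof -
  have e: "(- q * (z * y)\<^sup>2) * (- q * (z / y)\<^sup>2) = q\<^sup>2 * z ^ 4" "(- q * (z * y)\<^sup>2) / (- q * (z / y)\<^sup>2) = y ^ 4"
    using assms q_nonzero by (simp_all add: field_simps power2_eq_square power4_eq_xxxx)
  have s: "theta (q\<^sup>2) (q\<^sup>2 * (q\<^sup>2 * z ^ 4)) = thE z / (q\<^sup>2 * z ^ 4)"
    using theta_shift[of "q\<^sup>2" "z ^ 4"] assms q_nonzero by (simp add: thE_def power2_eq_square mult.assoc)
  have "theta q (- q * (z * y)\<^sup>2) * theta q (- q * (z / y)\<^sup>2) = theta (q\<^sup>2) (q\<^sup>2 * z ^ 4) * thE y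
     + q * (- q * (z * y)\<^sup>2) * (thE z / (q\<^sup>2 * z ^ 4)) * theta (q\<^sup>2) (q\<^sup>2 * y ^ 4)"
    using theta_mult[OF norm_q q_nonzero, of "- q * (z * y)\<^sup>2" "- q * (z / y)\<^sup>2"] assms q_nonzero
    unfolding e s by (simp add: thE_def)
  then have "t1 (z * y) * t1 (z / y) = (z * y) * (z / y) * (theta (q\<^sup>2) (q\<^sup>2 * z ^ 4) * thE y
     + q * (- q * (z * y)\<^sup>2) * (thE z / (q\<^sup>2 * z ^ 4)) * theta (q\<^sup>2) (q\<^sup>2 * y ^ 4))"
    unfolding t1_def by (simp only: mult_ac)
  also have "\<dots> = thO z * thE y - thE z * thO y"
    using assms q_nonzero by (simp add: thO_def field_simps power2_eq_square power4_eq_xxxx)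
  finally show ?thesis .
qed

text \<open>With y = 1, \<open>th4_mult\<close> and \<open>t1_mult\<close> express all squares by
  \<open>thE\<close> and \<open>thO\<close>. What remains is the polynomial identity (a c - q b d)
  (e^2 - q f^2) = (a e - q b f) (c e - q d f) - q (b e - a f) (d e - c f).\<close>

lemma th4_addition:
  assumes "z \<noteq> 0" "y \<noteq> 0"
  shows "th4 (z * y) * th4 (z / y) * (th4 1)\<^sup>2 = (th4 z)\<^sup>2 * (th4 y)\<^sup>2 - q * (t1 z)\<^sup>2 * (t1 y)\<^sup>2"
proof -
  have 4: "(th4 x)\<^sup>2 = thE x * thE 1 - q * thO x * thO 1" if "x \<noteq> 0" for x
    using th4_mult[OF that, of 1] by (simp add: power2_eq_square)
  have 1: "(t1 x)\<^sup>2 = thO x * thE 1 - thE x * thO 1" if "x \<noteq> 0" for x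
    using t1_mult[OF that, of 1] by (simp add: power2_eq_square)
  show ?thesis unfolding th4_mult[OF assms] 4[OF assms(1)] 4[OF assms(2)] 4[OF one_neq_zero] 1[OF assms(1)] 1[OF assms(2)]
    by (simp add: power2_eq_square algebra_simps)
qed

text \<open>At \<open>y = \<i>\<close> the shift by pi/2 turns \<open>t2\<close> into
  \<open>t1\<close> and \<open>th4\<close> into \<open>th3\<close>, up to constants, and the two
  terms of \<open>G_mult\<close> become equal. This is what makes \<open>G\<close> a multiple of
  theta_1 theta_3.\<close>

lemma G_mult_G_i:
  assumes "z \<noteq> 0"
  shows "G z * G \<i> = 2 * \<i> * t1 z * th3 z"
  using G_mult[OF assms, of \<i>]
  by (simp add: t2_def t1_def th4_def th3_def power_mult_distrib power_divide field_simps)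

lemma G_i_square: "(G \<i>)\<^sup>2 = - 2 * theta q q * theta q (-1)"
  using G_mult_G_i[of \<i>] by (simp add: t1_def th3_def power2_eq_square)

section \<open>The Fourier series of cn and its product with theta_4\<close>

definition lam :: "nat \<Rightarrow> complex" where "lam m = w ^ m / (1 + w ^ (2 * m))"

lemma norm_lam_le:
  assumes "m \<ge> 1"
  shows "norm (lam m) \<le> norm w ^ m / (1 - (norm w)\<^sup>2)" and "1 + w ^ (2 * m) \<noteq> 0"
proof -
  have "norm w ^ (2 * m) \<le> (norm w)\<^sup>2"
    using assms norm_w by (intro power_decreasing) auto
  then have a: "1 - (norm w)\<^sup>2 \<le> norm (1 + w ^ (2 * m))"
    using norm_triangle_ineq2[of 1 "- (w ^ (2 * m))"] by (simp add: norm_power)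
  have b: "1 - (norm w)\<^sup>2 > 0" using norm_w by (simp add: power_less_one_iff)
  show "1 + w ^ (2 * m) \<noteq> 0" using a b by auto
  show "norm (lam m) \<le> norm w ^ m / (1 - (norm w)\<^sup>2)"
    unfolding lam_def norm_divide norm_power using a b order.strict_trans2[OF b a]
    by (intro divide_left_mono mult_pos_pos) auto
qed

text \<open>With m = 2 k + 1 this is 1 / (w^m + w^(-m)), the coefficient q^(m/2) / (1 + q^m) of cn;
  the absolute value makes the symmetry m -> -m visible.\<close>

definition cf :: "int \<Rightarrow> complex" where "cf k = lam (nat \<bar>2 * k + 1\<bar>)"

lemma norm_cf_le: "norm (cf k) \<le> norm w ^ nat \<bar>2 * k + 1\<bar> / (1 - (norm w)\<^sup>2)"
proof -
  have "2 * k + 1 \<noteq> 0" by presburger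
  then show ?thesis unfolding cf_def by (intro norm_lam_le) simp
qed

lemma cf_mult: "cf k * (w powi (2 * k + 1) + w powi (- (2 * k + 1))) = 1"
proof -
  define m where "m = nat \<bar>2 * k + 1\<bar>"
  have "2 * k + 1 \<noteq> 0" by presburger
  then have m: "m \<ge> 1" by (simp add: m_def)
  have "w powi (2 * k + 1) + w powi (- (2 * k + 1)) = w powi int m + w powi (- int m)"
    by (cases "2 * k + 1 \<ge> 0") (auto simp: m_def add.commute)
  also have "\<dots> = (1 + w ^ (2 * m)) / w ^ m"
    using w_nonzero by (simp add: power_int_minus field_simps flip: power_add mult_2)
  finally show ?thesis using norm_lam_le(2)[OF m] w_nonzero
    by (simp add: cf_def lam_def flip: m_def)
qed

lemma summable_cf_exp:
  assumes "norm w * exp r < 1"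
  shows "(\<lambda>k. norm (cf k) * exp (r * \<bar>real_of_int (2 * k + 1)\<bar>)) summable_on UNIV"
proof (rule summable_on_comparison_test)
  show "(\<lambda>k::int. (norm w * exp r) ^ nat \<bar>2 * k + 1\<bar> / (1 - (norm w)\<^sup>2)) summable_on UNIV"
    unfolding divide_inverse using assms
    by (intro summable_on_cmult_left summable_on_geometric_int) auto
  fix k :: int
  have "exp (r * \<bar>real_of_int (2 * k + 1)\<bar>) = exp r ^ nat \<bar>2 * k + 1\<bar>"
    by (simp add: mult.commute flip: exp_of_nat_mult)
  then show "norm (cf k) * exp (r * \<bar>real_of_int (2 * k + 1)\<bar>) \<le> (norm w * exp r) ^ nat \<bar>2 * k + 1\<bar> / (1 - (norm w)\<^sup>2)"
    using mult_right_mono[OF norm_cf_le[of k], of "exp r ^ nat \<bar>2 * k + 1\<bar>"] by (simp add: power_mult_distrib)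
qed auto

text \<open>The Fourier series of \<open>cn\<close>; \<open>Cn_mult_th4\<close> identifies it with a multiple of \<open>\<theta>\<^sub>2 / \<theta>\<^sub>4\<close> by
  comparing coefficients.\<close>

definition Cn where "Cn z = (\<Sum>\<^sub>\<infinity>k::int. cf k * z powi (2 * k + 1))"

lemma Cn_summable:
  assumes "norm w < norm z" "norm z * norm w < 1"
  shows "(\<lambda>k::int. cf k * z powi (2 * k + 1)) summable_on UNIV"
proof -
  have z: "z \<noteq> 0" using assms by auto
  let ?r = "\<bar>ln (norm z)\<bar>"
  \<comment> \<open>exp |ln |z|| is the larger of |z| and 1 / |z|, so this is where both bounds of
    the annulus enter.\<close>
  have "norm w * exp ?r < 1"
  proof (cases "norm z \<ge> 1")
    case True then show ?thesis using assms z by (simp add: mult.commute)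
  next
    case False
    then have "ln (norm z) < 0" using z by simp
    then show ?thesis using assms z by (simp add: exp_minus field_simps)
  qed
  then have *: "(\<lambda>k. norm (cf k) * exp (?r * \<bar>real_of_int (2 * k + 1)\<bar>)) summable_on UNIV"
    by (rule summable_cf_exp)
  have "(\<lambda>k. norm (cf k * z powi (2 * k + 1))) summable_on UNIV"
    by (rule Infinite_Sum.abs_summable_on_comparison_test'[OF *])
       (use norm_powi_le_exp[OF z] in \<open>auto simp only: norm_mult of_int_abs intro!: mult_left_mono\<close>, auto)
  then show ?thesis by (rule abs_summable_summable)
qed

text \<open>The coefficient of \<open>z powi (2 * s + 1)\<close> in the Laurent series of
  \<open>Cn z * th4 z\<close>.\<close>

definition u where "u s = (\<Sum>\<^sub>\<infinity>j::int. q powi (j\<^sup>2) * (-1) powi j * cf (s - j))"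

lemma norm_cf_le': "norm (cf k) \<le> 1 / (1 - (norm w)\<^sup>2)"
proof -
  have "norm w ^ nat \<bar>2 * k + 1\<bar> / (1 - (norm w)\<^sup>2) \<le> 1 / (1 - (norm w)\<^sup>2)"
    using norm_w by (intro divide_right_mono power_le_one) (auto simp: power_le_one)
  with norm_cf_le[of k] show ?thesis by linarith
qed

lemma u_summable:
  "(\<lambda>j::int. q powi (j\<^sup>2) * (-1) powi j * cf (s - j)) summable_on UNIV"
proof -
  have *: "(\<lambda>j::int. norm (q powi (j\<^sup>2)) * exp (0 * real_of_int \<bar>j\<bar>) * (1 / (1 - (norm w)\<^sup>2))) summable_on UNIV"
    by (intro summable_on_cmult_left summable_on_gaussian norm_q)
  have "(\<lambda>j. norm (q powi (j\<^sup>2) * (-1) powi j * cf (s - j))) summable_on UNIV"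
  proof (rule Infinite_Sum.abs_summable_on_comparison_test'[OF *])
    fix j :: int
    show "norm (q powi (j\<^sup>2) * (-1) powi j * cf (s - j)) \<le> norm (q powi (j\<^sup>2)) * exp (0 * real_of_int \<bar>j\<bar>) * (1 / (1 - (norm w)\<^sup>2))"
      using mult_left_mono[OF norm_cf_le'[of "s - j"], of "norm (q powi (j\<^sup>2))"]
      by (simp add: norm_mult norm_power_int)
  qed
  then show ?thesis by (rule abs_summable_summable)
qed

text \<open>After an index shift in one of the sums, \<open>cf_mult\<close> cancels the denominators
  of the Fourier coefficients; the difference of the two sides is then w^(2 s + 3) times the series
  of \<open>theta q (- q)\<close>, which is 0. The coefficients q^(s^2 + s) of \<open>t2\<close>
  obey the same recurrence.\<close>

lemma u_Suc: "u (s + 1) = q powi (2 * s + 2) * u s"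
proof -
  define g where "g j = q powi ((j + 1)\<^sup>2) * (-1) powi (j + 1) * cf (s - j)" for j :: int
  have u1: "u (s + 1) = (\<Sum>\<^sub>\<infinity>j. g j)"
    unfolding u_def by (rule infsum_reindex_bij_witness[of _ "\<lambda>j. j + 1" "\<lambda>j. j - 1"]) (auto simp: g_def diff_diff_eq2)
  have gs: "g summable_on UNIV"
    using u_summable[of "s + 1"] unfolding g_def
    by (subst summable_on_reindex_bij_witness[of _ "\<lambda>j. j - 1" "\<lambda>j. j + 1"]) auto
  have "q powi (2 * s + 2) * u s - u (s + 1) = (\<Sum>\<^sub>\<infinity>j. q powi (2 * s + 2) * (q powi (j\<^sup>2) * (-1) powi j * cf (s - j)) + - g j)"
    unfolding u1 unfolding u_def infsum_cmult_right'[symmetric]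
    using infsum_add[OF summable_on_cmult_right[OF u_summable] summable_on_uminus[THEN iffD2, OF gs], of "q powi (2 * s + 2)" s]
    by (simp add: infsum_uminus)
  also have "(\<lambda>j. q powi (2 * s + 2) * (q powi (j\<^sup>2) * (-1) powi j * cf (s - j)) + - g j) =
     (\<lambda>j. w powi (2 * s + 3) * (q powi (j\<^sup>2) * (- q) powi j))"
  proof
    fix j :: int
    define k where "k = s - j"
    have qw: "q powi n = w powi (2 * n)" for n using power_int_mult[of w 2 n] by (simp add: q_def)
    have neg: "(- q) powi j = (-1) powi j * w powi (2 * j)"
      using power_int_mult_distrib[of "-1" q j] by (simp add: qw)
    have "q powi (2 * s + 2) * (q powi (j\<^sup>2) * (-1) powi j * cf (s - j)) + - g j =
      (-1) powi j * cf k * (w powi (4 * s + 4 + 2 * j\<^sup>2) + w powi (2 * (j + 1)\<^sup>2))"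
      using w_nonzero by (simp add: g_def qw power_int_add k_def algebra_simps)
    also have "w powi (4 * s + 4 + 2 * j\<^sup>2) = w powi (2 * j\<^sup>2 + 2 * j + (2 * s + 3)) * w powi (2 * k + 1)"
      using w_nonzero by (simp add: k_def algebra_simps flip: power_int_add)
    also have "w powi (2 * (j + 1)\<^sup>2) = w powi (2 * j\<^sup>2 + 2 * j + (2 * s + 3)) * w powi (- (2 * k + 1))"
      using w_nonzero by (simp add: k_def algebra_simps power2_eq_square flip: power_int_add)
    also have "(-1) powi j * cf k * (w powi (2 * j\<^sup>2 + 2 * j + (2 * s + 3)) * w powi (2 * k + 1) +
        w powi (2 * j\<^sup>2 + 2 * j + (2 * s + 3)) * w powi (- (2 * k + 1))) =
        (-1) powi j * w powi (2 * j\<^sup>2 + 2 * j + (2 * s + 3)) * (cf k * (w powi (2 * k + 1) + w powi (- (2 * k + 1))))"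
      by (simp only: algebra_simps)
    also have "\<dots> = w powi (2 * s + 3) * (q powi (j\<^sup>2) * (- q) powi j)"
      unfolding cf_mult neg qw using w_nonzero by (simp add: power_int_add)
    finally show "q powi (2 * s + 2) * (q powi (j\<^sup>2) * (-1) powi j * cf (s - j)) + - g j = \<dots>" .
  qed
  also have "(\<Sum>\<^sub>\<infinity>j. w powi (2 * s + 3) * (q powi (j\<^sup>2) * (- q) powi j)) = w powi (2 * s + 3) * theta q (- q)"
    by (simp only: infsum_cmult_right' theta_def)
  also have "\<dots> = 0" using theta_zero[OF q_nonzero] by simp
  finally show ?thesis by simp
qed

lemma u_eq: "u s = u 0 * q powi (s\<^sup>2 + s)"
proof (induction s rule: int_induct[where k = 0])
  case (step1 s)
  have e: "(s + 1)\<^sup>2 + (s + 1) = (2 * s + 2) + (s\<^sup>2 + s)" by (simp add: power2_eq_square algebra_simps)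
  show ?case unfolding u_Suc step1(2) e
    by (simp only: power_int_add[OF disjI1, OF q_nonzero] mult_ac)
next
  case (step2 s)
  have e: "s\<^sup>2 + s = (2 * (s - 1) + 2) + ((s - 1)\<^sup>2 + (s - 1))" by (simp add: power2_eq_square algebra_simps)
  have "q powi (2 * (s - 1) + 2) * u (s - 1) = q powi (2 * (s - 1) + 2) * (u 0 * q powi ((s - 1)\<^sup>2 + (s - 1)))"
    using u_Suc[of "s - 1"] step2 q_nonzero unfolding e power_int_add[OF disjI1, OF q_nonzero] by simp
  then show ?case using q_nonzero by simp
qed simp

lemma Cn_mult_th4:
  assumes "norm w < norm z" "norm z * norm w < 1"
  shows "Cn z * th4 z = u 0 * t2 z"
proof -
  have z: "z \<noteq> 0" using assms by auto
  have z2: "- (z\<^sup>2) \<noteq> 0" "z\<^sup>2 \<noteq> 0" using z by auto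
  note s1 = Cn_summable[OF assms] and s2 = theta_summable[OF norm_q z2(1)]
  \<comment> \<open>The Cauchy product with s = k + j: summing over j first produces
    \<open>u s\<close>.\<close>
  define f where "f s j = z powi (2 * s + 1) * (q powi (j\<^sup>2) * (-1) powi j * cf (s - j))" for s j :: int
  have fj: "f (k + j) j = cf k * z powi (2 * k + 1) * (q powi (j\<^sup>2) * (- (z\<^sup>2)) powi j)" for k j
  proof -
    have "(- (z\<^sup>2)) powi j = (-1) powi j * z powi (2 * j)"
      using power_int_mult_distrib[of "-1" "z\<^sup>2" j] power_int_mult[of z 2 j] by simp
    moreover have "z powi (2 * (k + j) + 1) = z powi (2 * k + 1) * z powi (2 * j)"
      using z by (simp add: algebra_simps flip: power_int_add)
    ultimately show ?thesis by (simp add: f_def mult_ac)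
  qed
  have w1: "(\<lambda>(s, j). f s j) summable_on UNIV \<times> UNIV \<longleftrightarrow>
      (\<lambda>(k, j). cf k * z powi (2 * k + 1) * (q powi (j\<^sup>2) * (- (z\<^sup>2)) powi j)) summable_on UNIV \<times> UNIV"
    by (rule summable_on_reindex_bij_witness[of _ "\<lambda>(k, j). (k + j, j)" "\<lambda>(s, j). (s - j, j)"])
       (auto simp flip: fj)
  have w2: "(\<Sum>\<^sub>\<infinity>(s, j)\<in>UNIV \<times> UNIV. f s j) =
      (\<Sum>\<^sub>\<infinity>(k, j)\<in>UNIV \<times> UNIV. cf k * z powi (2 * k + 1) * (q powi (j\<^sup>2) * (- (z\<^sup>2)) powi j))"
    by (rule infsum_reindex_bij_witness[of _ "\<lambda>(k, j). (k + j, j)" "\<lambda>(s, j). (s - j, j)"])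
       (auto simp flip: fj)
  have "Cn z * th4 z = (\<Sum>\<^sub>\<infinity>(s, j)\<in>UNIV \<times> UNIV. f s j)"
    unfolding w2 infsum_prod_mult[OF s1 s2] by (simp add: Cn_def th4_def theta_def)
  also have "\<dots> = (\<Sum>\<^sub>\<infinity>s. \<Sum>\<^sub>\<infinity>j. f s j)"
    using infsum_Sigma'_banach[of "\<lambda>s j. f s j" UNIV "\<lambda>_. UNIV"] w1 summable_on_prod_mult[OF s1 s2] by simp
  also have "\<dots> = (\<Sum>\<^sub>\<infinity>s. u 0 * (z * (q powi (s\<^sup>2) * (q * z\<^sup>2) powi s)))"
  proof (rule infsum_cong)
    fix s :: int
    have "(\<Sum>\<^sub>\<infinity>j. f s j) = z powi (2 * s + 1) * u s" by (simp only: f_def infsum_cmult_right' u_def)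
    also have "\<dots> = u 0 * (z * (q powi (s\<^sup>2) * (q * z\<^sup>2) powi s))"
      using z q_nonzero power_int_mult[of z 2 s]
      by (simp add: u_eq[of s] power_int_add power_int_mult_distrib)
    finally show "(\<Sum>\<^sub>\<infinity>j. f s j) = \<dots>" .
  qed
  also have "\<dots> = u 0 * t2 z"
    by (simp only: infsum_cmult_right' t2_def theta_def)
  finally show ?thesis .
qed

text \<open>At z = e / w the coefficients become 1 / (1 + q^(2 k + 1)) for k \<ge> 0 and tend to 1.
  Subtracting 1 isolates the pole at e^2 = 1 as a geometric series, and the remainder converges
  across |e| = 1.\<close>

lemma Cn_expand:
  assumes "norm w < norm (e / w)" "norm e < 1" "e \<noteq> 0"
  shows "Cn (e / w) = e / (1 - e\<^sup>2) + (\<Sum>\<^sub>\<infinity>k::int. (cf k / w powi (2 * k + 1) - (if k \<ge> 0 then 1 else 0)) * e powi (2 * k + 1))"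
proof -
  have e2: "norm (e\<^sup>2) < 1" using assms by (simp add: norm_square_lt_1)
  have "(\<lambda>n. e * (e\<^sup>2) ^ n) sums (e * (1 / (1 - e\<^sup>2)))"
    using sums_mult[OF geometric_sums[OF e2], of e] by (simp add: field_simps)
  moreover have "summable (\<lambda>n. norm (e * (e\<^sup>2) ^ n))"
    using e2 by (simp add: norm_mult norm_power summable_mult)
  ultimately have "((\<lambda>n. e * (e\<^sup>2) ^ n) has_sum (e / (1 - e\<^sup>2))) UNIV"
    using norm_summable_imp_has_sum by fastforce
  also have "?this \<longleftrightarrow> ((\<lambda>k::int. e powi (2 * k + 1)) has_sum (e / (1 - e\<^sup>2))) {0..}"
    using assms
    by (intro has_sum_reindex_bij_witness[of _ nat int])
       (auto simp: power_int_add power_int_mult)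
  finally have "((\<lambda>k::int. if k \<ge> 0 then e powi (2 * k + 1) else 0) has_sum (e / (1 - e\<^sup>2))) UNIV"
    by (rule has_sum_cong_neutral[THEN iffD1, rotated -1]) auto
  then have 1: "((\<lambda>k::int. (if k \<ge> 0 then 1 else 0) * e powi (2 * k + 1)) has_sum (e / (1 - e\<^sup>2))) UNIV"
    by (rule has_sum_cong[THEN iffD1, rotated]) auto
  have "norm (e / w) * norm w < 1" using assms w_nonzero by (simp add: norm_divide)
  then have "((\<lambda>k::int. cf k * (e / w) powi (2 * k + 1)) has_sum Cn (e / w)) UNIV"
    unfolding Cn_def by (intro has_sum_infsum Cn_summable assms)
  then have 2: "((\<lambda>k::int. cf k / w powi (2 * k + 1) * e powi (2 * k + 1)) has_sum Cn (e / w)) UNIV"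
    by (simp add: power_int_divide_distrib)
  have "((\<lambda>k::int. (cf k / w powi (2 * k + 1) - (if k \<ge> 0 then 1 else 0)) * e powi (2 * k + 1)) has_sum (Cn (e / w) - e / (1 - e\<^sup>2))) UNIV"
    using has_sum_add[OF 2 has_sum_uminusI[OF 1]]    unfolding left_diff_distrib unfolding diff_conv_add_uminus .
  then show ?thesis by (simp add: infsumI)
qed

lemma norm_Cn_remainder:
  "norm (cf k / w powi (2 * k + 1) - (if k \<ge> 0 then 1 else 0)) \<le> norm q ^ nat \<bar>2 * k + 1\<bar> / (1 - (norm w)\<^sup>2)"
proof -
  define m where "m = nat \<bar>2 * k + 1\<bar>"
  have "2 * k + 1 \<noteq> 0" by presburger
  then have m: "m \<ge> 1" by (simp add: m_def)
  have q: "w ^ (2 * m) = q ^ m" "w ^ m * w ^ m = q ^ m"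
    by (simp_all add: q_def power_mult power2_eq_square power_mult_distrib)
  \<comment> \<open>The difference is -q^m / (1 + q^m) for nonnegative k and q^m / (1 + q^m) for
    negative k.\<close>
  have "cf k / w powi (2 * k + 1) - (if k \<ge> 0 then 1 else 0) = (if k \<ge> 0 then -1 else 1) * (w ^ m * lam m)"
  proof (cases "k \<ge> 0")
    case True
    then have "2 * k + 1 = int m" by (simp add: m_def)
    then have "w powi (2 * k + 1) = w ^ m" by (simp only: power_int_of_nat)
    then have "cf k / w powi (2 * k + 1) - (if k \<ge> 0 then 1 else 0) = lam m / w ^ m - 1"
      using True by (simp only: cf_def flip: m_def) simp
    also have "\<dots> = - (w ^ m * lam m)"
    proof -
      have l: "lam m = w ^ m / (1 + q ^ m)" and n: "1 + q ^ m \<noteq> 0"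
        using norm_lam_le(2)[OF m] by (simp_all add: lam_def q)
      have "w ^ m * (w ^ m / (1 + q ^ m)) = q ^ m / (1 + q ^ m)"
        by (simp add: q(2))
      moreover have "w ^ m / (1 + q ^ m) / w ^ m = 1 / (1 + q ^ m)" using w_nonzero by simp
      moreover have "1 / (1 + q ^ m) - 1 = - (q ^ m / (1 + q ^ m))" using n by (simp add: divide_simps)
      ultimately show ?thesis unfolding l by argo
    qed
    finally show ?thesis using True by simp
  next
    case False
    then have "2 * k + 1 = - int m" by (simp add: m_def)
    then have "w powi (2 * k + 1) = inverse (w ^ m)" by (simp only: power_int_minus power_int_of_nat)
    then have "cf k / w powi (2 * k + 1) - (if k \<ge> 0 then 1 else 0) = lam m / inverse (w ^ m)"
      using False by (simp only: cf_def flip: m_def) simp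
    then show ?thesis using False by (simp add: field_simps)
  qed
  then have "norm (cf k / w powi (2 * k + 1) - (if k \<ge> 0 then 1 else 0)) = norm w ^ m * norm (lam m)"
    by (simp add: norm_mult norm_power)
  also have "\<dots> \<le> norm w ^ m * (norm w ^ m / (1 - (norm w)\<^sup>2))"
    by (intro mult_left_mono norm_lam_le(1) m) auto
  also have "\<dots> = norm q ^ m / (1 - (norm w)\<^sup>2)"
    by (simp add: q_def norm_mult power2_eq_square power_mult_distrib)
  finally show ?thesis by (simp add: m_def)
qed

text \<open>Compare both sides of \<open>Cn_mult_th4\<close> at the simple pole \<open>z = 1 / w\<close> of the series, approached
  from inside the annulus of convergence.\<close>

lemma u_0_eq: "u 0 = w * theta1_prime q / (2 * theta q 1)"
proof -
  define R where "R x = (\<Sum>\<^sub>\<infinity>k::int. (cf k / w powi (2 * k + 1) - (if k \<ge> 0 then 1 else 0)) * exp (of_int (2 * k + 1) * \<i> * x))" for x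
  \<comment> \<open>Chosen so that |q| e^r = |q|^(1/2) < 1, which makes the remainder series
    \<open>R\<close> analytic at 0.\<close>
  define r where "r = - ln (norm q) / 2"
  have nq: "norm q > 0" using q_nonzero by simp
  have r: "r > 0" using norm_q nq by (simp add: r_def)
  have qr: "norm q * exp r < 1"
  proof -
    have "norm q * exp r = exp (ln (norm q) / 2)"
      using nq exp_add[of "ln (norm q)" r] by (simp add: r_def)
    then show ?thesis using norm_q nq by simp
  qed
  have "(\<lambda>k::int. norm (cf k / w powi (2 * k + 1) - (if k \<ge> 0 then 1 else 0)) * exp (r * norm (of_int (2 * k + 1) * \<i>))) summable_on UNIV"
  proof (rule summable_on_comparison_test)
    show "(\<lambda>k::int. (norm q * exp r) ^ nat \<bar>2 * k + 1\<bar> / (1 - (norm w)\<^sup>2)) summable_on UNIV"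
      unfolding divide_inverse using qr
      by (intro summable_on_cmult_left summable_on_geometric_int) auto
    fix k :: int
    have "norm (of_int (2 * k + 1) * \<i>) = \<bar>real_of_int (2 * k + 1)\<bar>"
      unfolding norm_mult norm_of_int by simp
    then have "exp (r * norm (of_int (2 * k + 1) * \<i>)) = exp r ^ nat \<bar>2 * k + 1\<bar>"
      by (simp add: mult.commute flip: exp_of_nat_mult)
    then show "norm (cf k / w powi (2 * k + 1) - (if k \<ge> 0 then 1 else 0)) * exp (r * norm (of_int (2 * k + 1) * \<i>)) \<le> (norm q * exp r) ^ nat \<bar>2 * k + 1\<bar> / (1 - (norm w)\<^sup>2)"
      using mult_right_mono[OF norm_Cn_remainder[of k], of "exp r ^ nat \<bar>2 * k + 1\<bar>"] by (simp add: power_mult_distrib)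
  qed auto
  from has_fps_expansion_imp_continuous[OF fourier_has_fps_expansion[OF r this]]
  have "isCont R 0" unfolding R_def by simp
  then have R: "(R \<longlongrightarrow> R 0) (at 0)" by (simp add: isCont_def)
  have t: "((\<lambda>x. theta1 q x / x) \<longlongrightarrow> \<i> * theta1_prime q) (at 0)"
    using theta1_has_deriv[OF norm_q q_nonzero] by (simp add: has_field_derivative_iff theta1_0 q_nonzero)
  have t0: "(theta1 q \<longlongrightarrow> 0) (at 0)"
    using DERIV_isCont[OF theta1_has_deriv[OF norm_q q_nonzero]] by (simp add: isCont_def theta1_0 q_nonzero)
  have "((\<lambda>x. 1 - (exp (\<i> * x))\<^sup>2) has_field_derivative - (2 * \<i>)) (at 0)"
    by (auto intro!: derivative_eq_intros)
  then have e: "((\<lambda>x. (1 - (exp (\<i> * x))\<^sup>2) / x) \<longlongrightarrow> - (2 * \<i>)) (at 0)"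
    by (simp add: has_field_derivative_iff)
  have "isCont (\<lambda>x. exp (of_int 0 * \<i> * x) * theta q (1 * exp (2 * \<i> * x))) 0"
    by (rule has_fps_expansion_imp_continuous[OF theta_has_fps_expansion[OF norm_q one_neq_zero]])
  then have th: "((\<lambda>x. theta q ((exp (\<i> * x))\<^sup>2)) \<longlongrightarrow> theta q 1) (at 0)"
    by (simp add: isCont_def mult.assoc flip: exp_double)
  \<comment> \<open>\<open>L\<close> and \<open>M\<close> are the two sides of
    \<open>Cn_mult_th4\<close> at z = exp (i x) / w. In \<open>L\<close> the pole of
    \<open>Cn\<close> is paired with the zero of theta_1, both divided by x so that each has a
    finite nonzero or known limit.\<close>
  define L where "L x = - (exp (\<i> * x))\<^sup>2 * ((theta1 q x / x) / ((1 - (exp (\<i> * x))\<^sup>2) / x)) - exp (\<i> * x) * R x * theta1 q x" for x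
  have exp_lim: "((\<lambda>x. exp (\<i> * x)) \<longlongrightarrow> 1) (at 0)"
    by (auto intro!: tendsto_eq_intros)
  have L: "(L \<longlongrightarrow> - 1\<^sup>2 * ((\<i> * theta1_prime q) / (- (2 * \<i>))) - 1 * R 0 * 0) (at 0)"
    unfolding L_def by (intro tendsto_intros exp_lim t e R t0) auto
  define M where "M x = u 0 * (exp (\<i> * x) / w * theta q ((exp (\<i> * x))\<^sup>2))" for x
  have M: "(M \<longlongrightarrow> u 0 * (1 / w * theta q 1)) (at 0)"
    unfolding M_def by (intro tendsto_intros exp_lim th) (use w_nonzero in auto)
  \<comment> \<open>On the positive imaginary axis |exp (i x)| < 1, which keeps z inside the
    annulus.\<close>
  define X where "X n = \<i> * of_real (inverse (real (Suc n)))" for n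
  have "X \<longlonglongrightarrow> \<i> * of_real 0"
    unfolding X_def by (intro tendsto_intros LIMSEQ_inverse_real_of_nat)
  moreover have X0: "X n \<noteq> 0" for n by (simp add: X_def del: of_nat_Suc)
  ultimately have X: "filterlim X (at 0) sequentially"
    by (simp add: filterlim_at)
  have "eventually (\<lambda>x. norm (exp (\<i> * x)) > (norm w)\<^sup>2) (at 0)"
    using tendsto_norm[OF exp_lim] norm_w by (intro order_tendstoD) (auto simp: power_less_one_iff)
  then have "eventually (\<lambda>n. norm (exp (\<i> * X n)) > (norm w)\<^sup>2) sequentially"
    by (rule eventually_compose_filterlim[OF _ X])
  then have "eventually (\<lambda>n. L (X n) = M (X n)) sequentially"
  proof eventually_elim
    case (elim n)
    define x where "x = X n"
    define e where "e = exp (\<i> * x)"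
    have ne: "norm e < 1" by (simp add: e_def x_def X_def)
    have e0: "e \<noteq> 0" by (simp add: e_def)
    have x0: "x \<noteq> 0" by (simp add: x_def X0)
    have c: "norm w < norm (e / w)" "norm (e / w) * norm w < 1"
      using elim ne w_nonzero by (simp_all add: norm_divide e_def x_def power2_eq_square pos_less_divide_eq)
    have e2: "e\<^sup>2 \<noteq> 1" using ne norm_square_lt_1[OF ne] by force
    have "e powi (2 * k + 1) = exp (of_int (2 * k + 1) * \<i> * x)" for k
      unfolding e_def exp_power_int by (simp add: mult.assoc)
    then have C: "Cn (e / w) = e / (1 - e\<^sup>2) + R x"
      unfolding R_def using Cn_expand[OF c(1) ne e0] by simp
    have "theta q (- (e\<^sup>2 / q)) = - (e\<^sup>2) * theta q (- q * e\<^sup>2)"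
      using theta_shift[of q "- (e\<^sup>2 / q)"] q_nonzero e0 by (simp add: power2_eq_square field_simps)
    then have 4: "th4 (e / w) = - e * theta1 q x"
    proof -
      have "(e / w)\<^sup>2 = e\<^sup>2 / q" by (simp add: q_def power_divide)
      moreover have "exp (2 * \<i> * x) = e\<^sup>2" using exp_double[of "\<i> * x"] by (simp add: e_def mult.assoc)
      ultimately show ?thesis
        unfolding th4_def theta1_def \<open>theta q (- (e\<^sup>2 / q)) = - (e\<^sup>2) * theta q (- q * e\<^sup>2)\<close>
        by (simp add: e_def[symmetric] \<open>theta q (- (e\<^sup>2 / q)) = - (e\<^sup>2) * theta q (- q * e\<^sup>2)\<close>)
           (simp add: power2_eq_square)
    qed
    have 2: "t2 (e / w) = e / w * theta q (e\<^sup>2)"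
    proof -
      have "q * (e / w)\<^sup>2 = e\<^sup>2" using w_nonzero by (simp add: q_def power_divide)
      then show ?thesis by (simp add: t2_def)
    qed
    have "L x = - (e\<^sup>2) * (theta1 q x / (1 - e\<^sup>2)) - e * R x * theta1 q x"
      using x0 by (simp add: L_def e_def)
    also have "\<dots> = Cn (e / w) * th4 (e / w)"
      unfolding C 4 using e2 by (simp add: field_simps power2_eq_square)
    also have "\<dots> = M x" unfolding Cn_mult_th4[OF c] 2 by (simp add: M_def e_def)
    finally show ?case by (simp add: x_def)
  qed
  then have "- 1\<^sup>2 * ((\<i> * theta1_prime q) / (- (2 * \<i>))) - 1 * R 0 * 0 = u 0 * (1 / w * theta q 1)"
    using tendsto_unique[OF _ Lim_transform_eventually[OF filterlim_compose[OF L X]] filterlim_compose[OF M X]]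
    by simp
  then show ?thesis
    using theta_1_nonzero[OF norm_q q_nonzero] w_nonzero by (simp add: field_simps)
qed

end

section \<open>Determinants from separated kernels\<close>

text \<open>Write g = X g' and H = X^2 H'; then g H^j = X^(2 j + 1) g' H'^j.\<close>

lemma fps_nth_mult_power_below:
  fixes g H :: "complex fps"
  assumes "fps_nth g 0 = 0" "fps_nth H 0 = 0" "fps_nth H 1 = 0"
  shows "p < 2 * j + 1 \<Longrightarrow> fps_nth (g * H ^ j) p = 0"
    and "fps_nth (g * H ^ j) (2 * j + 1) = fps_nth g 1 * fps_nth H 2 ^ j"
proof -
  define g' where "g' = fps_shift 1 g"
  define H' where "H' = fps_shift 2 H"
  have g: "g = fps_X * g'"
    by (intro fps_ext) (use assms in \<open>auto simp: g'_def fps_X_mult_nth\<close>)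
  have H: "H = fps_X ^ 2 * H'"
  proof (intro fps_ext)
    fix n show "fps_nth H n = fps_nth (fps_X ^ 2 * H') n"
    proof (cases "n < 2")
      case True
      then show ?thesis using assms by (auto simp: fps_X_power_mult_nth less_2_cases_iff)
    next
      case False
      then have "n - 2 + 2 = n" by simp
      then show ?thesis using False unfolding fps_X_power_mult_nth H'_def fps_shift_nth by simp
    qed
  qed
  have e: "g * H ^ j = fps_X ^ (2 * j + 1) * (g' * H' ^ j)"
    by (subst g, subst H) (simp add: power_mult_distrib power_add flip: power_mult)
  show "p < 2 * j + 1 \<Longrightarrow> fps_nth (g * H ^ j) p = 0"
    unfolding e fps_X_power_mult_nth by simp
  show "fps_nth (g * H ^ j) (2 * j + 1) = fps_nth g 1 * fps_nth H 2 ^ j"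
    unfolding e fps_X_power_mult_nth by (simp add: fps_power_zeroth g'_def H'_def numeral_2_eq_2)
qed

lemma fps_nth_square_2:
  fixes F :: "complex fps"
  assumes "fps_nth F 0 = 0"
  shows "fps_nth (F\<^sup>2) 0 = 0" "fps_nth (F\<^sup>2) 1 = 0" "fps_nth (F\<^sup>2) 2 = (fps_nth F 1)\<^sup>2"
  using assms by (simp_all add: power2_eq_square fps_mult_nth eval_nat_numeral)

text \<open>The variables are treated one at a time. For fixed y the geometric series is truncated
  after N terms, since the error carries h(x)^N and thus vanishes to order 2 N > p; the resulting
  finite sum is then expanded in y.\<close>

lemma kernel_coefficients:
  fixes \<Phi> :: "complex \<Rightarrow> complex \<Rightarrow> complex" and g h :: "complex \<Rightarrow> complex" and gF hF :: "complex fps"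
    and A :: complex and \<phi> :: "nat \<Rightarrow> complex \<Rightarrow> complex" and \<mu> :: "nat \<Rightarrow> nat \<Rightarrow> complex"
  assumes g: "g has_fps_expansion gF" and h: "h has_fps_expansion hF"
    and hF0: "fps_nth hF 0 = 0" "fps_nth hF 1 = 0" and gF0: "fps_nth gF 0 = 0"
    and x_expansion: "eventually (\<lambda>y. (\<lambda>x. \<Phi> x y) has_fps_expansion Abs_fps (\<lambda>p. \<phi> p y)) (nhds 0)"
    and y_expansion: "\<And>p. \<phi> p has_fps_expansion Abs_fps (\<mu> p)"
    and kernel: "eventually (\<lambda>y. eventually (\<lambda>x. \<Phi> x y * (1 - h x * h y) = A * g x * g y) (nhds 0)) (nhds 0)"
    and p: "p < 2 * N"
  shows "\<mu> p r = A * (\<Sum>j<N. fps_nth (gF * hF ^ j) p * fps_nth (gF * hF ^ j) r)"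
proof -
  have "eventually (\<lambda>y. \<phi> p y = (\<Sum>j<N. A * fps_nth (gF * hF ^ j) p * (g y * h y ^ j))) (nhds 0)"
    using x_expansion kernel
  proof eventually_elim
    case (elim y)
    let ?F = "Abs_fps (\<lambda>p. \<phi> p y)"
    have "(\<lambda>x. \<Phi> x y * (1 - h x * h y)) has_fps_expansion ?F * (1 - hF * fps_const (h y))"
      by (intro fps_expansion_intros elim h)
    moreover have "(\<lambda>x. A * g x * g y) has_fps_expansion fps_const A * gF * fps_const (g y)"
      by (intro fps_expansion_intros g)
    then have "(\<lambda>x. \<Phi> x y * (1 - h x * h y)) has_fps_expansion fps_const A * gF * fps_const (g y)"
      using elim(2) by (subst has_fps_expansion_cong[OF _ refl]) auto
    ultimately have *: "?F * (1 - hF * fps_const (h y)) = fps_const A * gF * fps_const (g y)"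
      using fps_expansion_unique_complex by blast
    define X where "X = hF * fps_const (h y)"
    have "?F * (1 - X ^ N) = ?F * (1 - X) * (\<Sum>j<N. X ^ j)"
      by (simp add: one_diff_power_eq mult.assoc)
    also have "\<dots> = (\<Sum>j<N. fps_const (A * (g y * h y ^ j)) * (gF * hF ^ j))"
      unfolding X_def * sum_distrib_left
      by (intro sum.cong refl) (simp add: power_mult_distrib fps_const_power mult_ac flip: fps_const_mult)
    finally have "fps_nth (?F * (1 - X ^ N)) p = (\<Sum>j<N. A * (g y * h y ^ j) * fps_nth (gF * hF ^ j) p)"
      by (simp only: fps_sum_nth fps_mult_left_const_nth)
    moreover have "fps_nth (?F * X ^ N) p = 0"
    proof -
      \<comment> \<open>The extra \<open>fps_X\<close> supplies the vanishing constant term required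
        of the first factor; it shifts the index to p + 1 < 2 N + 1.\<close>
      have "fps_nth (fps_X * ?F * hF ^ N) (Suc p) = 0"
        using p hF0 by (intro fps_nth_mult_power_below) auto
      then have "fps_nth (?F * hF ^ N) p = 0"
        by (simp add: mult.assoc)
      moreover have "?F * X ^ N = ?F * hF ^ N * fps_const (h y ^ N)"
        by (simp add: X_def power_mult_distrib fps_const_power mult.assoc)
      ultimately show ?thesis by (simp only: fps_mult_right_const_nth mult_zero_left)
    qed
    ultimately show ?case by (simp add: right_diff_distrib algebra_simps)
  qed
  moreover have "(\<lambda>y. \<Sum>j<N. A * fps_nth (gF * hF ^ j) p * (g y * h y ^ j)) has_fps_expansion
      (\<Sum>j<N. fps_const (A * fps_nth (gF * hF ^ j) p) * (gF * hF ^ j))"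
    by (intro fps_expansion_intros g h)
  ultimately have "\<phi> p has_fps_expansion (\<Sum>j<N. fps_const (A * fps_nth (gF * hF ^ j) p) * (gF * hF ^ j))"
    by (subst has_fps_expansion_cong[OF _ refl]) auto
  then have "Abs_fps (\<mu> p) = (\<Sum>j<N. fps_const (A * fps_nth (gF * hF ^ j) p) * (gF * hF ^ j))"
    using y_expansion fps_expansion_unique_complex by blast
  then have "fps_nth (Abs_fps (\<mu> p)) r = (\<Sum>j<N. A * fps_nth (gF * hF ^ j) p * fps_nth (gF * hF ^ j) r)"
    by (simp only: fps_sum_nth fps_mult_left_const_nth)
  then show ?thesis by (simp add: sum_distrib_left mult_ac)
qed

lemma det_LDL:
  fixes B :: "nat \<Rightarrow> nat \<Rightarrow> complex"
  assumes "\<And>i j. i < j \<Longrightarrow> B i j = 0"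
  shows "det (mat n n (\<lambda>(i, k). A * (\<Sum>j<n. B i j * B k j))) = A ^ n * (\<Prod>j<n. (B j j)\<^sup>2)"
proof -
  define L where "L = mat n n (\<lambda>(i, j). B i j)"
  have L: "L \<in> carrier_mat n n" by (simp add: L_def)
  have "mat n n (\<lambda>(i, k). A * (\<Sum>j<n. B i j * B k j)) = A \<cdot>\<^sub>m (L * L\<^sup>T)"
    by (intro eq_matI) (auto simp: L_def scalar_prod_def lessThan_atLeast0)
  moreover have "det L = (\<Prod>j<n. B j j)"
  proof -
    have "det L = prod_list (diag_mat L)"
      using assms by (intro det_lower_triangular[OF _ L]) (auto simp: L_def)
    also have "diag_mat L = map (\<lambda>j. B j j) [0..<n]"
      by (auto simp: diag_mat_def L_def)
    also have "prod_list (map (\<lambda>j. B j j) [0..<n]) = (\<Prod>j\<in>set [0..<n]. B j j)"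
      by (rule prod.distinct_set_conv_list[symmetric]) simp
    finally show ?thesis by (simp add: atLeast0LessThan)
  qed
  ultimately show ?thesis
    using L by (simp add: det_mult[OF L] det_transpose[OF L] power2_eq_square prod.distrib)
qed

section \<open>An infinite Cauchy-Binet formula\<close>

lemma summable_on_prod_PiE:
  fixes f :: "'i \<Rightarrow> 'a \<Rightarrow> complex"
  assumes "finite I" "\<And>i. i \<in> I \<Longrightarrow> f i summable_on A i"
  shows "(\<lambda>p. \<Prod>i\<in>I. f i (p i)) summable_on PiE I A"
  using assms
proof (induction I)
  case (insert i I)
  have "(\<lambda>(y, p). f i y * (\<Prod>j\<in>I. f j (p j))) summable_on A i \<times> PiE I A"
    using insert by (intro summable_on_prod_mult) auto
  moreover have "bij_betw (\<lambda>(y, p). p(i := y)) (A i \<times> PiE I A) (PiE (insert i I) A)"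
    using insert inj_combinator[of i I A] by (auto simp: bij_betw_def PiE_insert_eq)
  moreover have "(\<Prod>j\<in>insert i I. f j ((case x of (y, p) \<Rightarrow> p(i := y)) j)) = (case x of (y, p) \<Rightarrow> f i y * (\<Prod>j\<in>I. f j (p j)))" for x
    using insert by (auto simp: case_prod_unfold intro!: prod.cong)
  ultimately show ?case
    using summable_on_reindex_bij_betw[of "\<lambda>(y, p). p(i := y)" "A i \<times> PiE I A" "PiE (insert i I) A" "\<lambda>p. \<Prod>j\<in>insert i I. f j (p j)"]
    by simp
qed simp

lemma has_sum_finite_sum:
  fixes f :: "'i \<Rightarrow> 'a \<Rightarrow> complex"
  assumes "finite I" "\<And>i. i \<in> I \<Longrightarrow> (f i has_sum s i) A"
  shows "((\<lambda>x. \<Sum>i\<in>I. f i x) has_sum (\<Sum>i\<in>I. s i)) A"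
  using assms by (induction I) (auto intro: has_sum_add)

definition vandermonde :: "nat \<Rightarrow> (nat \<Rightarrow> 'a :: comm_ring_1) \<Rightarrow> 'a mat" where
  "vandermonde n x = mat n n (\<lambda>(r, i). x r ^ i)"

lemma vandermonde_carrier [simp]: "vandermonde n x \<in> carrier_mat n n"
  by (simp add: vandermonde_def)

text \<open>Column operations turn the monomials into the Newton basis of the nodes, whose evaluation
  matrix is lower triangular.\<close>

lemma det_vandermonde:
  fixes x :: "nat \<Rightarrow> 'a :: idom"
  shows "det (vandermonde n x) = (\<Prod>i<n. \<Prod>j<i. x i - x j)"
proof -
  define P where "P i = (\<Prod>j<i. [:- x j, 1:])" for i
  have deg: "degree (P i) = i" for i
    unfolding P_def by (subst degree_prod_eq_sum_degree) auto
  have lc: "coeff (P i) i = 1" for i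
    using lead_coeff_prod[of "\<lambda>j. [:- x j, 1:]" "{..<i}"] deg[of i] by (simp add: P_def)
  define U where "U = mat n n (\<lambda>(k, i). coeff (P i) k)"
  define N where "N = mat n n (\<lambda>(r, i). poly (P i) (x r))"
  have U: "U \<in> carrier_mat n n" and N: "N \<in> carrier_mat n n" by (simp_all add: U_def N_def)
  have "vandermonde n x * U = N"
  proof (intro eq_matI)
    fix r i assume "r < dim_row N" "i < dim_col N"
    then have ri: "r < n" "i < n" by (simp_all add: N_def)
    have "(vandermonde n x * U) $$ (r, i) = (\<Sum>k\<in>{0..<n}. x r ^ k * coeff (P i) k)"
      using ri by (simp add: vandermonde_def U_def scalar_prod_def)
    also have "\<dots> = (\<Sum>k\<le>i. x r ^ k * coeff (P i) k)"
      using ri deg[of i] by (intro sum.mono_neutral_right) (auto intro: coeff_eq_0)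
    also have "\<dots> = N $$ (r, i)"
      using ri by (simp add: N_def poly_altdef deg mult.commute)
    finally show "(vandermonde n x * U) $$ (r, i) = N $$ (r, i)" .
  qed (auto simp: vandermonde_def U_def N_def)
  then have "det N = det (vandermonde n x) * det U"
    using det_mult[OF vandermonde_carrier U, of x] by simp
  moreover have "det U = 1"
  proof -
    have "det U = prod_list (diag_mat U)"
      using deg by (intro det_upper_triangular[OF _ U] upper_triangularI) (auto simp: U_def intro: coeff_eq_0)
    also have "diag_mat U = map (\<lambda>_. 1) [0..<n]"
      by (auto simp: diag_mat_def U_def lc)
    also have "prod_list (map (\<lambda>_. 1 :: 'a) [0..<n]) = 1"
      by (simp add: map_replicate_const prod_list_replicate)
    finally show ?thesis .
  qed
  moreover have "det N = (\<Prod>i<n. \<Prod>j<i. x i - x j)"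
  proof -
    have "det N = prod_list (diag_mat N)"
      by (intro det_lower_triangular[OF _ N]) (auto simp: N_def P_def poly_prod)
    also have "diag_mat N = map (\<lambda>i. \<Prod>j<i. x i - x j) [0..<n]"
      by (auto simp: diag_mat_def N_def P_def poly_prod)
    also have "prod_list (map (\<lambda>i. \<Prod>j<i. x i - x j) [0..<n]) = (\<Prod>i\<in>set [0..<n]. \<Prod>j<i. x i - x j)"
      by (rule prod.distinct_set_conv_list[symmetric]) simp
    finally show ?thesis by (simp add: atLeast0LessThan)
  qed
  ultimately show ?thesis by simp
qed

text \<open>For distinct keys, the position of r in decreasing order of keys; the identity from n
  on, as \<open>permutes\<close> demands.\<close>

definition rank_perm :: "nat \<Rightarrow> (nat \<Rightarrow> nat) \<Rightarrow> nat \<Rightarrow> nat" where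
  "rank_perm n k r = (if r < n then card {s \<in> {0..<n}. k s > k r} else r)"

lemma rank_perm_less:
  assumes "r < n" "s < n" "k s < k r"
  shows "rank_perm n k r < rank_perm n k s"
proof -
  have "{t \<in> {0..<n}. k t > k r} \<subseteq> {t \<in> {0..<n}. k t > k s}"
    using assms(3) by (auto intro: less_trans)
  moreover have "r \<in> {t \<in> {0..<n}. k t > k s}" "r \<notin> {t \<in> {0..<n}. k t > k r}"
    using assms by auto
  ultimately have "{t \<in> {0..<n}. k t > k r} \<subset> {t \<in> {0..<n}. k t > k s}" by blast
  then show ?thesis using assms by (simp add: rank_perm_def psubset_card_mono)
qed

lemma rank_perm_permutes:
  assumes "inj_on k {0..<n}"
  shows "rank_perm n k permutes {0..<n}"
proof -
  have inj: "inj_on (rank_perm n k) {0..<n}"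
  proof (rule inj_onI)
    fix r s assume rs: "r \<in> {0..<n}" "s \<in> {0..<n}" "rank_perm n k r = rank_perm n k s"
    then have "k r = k s"
      using rank_perm_less[of r n s k] rank_perm_less[of s n r k]
      by (cases "k r" "k s" rule: linorder_cases) auto
    then show "r = s" using inj_onD[OF assms] rs(1,2) by blast
  qed
  have "rank_perm n k r < n" if "r < n" for r
  proof -
    have "r \<in> {0..<n}" "r \<notin> {s \<in> {0..<n}. k s > k r}" using that by auto
    then have "{s \<in> {0..<n}. k s > k r} \<subset> {0..<n}" by blast
    then have "card {s \<in> {0..<n}. k s > k r} < card {0..<n}" by (rule psubset_card_mono[rotated]) simp
    then show ?thesis using that by (simp add: rank_perm_def)
  qed
  then have "rank_perm n k ` {0..<n} \<subseteq> {0..<n}" by auto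
  then have "rank_perm n k ` {0..<n} = {0..<n}"
    by (intro endo_inj_surj inj) auto
  then have "bij_betw (rank_perm n k) {0..<n} {0..<n}"
    using inj by (simp add: bij_betw_def)
  then show ?thesis
    by (rule bij_imp_permutes) (simp add: rank_perm_def)
qed

text \<open>Sorting recovers the permutation applied to a decreasing tuple, so each tuple with
  distinct keys has a unique decomposition.\<close>

lemma rank_perm_comp:
  assumes "\<sigma> permutes {0..<n}" and dec: "\<And>r s. r < s \<Longrightarrow> s < n \<Longrightarrow> k s < k r"
  shows "rank_perm n (k \<circ> \<sigma>) = \<sigma>"
proof
  fix r
  show "rank_perm n (k \<circ> \<sigma>) r = \<sigma> r"
  proof (cases "r < n")
    case True
    then have sr: "\<sigma> r < n" using permutes_in_image[OF assms(1), of r] by simp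
    have "{s \<in> {0..<n}. k (\<sigma> s) > k (\<sigma> r)} = \<sigma> -` {0..<\<sigma> r}"
    proof (intro equalityI subsetI)
      fix s assume "s \<in> {s \<in> {0..<n}. k (\<sigma> s) > k (\<sigma> r)}"
      then have s: "s < n" "k (\<sigma> s) > k (\<sigma> r)" by auto
      then have "\<sigma> s < n" using permutes_in_image[OF assms(1), of s] by simp
      then have "\<sigma> s < \<sigma> r"
        using s(2) dec[of "\<sigma> r" "\<sigma> s"] by (cases "\<sigma> s" "\<sigma> r" rule: linorder_cases) auto
      then show "s \<in> \<sigma> -` {0..<\<sigma> r}" by simp
    next
      fix s assume s: "s \<in> \<sigma> -` {0..<\<sigma> r}"
      then have "\<sigma> s < n" using sr by simp
      then have "s < n" using permutes_in_image[OF assms(1), of s] by simp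
      then show "s \<in> {s \<in> {0..<n}. k (\<sigma> s) > k (\<sigma> r)}" using s sr dec by simp
    qed
    also have "card \<dots> = \<sigma> r"
      using permutes_bij[OF assms(1)] by (subst card_vimage_inj) (auto simp: bij_def)
    finally show ?thesis using True by (simp add: rank_perm_def)
  next
    case False
    then show ?thesis using permutes_not_in[OF assms(1), of r] by (simp add: rank_perm_def)
  qed
qed

text \<open>The symmetric group acts on the tuples with distinct keys, and the decreasing ones represent
  its orbits. Expanding one of the two Vandermonde determinants over such an orbit undoes the
  ordering, and expanding the other one then factorises the sum over all tuples.\<close>

theorem cauchy_binet_infsum:
  fixes \<beta> x :: "'a \<Rightarrow> complex" and key :: "'a \<Rightarrow> nat" and S :: "'a set" and n :: nat
  defines "D \<equiv> {p \<in> PiE {0..<n} (\<lambda>_. S). \<forall>r s. r < s \<longrightarrow> s < n \<longrightarrow> key (p s) < key (p r)}"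
  assumes sm: "\<And>e. (\<lambda>a. \<beta> a * x a ^ e) summable_on S"
    and key: "\<And>a b. key a = key b \<Longrightarrow> x a = x b"
  shows "(\<lambda>p. (\<Prod>r<n. \<beta> (p r)) * (det (vandermonde n (x \<circ> p)))\<^sup>2) summable_on D"
    and "(\<Sum>\<^sub>\<infinity>p\<in>D. (\<Prod>r<n. \<beta> (p r)) * (det (vandermonde n (x \<circ> p)))\<^sup>2) =
      det (mat n n (\<lambda>(i, k). \<Sum>\<^sub>\<infinity>a\<in>S. \<beta> a * x a ^ (i + k)))"
proof -
  define T where "T = PiE {0..<n} (\<lambda>_. S)"
  define Pm where "Pm = {\<sigma>. \<sigma> permutes {0..<n}}"
  have fin: "finite Pm" unfolding Pm_def by (rule finite_permutations) simp
  define M where "M = mat n n (\<lambda>(i, k). \<Sum>\<^sub>\<infinity>a\<in>S. \<beta> a * x a ^ (i + k))"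
  define f where "f \<sigma> r a = \<beta> a * x a ^ (r + \<sigma> r)" for \<sigma> :: "nat \<Rightarrow> nat" and r a
  \<comment> \<open>One determinant is replaced by its diagonal monomial; summing over an orbit
    restores it.\<close>
  define \<phi> where "\<phi> p = (\<Prod>r\<in>{0..<n}. \<beta> (p r) * x (p r) ^ r) * det (vandermonde n (x \<circ> p))" for p
  have \<phi>_eq: "\<phi> p = (\<Sum>\<sigma>\<in>Pm. signof \<sigma> * (\<Prod>r\<in>{0..<n}. f \<sigma> r (p r)))" for p
  proof -
    have "det (vandermonde n (x \<circ> p)) = (\<Sum>\<sigma>\<in>Pm. signof \<sigma> * (\<Prod>r\<in>{0..<n}. x (p r) ^ \<sigma> r))"
      unfolding det_def'[OF vandermonde_carrier] Pm_def
      by (intro sum.cong refl arg_cong2[of _ _ _ _ "(*)"] prod.cong)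
         (auto simp: vandermonde_def dest: permutes_in_image)
    then show ?thesis
      by (simp add: \<phi>_def sum_distrib_left f_def power_add prod.distrib mult_ac)
  qed
  have fs: "(\<lambda>p. \<Prod>r\<in>{0..<n}. f \<sigma> r (p r)) summable_on T" for \<sigma>
    unfolding T_def by (intro summable_on_prod_PiE) (auto simp: f_def intro: sm)
  have \<phi>hs: "(\<phi> has_sum (\<Sum>\<sigma>\<in>Pm. signof \<sigma> * (\<Sum>\<^sub>\<infinity>p\<in>T. \<Prod>r\<in>{0..<n}. f \<sigma> r (p r)))) T"
    unfolding \<phi>_eq[abs_def] by (intro has_sum_finite_sum fin has_sum_cmult_right has_sum_infsum fs)
  then have \<phi>s: "\<phi> summable_on T" by (rule has_sum_imp_summable)
  have "(\<Sum>\<^sub>\<infinity>p\<in>T. \<phi> p) = (\<Sum>\<sigma>\<in>Pm. signof \<sigma> * (\<Sum>\<^sub>\<infinity>p\<in>T. \<Prod>r\<in>{0..<n}. f \<sigma> r (p r)))"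
    by (rule infsumI[OF \<phi>hs])
  also have "\<dots> = (\<Sum>\<sigma>\<in>Pm. signof \<sigma> * (\<Prod>r\<in>{0..<n}. M $$ (r, \<sigma> r)))"
  proof (intro sum.cong refl arg_cong2[of _ _ _ _ "(*)"])
    fix \<sigma> assume \<sigma>: "\<sigma> \<in> Pm"
    have "(\<Sum>\<^sub>\<infinity>p\<in>T. \<Prod>r\<in>{0..<n}. f \<sigma> r (p r)) = (\<Prod>r\<in>{0..<n}. \<Sum>\<^sub>\<infinity>a\<in>S. f \<sigma> r a)"
      unfolding T_def by (intro infsum_prod_PiE_abs) (auto simp: f_def summable_on_iff_abs_summable_on_complex[symmetric] sm)
    also have "\<dots> = (\<Prod>r\<in>{0..<n}. M $$ (r, \<sigma> r))"
    proof (intro prod.cong refl)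
      fix r assume "r \<in> {0..<n}"
      then show "(\<Sum>\<^sub>\<infinity>a\<in>S. f \<sigma> r a) = M $$ (r, \<sigma> r)"
        using permutes_in_image[of \<sigma> "{0..<n}" r] \<sigma> by (simp add: M_def f_def Pm_def)
    qed
    finally show "(\<Sum>\<^sub>\<infinity>p\<in>T. \<Prod>r\<in>{0..<n}. f \<sigma> r (p r)) = \<dots>" .
  qed
  also have "\<dots> = det M"
    unfolding Pm_def by (rule det_def'[symmetric]) (simp add: M_def)
  finally have sum_\<phi>: "(\<Sum>\<^sub>\<infinity>p\<in>T. \<phi> p) = det M" .

  \<comment> \<open>Different elements may share a key. Their nodes agree, so such a tuple gives two
    equal rows and contributes 0.\<close>
  define T' where "T' = {p \<in> T. inj_on (key \<circ> p) {0..<n}}"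
  have \<phi>_0: "\<phi> p = 0" if p: "p \<in> T - T'" for p
  proof -
    obtain r s where rs: "r < n" "s < n" "r \<noteq> s" "key (p r) = key (p s)"
      using p by (auto simp: T'_def inj_on_def)
    have "row (vandermonde n (x \<circ> p)) r = row (vandermonde n (x \<circ> p)) s"
      using rs key[OF rs(4)] by (intro eq_vecI) (auto simp: vandermonde_def)
    then have "det (vandermonde n (x \<circ> p)) = 0"
      by (rule det_identical_rows[OF vandermonde_carrier rs(3,1,2)])
    then show ?thesis by (simp add: \<phi>_def)
  qed
  have sum_T': "(\<Sum>\<^sub>\<infinity>p\<in>T. \<phi> p) = (\<Sum>\<^sub>\<infinity>p\<in>T'. \<phi> p)"
    by (rule infsum_cong_neutral) (use \<phi>_0 in \<open>auto simp: T'_def\<close>)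
  have \<phi>s': "\<phi> summable_on T'"
    by (rule summable_on_subset_banach[OF \<phi>s]) (auto simp: T'_def)

  have comp_T: "p \<circ> \<sigma> \<in> T" if "p \<in> T" "\<sigma> permutes {0..<n}" for p \<sigma>
    using that permutes_in_image[OF that(2)] permutes_not_in[OF that(2)]
    by (auto simp: T_def PiE_iff extensional_def)
  define i where "i = (\<lambda>(p :: nat \<Rightarrow> 'a, \<sigma> :: nat \<Rightarrow> nat). p \<circ> \<sigma>)"
  define j where "j p = (p \<circ> Hilbert_Choice.inv (rank_perm n (key \<circ> p)), rank_perm n (key \<circ> p))" for p
  have ij: "i (j p) = p" if "p \<in> T'" for p
  proof -
    have "rank_perm n (key \<circ> p) permutes {0..<n}"
      using that by (intro rank_perm_permutes) (simp add: T'_def)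
    then have "Hilbert_Choice.inv (rank_perm n (key \<circ> p)) \<circ> rank_perm n (key \<circ> p) = id"
      by (rule permutes_inv_o(2))
    then show ?thesis by (simp add: i_def j_def comp_assoc)
  qed
  have j: "j p \<in> D \<times> Pm" if p: "p \<in> T'" for p
  proof -
    define \<sigma> where "\<sigma> = rank_perm n (key \<circ> p)"
    define \<tau> where "\<tau> = Hilbert_Choice.inv \<sigma>"
    have \<sigma>: "\<sigma> permutes {0..<n}"
      unfolding \<sigma>_def using p by (intro rank_perm_permutes) (simp add: T'_def)
    have \<tau>: "\<tau> permutes {0..<n}" unfolding \<tau>_def by (rule permutes_inv[OF \<sigma>])
    have \<sigma>\<tau>: "\<sigma> (\<tau> r) = r" for r unfolding \<tau>_def by (rule permutes_inverses(1)[OF \<sigma>])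
    have "key (p (\<tau> s)) < key (p (\<tau> r))" if rs: "r < s" "s < n" for r s
    proof (rule ccontr)
      assume *: "\<not> ?thesis"
      have "r < n" using rs by simp
      then have in_n: "\<tau> r \<in> {0..<n}" "\<tau> s \<in> {0..<n}"
        using rs permutes_in_image[OF \<tau>, of r] permutes_in_image[OF \<tau>, of s] by simp_all
      have "\<tau> r \<noteq> \<tau> s" using \<sigma>\<tau>[of r] \<sigma>\<tau>[of s] rs(1) by (metis less_irrefl)
      moreover have "inj_on (key \<circ> p) {0..<n}" using p by (simp add: T'_def)
      ultimately have "(key \<circ> p) (\<tau> r) \<noteq> (key \<circ> p) (\<tau> s)"
        using in_n by (metis inj_onD)
      with * have "\<sigma> (\<tau> s) < \<sigma> (\<tau> r)"
        using in_n unfolding \<sigma>_def by (intro rank_perm_less) simp_all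
      then show False using rs(1) by (simp add: \<sigma>\<tau>)
    qed
    moreover have "p \<circ> \<tau> \<in> T"
      using p by (intro comp_T \<tau>) (simp add: T'_def)
    ultimately show ?thesis using \<sigma> by (simp add: j_def D_def Pm_def T_def flip: \<sigma>_def \<tau>_def)
  qed
  have i: "i b \<in> T'" if b0: "b \<in> D \<times> Pm" for b
  proof -
    obtain p \<sigma> where b: "b = (p, \<sigma>)" "p \<in> D" "\<sigma> permutes {0..<n}" using b0 by (auto simp: Pm_def)
    have "inj_on (key \<circ> p) {0..<n}"
    proof (rule inj_onI)
      fix r s assume "r \<in> {0..<n}" "s \<in> {0..<n}" "(key \<circ> p) r = (key \<circ> p) s"
      moreover have "key (p s) < key (p r)" if "r < s" "s < n" for r s
        using b(2) that by (simp add: D_def)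
      ultimately show "r = s" by (cases r s rule: linorder_cases) force+
    qed
    then have "inj_on (key \<circ> p \<circ> \<sigma>) {0..<n}"
      by (intro comp_inj_on[OF permutes_inj_on[OF b(3)]]) (simp only: permutes_image[OF b(3)])
    then show ?thesis using b comp_T[of p \<sigma>] by (auto simp: i_def T'_def D_def T_def comp_assoc)
  qed
  have ji: "j (i b) = b" if b0: "b \<in> D \<times> Pm" for b
  proof -
    obtain p \<sigma> where b: "b = (p, \<sigma>)" "p \<in> D" "\<sigma> permutes {0..<n}" using b0 by (auto simp: Pm_def)
    have "rank_perm n ((key \<circ> p) \<circ> \<sigma>) = \<sigma>"
      using b by (intro rank_perm_comp) (auto simp: D_def)
    then show ?thesis using permutes_inv_o(1)[OF b(3)]
      by (simp add: i_def j_def b comp_assoc)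
  qed
  have e1: "\<phi> (i (j p)) = \<phi> p" if "p \<in> T'" for p using ij[OF that] by simp
  have sm_prod: "(\<lambda>b. \<phi> (i b)) summable_on D \<times> Pm"
    using summable_on_reindex_bij_witness[of T' i j "D \<times> Pm" "\<lambda>b. \<phi> (i b)" \<phi>, OF ij j ji i e1] \<phi>s' by simp
  have sum_prod: "(\<Sum>\<^sub>\<infinity>p\<in>T'. \<phi> p) = (\<Sum>\<^sub>\<infinity>b\<in>D \<times> Pm. \<phi> (i b))"
    by (rule infsum_reindex_bij_witness[of T' i j "D \<times> Pm" "\<lambda>b. \<phi> (i b)" \<phi>, OF ij j ji i e1])
  \<comment> \<open>Permuting the rows of the remaining determinant yields the sign that turns the
    permuted monomials into the Leibniz expansion of the transpose.\<close>
  have inner: "(\<Sum>\<^sub>\<infinity>\<sigma>\<in>Pm. \<phi> (i (p, \<sigma>))) = (\<Prod>r<n. \<beta> (p r)) * (det (vandermonde n (x \<circ> p)))\<^sup>2" for p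
  proof -
    let ?V = "vandermonde n (x \<circ> p)"
    have "\<phi> (i (p, \<sigma>)) = (\<Prod>r<n. \<beta> (p r)) * det ?V * (signof \<sigma> * (\<Prod>r\<in>{0..<n}. ?V\<^sup>T $$ (r, \<sigma> r)))" if "\<sigma> \<in> Pm" for \<sigma>
    proof -
      have \<sigma>: "\<sigma> permutes {0..<n}" using that by (simp add: Pm_def)
      have "vandermonde n (x \<circ> (p \<circ> \<sigma>)) = mat n n (\<lambda>(r, k). ?V $$ (\<sigma> r, k))"
        using permutes_in_image[OF \<sigma>] by (intro eq_matI) (auto simp: vandermonde_def)
      then have "det (vandermonde n (x \<circ> (p \<circ> \<sigma>))) = signof \<sigma> * det ?V"
        using det_permute_rows[OF vandermonde_carrier \<sigma>, of "x \<circ> p"] by simp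
      moreover have "(\<Prod>r\<in>{0..<n}. \<beta> (p (\<sigma> r))) = (\<Prod>r\<in>{0..<n}. \<beta> (p r))"
        by (rule prod.permute[OF \<sigma>, unfolded comp_def, symmetric])
      moreover have "(\<Prod>r\<in>{0..<n}. x (p (\<sigma> r)) ^ r) = (\<Prod>r\<in>{0..<n}. ?V\<^sup>T $$ (r, \<sigma> r))"
        using permutes_in_image[OF \<sigma>] by (intro prod.cong) (auto simp: vandermonde_def)
      ultimately show ?thesis
        by (simp add: \<phi>_def i_def prod.distrib atLeast0LessThan mult_ac)
    qed
    then have "(\<Sum>\<^sub>\<infinity>\<sigma>\<in>Pm. \<phi> (i (p, \<sigma>))) = (\<Prod>r<n. \<beta> (p r)) * det ?V * det ?V\<^sup>T"
      using fin by (simp add: det_def'[of "?V\<^sup>T" n] sum_distrib_left Pm_def)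
    then show ?thesis by (simp add: det_transpose[OF vandermonde_carrier] power2_eq_square mult.assoc)
  qed
  show "(\<lambda>p. (\<Prod>r<n. \<beta> (p r)) * (det (vandermonde n (x \<circ> p)))\<^sup>2) summable_on D"
  proof -
    have "(\<lambda>(p, \<sigma>). \<phi> (i (p, \<sigma>))) = (\<lambda>b. \<phi> (i b))" by auto
    then show ?thesis
      using summable_on_Sigma_banach[of "\<lambda>p \<sigma>. \<phi> (i (p, \<sigma>))" D "\<lambda>_. Pm"] sm_prod by (simp add: inner)
  qed
  have "(\<Sum>\<^sub>\<infinity>p\<in>D. (\<Prod>r<n. \<beta> (p r)) * (det (vandermonde n (x \<circ> p)))\<^sup>2) = (\<Sum>\<^sub>\<infinity>b\<in>D \<times> Pm. \<phi> (i b))"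
    using infsum_Sigma_banach[OF sm_prod] by (simp add: inner)
  then show "(\<Sum>\<^sub>\<infinity>p\<in>D. (\<Prod>r<n. \<beta> (p r)) * (det (vandermonde n (x \<circ> p)))\<^sup>2) =
      det (mat n n (\<lambda>(i, k). \<Sum>\<^sub>\<infinity>a\<in>S. \<beta> a * x a ^ (i + k)))"
    using sum_\<phi> sum_T' sum_prod by (simp add: M_def)
qed

section \<open>The moment determinant\<close>

text \<open>One term of the exponential series; it trades powers of a frequency for a slightly
  larger exponential.\<close>

lemma power_le_fact_exp:
  fixes x :: real
  assumes "x \<ge> 0"
  shows "x ^ p \<le> fact p * exp x"
proof -
  have "(\<lambda>n. x ^ n / fact n) sums exp x"
    using exp_converges[of x] by (simp add: field_simps)
  then have "(\<Sum>n\<in>{p}. x ^ n / fact n) \<le> exp x"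
    using assms by (intro sum_le_suminf[THEN order_trans[OF _ eq_refl[OF sums_unique[symmetric]]]])
      (auto simp: sums_iff)
  then show ?thesis by (simp add: field_simps)
qed

text \<open>The map k -> -1 - k is m -> -m on odd m = 2 k + 1.\<close>

lemma infsum_int_reflect:
  fixes f :: "int \<Rightarrow> complex"
  assumes "f summable_on UNIV" "\<And>k. f (- 1 - k) = f k"
  shows "(\<lambda>n. f (int n)) summable_on UNIV" "(\<Sum>\<^sub>\<infinity>k. f k) = 2 * (\<Sum>\<^sub>\<infinity>n. f (int n))"
proof -
  have s: "f summable_on {0..}" "f summable_on {..<0}"
    using assms(1) by (auto intro: summable_on_subset_banach)
  have "(\<lambda>n. f (int n)) summable_on UNIV \<longleftrightarrow> f summable_on {0..}"
    by (rule summable_on_reindex_bij_witness[of _ nat int]) auto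
  with s show "(\<lambda>n. f (int n)) summable_on UNIV" by simp
  have 1: "(\<Sum>\<^sub>\<infinity>k\<in>{0..}. f k) = (\<Sum>\<^sub>\<infinity>n. f (int n))"
    by (rule infsum_reindex_bij_witness[of _ int nat]) auto
  have 2: "(\<Sum>\<^sub>\<infinity>k\<in>{..<0}. f k) = (\<Sum>\<^sub>\<infinity>n. f (int n))"
  proof (rule infsum_reindex_bij_witness[of _ "\<lambda>n. - 1 - int n" "\<lambda>k. nat (- 1 - k)"])
    fix k :: int assume "k \<in> {..<0}"
    then have "int (nat (- 1 - k)) = - 1 - k" by simp
    then show "f (int (nat (- 1 - k))) = f k" using assms(2)[of k] by simp
  qed auto
  have "(\<Sum>\<^sub>\<infinity>k\<in>{0..} \<union> {..<0}. f k) = (\<Sum>\<^sub>\<infinity>k\<in>{0..}. f k) + (\<Sum>\<^sub>\<infinity>k\<in>{..<0}. f k)"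
    by (intro infsum_Un_disjoint s) auto
  moreover have "{0..} \<union> {..<0} = (UNIV :: int set)" by auto
  ultimately show "(\<Sum>\<^sub>\<infinity>k. f k) = 2 * (\<Sum>\<^sub>\<infinity>n. f (int n))"
    using 1 2 by simp
qed

section \<open>Theta constants, the normalised functions g and h, and their kernel\<close>

context nome
begin

text \<open>The exponent j^2 + j is unchanged under j -> -1 - j, so every triangular number occurs
  twice.\<close>

lemma Delta_eq: "theta w w = 2 * Delta q"
proof -
  define f where "f j = w ^ nat (j\<^sup>2 + j)" for j :: int
  have f: "f j = w powi (j\<^sup>2) * w powi j" for j
    by (simp add: f_def powi_square_mult_powi w_nonzero)
  have s: "f summable_on UNIV"
    unfolding f using theta_summable[OF norm_w w_nonzero] by simp
  have r: "f (- 1 - j) = f j" for j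
    by (simp add: f_def power2_eq_square algebra_simps)
  have "f (int n) = q ^ (n * (n + 1) div 2)" for n
  proof -
    have "nat ((int n)\<^sup>2 + int n) = n * (n + 1)" by (simp add: nat_eq_iff power2_eq_square algebra_simps)
    also have "\<dots> = 2 * (n * (n + 1) div 2)" by simp
    finally have "f (int n) = w ^ (2 * (n * (n + 1) div 2))" unfolding f_def by (rule arg_cong)
    then show ?thesis by (simp only: q_def power_mult)
  qed
  then have "(\<Sum>\<^sub>\<infinity>n. f (int n)) = Delta q"
    using has_sum_imp_sums[OF has_sum_infsum[OF infsum_int_reflect(1)[OF s r]]]
    by (simp add: Delta_def sums_iff)
  then show ?thesis
    using infsum_int_reflect(2)[OF s r] by (simp add: theta_def f)
qed

lemma Delta_square: "2 * (Delta q)\<^sup>2 = theta q q * theta q 1"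
  using theta_self_square[OF norm_w w_nonzero] unfolding Delta_eq q_def[symmetric]
  by (simp add: power2_eq_square)

text \<open>The factor between \<open>G\<close> and theta_1 theta_3. Only its square enters the
  determinant, and \<open>G_i_square\<close> determines that.\<close>

definition kappa where "kappa = 2 * \<i> / G \<i>"

lemma kappa_square: "kappa\<^sup>2 = 2 / (theta q q * theta q (-1))"
  using theta_self_nonzero[OF norm_q q_nonzero] theta_m1_nonzero[OF norm_q q_nonzero]
  by (simp add: kappa_def power_divide G_i_square power_mult_distrib divide_simps)

lemma G_eq: "z \<noteq> 0 \<Longrightarrow> G z = kappa * t1 z * th3 z"
proof -
  have "G \<i> \<noteq> 0"
    using G_i_square theta_self_nonzero[OF norm_q q_nonzero] theta_m1_nonzero[OF norm_q q_nonzero] by auto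
  then show "z \<noteq> 0 \<Longrightarrow> G z = kappa * t1 z * th3 z"
    using G_mult_G_i[of z] by (simp add: kappa_def field_simps)
qed

text \<open>The factor \<open>w\<close> in \<open>h\<close> shares the q = w^2 of
  \<open>th4_addition\<close> equally between x and y. With it, \<open>h\<close> is -k sn^2, where k
  is the modulus.\<close>

definition g where "g x = kappa * theta1 q x * th3 (exp (\<i> * x)) * inverse ((th4 (exp (\<i> * x)))\<^sup>2)"
definition h where "h x = w * (theta1 q x)\<^sup>2 * inverse ((th4 (exp (\<i> * x)))\<^sup>2)"

lemma exp_square: "(exp (\<i> * x))\<^sup>2 = exp (2 * \<i> * x)" for x :: complex
  using exp_double[of "\<i> * x"] by (simp add: mult.assoc)

lemma t1_exp: "t1 (exp (\<i> * x)) = theta1 q x"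
  by (simp add: t1_def theta1_def exp_square)

lemma th4_has_fps_expansion: "\<exists>F. (\<lambda>x. th4 (exp (\<i> * x))) has_fps_expansion F \<and> fps_nth F 0 = theta q (-1)"
proof -
  have "(-1 :: complex) \<noteq> 0" by simp
  from theta_has_fps_expansion[OF norm_q this, of 0] obtain F
    where F: "(\<lambda>x. exp (of_int 0 * \<i> * x) * theta q (- 1 * exp (2 * \<i> * x))) has_fps_expansion F" by blast
  then have "(\<lambda>x. th4 (exp (\<i> * x))) has_fps_expansion F"
    by (simp add: th4_def exp_square)
  then show ?thesis using has_fps_expansion_nth_0 by (force simp: th4_def)
qed

lemma th3_has_fps_expansion: "\<exists>F. (\<lambda>x. th3 (exp (\<i> * x))) has_fps_expansion F \<and> fps_nth F 0 = theta q 1"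
proof -
  from theta_has_fps_expansion[OF norm_q one_neq_zero, of 0] obtain F
    where F: "(\<lambda>x. exp (of_int 0 * \<i> * x) * theta q (1 * exp (2 * \<i> * x))) has_fps_expansion F" by blast
  then have "(\<lambda>x. th3 (exp (\<i> * x))) has_fps_expansion F"
    by (simp add: th3_def exp_square)
  then show ?thesis using has_fps_expansion_nth_0 by (force simp: th3_def)
qed

lemma g_h_expansions:
  obtains gF hF where "g has_fps_expansion gF" "h has_fps_expansion hF"
    "fps_nth gF 0 = 0" "fps_nth gF 1 = kappa * (\<i> * theta1_prime q) * theta q 1 / (theta q (-1))\<^sup>2"
    "fps_nth hF 0 = 0" "fps_nth hF 1 = 0" "fps_nth hF 2 = - w * (theta1_prime q)\<^sup>2 / (theta q (-1))\<^sup>2"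
proof -
  obtain F1 where F1: "theta1 q has_fps_expansion F1" "fps_nth F1 0 = 0" "fps_nth F1 1 = \<i> * theta1_prime q"
    using theta1_has_fps_expansion[OF norm_q q_nonzero] by blast
  obtain F3 where F3: "(\<lambda>x. th3 (exp (\<i> * x))) has_fps_expansion F3" "fps_nth F3 0 = theta q 1"
    using th3_has_fps_expansion by blast
  obtain F4 where F4: "(\<lambda>x. th4 (exp (\<i> * x))) has_fps_expansion F4" "fps_nth F4 0 = theta q (-1)"
    using th4_has_fps_expansion by blast
  define I where "I = inverse (F4 * F4)"
  have nz: "fps_nth (F4 * F4) 0 \<noteq> 0" using F4 theta_m1_nonzero[OF norm_q q_nonzero] by simp
  have I: "(\<lambda>x. inverse ((th4 (exp (\<i> * x)))\<^sup>2)) has_fps_expansion I"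
    unfolding I_def power2_eq_square by (intro has_fps_expansion_inverse has_fps_expansion_mult F4 nz)
  have I0: "fps_nth I 0 = 1 / (theta q (-1))\<^sup>2"
    using nz F4 by (simp add: I_def power2_eq_square divide_inverse)
  define gF where "gF = fps_const kappa * F1 * F3 * I"
  define hF where "hF = fps_const w * F1\<^sup>2 * I"
  have "g has_fps_expansion gF"
    unfolding g_def[abs_def] gF_def by (intro has_fps_expansion_mult has_fps_expansion_const F1 F3 I)
  moreover have "h has_fps_expansion hF"
    unfolding h_def[abs_def] hF_def power2_eq_square[of F1] power2_eq_square[of "theta1 q _"]
    by (intro has_fps_expansion_mult has_fps_expansion_const F1 I)
  moreover have "fps_nth gF 0 = 0" using F1 by (simp add: gF_def)
  moreover have "fps_nth gF 1 = kappa * (\<i> * theta1_prime q) * theta q 1 / (theta q (-1))\<^sup>2"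
    using F1 F3(2) I0 by (simp add: gF_def fps_mult_nth_1)
  moreover have "fps_nth hF 0 = 0" using F1 by (simp add: hF_def power2_eq_square)
  moreover have "fps_nth hF 1 = 0" using F1 by (simp add: hF_def power2_eq_square fps_mult_nth_1)
  moreover have "fps_nth hF 2 = - w * (theta1_prime q)\<^sup>2 / (theta q (-1))\<^sup>2"
  proof -
    have "fps_nth (F1\<^sup>2 * I) 2 = (\<i> * theta1_prime q)\<^sup>2 * (1 / (theta q (-1))\<^sup>2)"
      using fps_nth_square_2[OF F1(2)] F1(3) I0 by (simp add: fps_mult_nth eval_nat_numeral)
    then show ?thesis by (simp add: hF_def mult.assoc power_mult_distrib)
  qed
  ultimately show ?thesis by (rule that)
qed

text \<open>The kernel below is \<open>4\<close> times the sum of \<open>lam m sin (m x) sin (m y)\<close> over odd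
  \<open>m > 0\<close>; its Taylor coefficients are therefore the moments \<open>mom (i + k)\<close> up to signs and factorials.\<close>

definition Phi where "Phi x y = Cn (exp (\<i> * x) / exp (\<i> * y)) - Cn (exp (\<i> * x) * exp (\<i> * y))"

lemma annulus:
  assumes r: "norm w * exp (2 * r) < 1" and xy: "norm x < r" "norm y < r"
  shows "norm w < norm (exp (\<i> * x) / exp (\<i> * y))" "norm (exp (\<i> * x) / exp (\<i> * y)) * norm w < 1"
    "norm w < norm (exp (\<i> * x) * exp (\<i> * y))" "norm (exp (\<i> * x) * exp (\<i> * y)) * norm w < 1"
proof -
  have *: "norm w < exp t \<and> exp t * norm w < 1" if "\<bar>t\<bar> \<le> 2 * r" for t
  proof
    have "norm w < exp (- (2 * r))" using r by (simp add: exp_minus field_simps)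
    also have "\<dots> \<le> exp t" using that by simp
    finally show "norm w < exp t" .
    have "exp t * norm w \<le> exp (2 * r) * norm w" using that by (intro mult_right_mono) auto
    then show "exp t * norm w < 1" using r by (simp add: mult.commute)
  qed
  have "\<bar>Im x\<bar> < r" "\<bar>Im y\<bar> < r" using xy abs_Im_le_cmod[of x] abs_Im_le_cmod[of y] by linarith+
  then have "\<bar>Im y - Im x\<bar> \<le> 2 * r" "\<bar>- Im x - Im y\<bar> \<le> 2 * r" by linarith+
  from this[THEN *] show "norm w < norm (exp (\<i> * x) / exp (\<i> * y))" "norm (exp (\<i> * x) / exp (\<i> * y)) * norm w < 1"
    "norm w < norm (exp (\<i> * x) * exp (\<i> * y))" "norm (exp (\<i> * x) * exp (\<i> * y)) * norm w < 1"
    by (simp_all add: norm_divide norm_mult exp_diff exp_minus field_simps)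
qed

text \<open>\<open>G_mult\<close> gives the numerator and \<open>th4_addition\<close> the
  denominator. The identity is first cleared of \<open>th4 (z * v)\<close> and
  \<open>th4 (z / v)\<close>, so that only \<open>th4 z\<close> and \<open>th4 v\<close> have to be
  inverted.\<close>

lemma Phi_kernel:
  assumes r: "norm w * exp (2 * r) < 1" and xy: "norm x < r" "norm y < r"
    and nz: "th4 (exp (\<i> * x)) \<noteq> 0" "th4 (exp (\<i> * y)) \<noteq> 0"
  shows "Phi x y * (1 - h x * h y) = (- u 0 * (theta q (-1))\<^sup>2) * g x * g y"
proof -
  define z where "z = exp (\<i> * x)"
  define v where "v = exp (\<i> * y)"
  have z: "z \<noteq> 0" "v \<noteq> 0" by (simp_all add: z_def v_def)
  note a = annulus[OF r xy, folded z_def v_def]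
  have 1: "Cn (z / v) * th4 (z / v) = u 0 * t2 (z / v)" and 2: "Cn (z * v) * th4 (z * v) = u 0 * t2 (z * v)"
    using Cn_mult_th4 a by auto
  have "Phi x y * (th4 (z * v) * th4 (z / v)) =
      Cn (z / v) * th4 (z / v) * th4 (z * v) - Cn (z * v) * th4 (z * v) * th4 (z / v)"
    by (simp add: Phi_def z_def v_def algebra_simps)
  also have "\<dots> = - u 0 * (G z * G v)"
    unfolding 1 2 G_mult[OF z] by (simp add: algebra_simps)
  finally have "Phi x y * (th4 (z * v) * th4 (z / v)) * (th4 1)\<^sup>2 = - u 0 * (G z * G v) * (th4 1)\<^sup>2"
    by (rule arg_cong)
  then have "Phi x y * (th4 (z * v) * th4 (z / v) * (th4 1)\<^sup>2) = - u 0 * (th4 1)\<^sup>2 * (G z * G v)"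
    by (simp only: mult_ac)
  then have *: "Phi x y * ((th4 z)\<^sup>2 * (th4 v)\<^sup>2 - q * (t1 z)\<^sup>2 * (t1 v)\<^sup>2) = - u 0 * (theta q (-1))\<^sup>2 * (G z * G v)"
    unfolding th4_addition[OF z] by (simp add: th4_def)
  have gx: "g x = G z / (th4 z)\<^sup>2" "g y = G v / (th4 v)\<^sup>2"
    using G_eq[OF z(1)] G_eq[OF z(2)] by (simp_all add: g_def z_def v_def t1_exp divide_inverse)
  have hx: "h x = w * (t1 z)\<^sup>2 / (th4 z)\<^sup>2" "h y = w * (t1 v)\<^sup>2 / (th4 v)\<^sup>2"
    by (simp_all add: h_def z_def v_def t1_exp divide_inverse)
  have n: "th4 z \<noteq> 0" "th4 v \<noteq> 0" using nz by (simp_all add: z_def v_def)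
  have "h x * h y = q * (t1 z)\<^sup>2 * (t1 v)\<^sup>2 / ((th4 z)\<^sup>2 * (th4 v)\<^sup>2)"
    unfolding hx by (simp add: q_def power2_eq_square)
  then have "1 - h x * h y = ((th4 z)\<^sup>2 * (th4 v)\<^sup>2 - q * (t1 z)\<^sup>2 * (t1 v)\<^sup>2) / ((th4 z)\<^sup>2 * (th4 v)\<^sup>2)"
    using n by (simp add: field_simps)
  then have "Phi x y * (1 - h x * h y) = (- u 0 * (theta q (-1))\<^sup>2 * (G z * G v)) / ((th4 z)\<^sup>2 * (th4 v)\<^sup>2)"
    using * by simp
  then show ?thesis unfolding gx by simp
qed

section \<open>Taylor coefficients of the kernel as moments\<close>

definition freq :: "int \<Rightarrow> complex" where "freq k = of_int (2 * k + 1) * \<i>"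

lemma norm_freq: "norm (freq k) = \<bar>real_of_int (2 * k + 1)\<bar>"
  unfolding freq_def norm_mult norm_of_int by simp

text \<open>The Taylor coefficient of order p of \<open>Phi x y\<close> in x; \<open>mu p s\<close>
  below is the coefficient of order s of this function of y.\<close>

definition phi where "phi p y = (\<Sum>\<^sub>\<infinity>k::int. cf k * (exp (- freq k * y) - exp (freq k * y)) * freq k ^ p) / fact p"

text \<open>The factor 2 lets x and y both range over the disc of radius r. The witness makes the
  product |w|^(1/2).\<close>

lemma exists_radius: "\<exists>r>0. norm w * exp (2 * r) < 1"
proof -
  have w: "norm w > 0" using w_nonzero by simp
  define r where "r = - ln (norm w) / 4"
  have "norm w * exp (2 * r) = exp (ln (norm w) / 2)"
    using w exp_add[of "ln (norm w)" "2 * r"] by (simp add: r_def)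
  then have "norm w * exp (2 * r) < 1" using w norm_w by simp
  moreover have "r > 0" using w norm_w by (simp add: r_def)
  ultimately show ?thesis by blast
qed

lemma Phi_has_fps_expansion:
  assumes r: "r > 0" "norm w * exp (2 * r) < 1" and y: "norm y < r"
  shows "(\<lambda>x. Phi x y) has_fps_expansion Abs_fps (\<lambda>p. phi p y)"
proof -
  define c where "c k = cf k * (exp (- freq k * y) - exp (freq k * y))" for k
  have "(\<lambda>k. norm (c k) * exp (r * norm (freq k))) summable_on UNIV"
  proof (rule summable_on_comparison_test)
    show "(\<lambda>k. 2 * (norm (cf k) * exp (2 * r * \<bar>real_of_int (2 * k + 1)\<bar>))) summable_on UNIV"
      by (intro summable_on_cmult_right summable_cf_exp r)
    fix k
    have e: "norm (exp t) \<le> exp (r * norm (freq k))" if "norm t = norm (freq k) * norm y" for t :: complex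
    proof -
      have "norm (exp t) \<le> exp (norm t)" by (rule norm_exp)
      also have "\<dots> \<le> exp (r * norm (freq k))"
        using that y by (simp add: mult.commute mult_right_mono)
      finally show ?thesis .
    qed
    have "norm (exp (- freq k * y) - exp (freq k * y)) \<le> exp (r * norm (freq k)) + exp (r * norm (freq k))"
      by (rule norm_triangle_le_diff, intro add_mono e) (simp_all add: norm_mult)
    then have "norm (c k) * exp (r * norm (freq k)) \<le> norm (cf k) * (2 * exp (r * norm (freq k))) * exp (r * norm (freq k))"
      unfolding c_def norm_mult by (intro mult_right_mono mult_left_mono) auto
    also have "\<dots> = 2 * (norm (cf k) * (exp (r * norm (freq k)) * exp (r * norm (freq k))))" by simp
    also have "exp (r * norm (freq k)) * exp (r * norm (freq k)) = exp (2 * r * \<bar>real_of_int (2 * k + 1)\<bar>)"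
      unfolding norm_freq by (simp flip: exp_add)
    finally show "norm (c k) * exp (r * norm (freq k)) \<le> 2 * (norm (cf k) * exp (2 * r * \<bar>real_of_int (2 * k + 1)\<bar>))" .
  qed auto
  then have 1: "(\<lambda>x. \<Sum>\<^sub>\<infinity>k. c k * exp (freq k * x)) has_fps_expansion Abs_fps (\<lambda>p. phi p y)"
    using fourier_has_fps_expansion[of r c freq UNIV] r by (simp add: phi_def c_def mult_ac)
  have 2: "eventually (\<lambda>x. (\<Sum>\<^sub>\<infinity>k. c k * exp (freq k * x)) = Phi x y) (nhds 0)"
  proof -
    have "eventually (\<lambda>x::complex. x \<in> ball 0 r) (nhds 0)"
      using r by (intro eventually_nhds_in_open) auto
    then show ?thesis
    proof eventually_elim
      case (elim x)
      then have x: "norm x < r" by simp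
      note a = annulus[OF r(2) x y]
      have e: "(exp (\<i> * x) / exp (\<i> * y)) powi (2 * k + 1) = exp (freq k * x) * exp (- freq k * y)"
        "(exp (\<i> * x) * exp (\<i> * y)) powi (2 * k + 1) = exp (freq k * x) * exp (freq k * y)" for k
        unfolding freq_def exp_diff[symmetric] exp_add[symmetric] exp_power_int
        by (rule arg_cong[where f = exp]; simp add: algebra_simps)+
      have "Phi x y = (\<Sum>\<^sub>\<infinity>k. cf k * (exp (\<i> * x) / exp (\<i> * y)) powi (2 * k + 1) + - (cf k * (exp (\<i> * x) * exp (\<i> * y)) powi (2 * k + 1)))"
        using infsum_add[OF Cn_summable[OF a(1,2)] summable_on_uminus[THEN iffD2, OF Cn_summable[OF a(3,4)]]]
        by (simp add: Phi_def Cn_def infsum_uminus)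
      also have "\<dots> = (\<Sum>\<^sub>\<infinity>k. c k * exp (freq k * x))"
        unfolding e c_def by (intro infsum_cong) (simp add: algebra_simps)
      finally show ?case by simp
    qed
  qed
  show ?thesis using 1 has_fps_expansion_cong[OF 2 refl] by blast
qed

lemma summable_cf_freq_exp:
  assumes r: "r > 0" "norm w * exp (2 * r) < 1"
  shows "(\<lambda>k. norm (cf k * freq k ^ p) * exp (r * norm (freq k))) summable_on UNIV"
proof (rule summable_on_comparison_test)
  show "(\<lambda>k. fact p / r ^ p * (norm (cf k) * exp (2 * r * \<bar>real_of_int (2 * k + 1)\<bar>))) summable_on UNIV"
    by (intro summable_on_cmult_right summable_cf_exp r)
  fix k
  have "(r * norm (freq k)) ^ p \<le> fact p * exp (r * norm (freq k))"
    using r by (intro power_le_fact_exp) auto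
  then have "norm (freq k) ^ p \<le> fact p / r ^ p * exp (r * norm (freq k))"
    using r by (simp add: power_mult_distrib field_simps)
  then have "norm (cf k) * norm (freq k) ^ p * exp (r * norm (freq k)) \<le>
      norm (cf k) * (fact p / r ^ p * exp (r * norm (freq k))) * exp (r * norm (freq k))"
    by (intro mult_right_mono mult_left_mono) auto
  also have "\<dots> = fact p / r ^ p * (norm (cf k) * (exp (r * norm (freq k)) * exp (r * norm (freq k))))" by simp
  also have "exp (r * norm (freq k)) * exp (r * norm (freq k)) = exp (2 * r * \<bar>real_of_int (2 * k + 1)\<bar>)"
    unfolding norm_freq by (simp flip: exp_add)
  finally show "norm (cf k * freq k ^ p) * exp (r * norm (freq k)) \<le> fact p / r ^ p * (norm (cf k) * exp (2 * r * \<bar>real_of_int (2 * k + 1)\<bar>))"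
    by (simp add: norm_mult norm_power)
qed auto

definition mu where
  "mu p s = ((\<Sum>\<^sub>\<infinity>k::int. cf k * freq k ^ p * (- freq k) ^ s) - (\<Sum>\<^sub>\<infinity>k::int. cf k * freq k ^ p * freq k ^ s)) / (fact p * fact s)"

lemma phi_has_fps_expansion: "phi p has_fps_expansion Abs_fps (mu p)"
proof -
  obtain r where r: "r > 0" "norm w * exp (2 * r) < 1" using exists_radius by blast
  define d where "d k = cf k * freq k ^ p" for k
  note sm = summable_cf_freq_exp[OF r, of p, folded d_def]
  have sm': "(\<lambda>k. norm (d k) * exp (r * norm (- freq k))) summable_on UNIV" using sm by simp
  have "(\<lambda>y. ((\<Sum>\<^sub>\<infinity>k. d k * exp (- freq k * y)) - (\<Sum>\<^sub>\<infinity>k. d k * exp (freq k * y))) * (1 / fact p)) has_fps_expansion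
    (Abs_fps (\<lambda>s. (\<Sum>\<^sub>\<infinity>k. d k * (- freq k) ^ s) / fact s) - Abs_fps (\<lambda>s. (\<Sum>\<^sub>\<infinity>k. d k * freq k ^ s) / fact s)) * fps_const (1 / fact p)"
    by (intro has_fps_expansion_mult has_fps_expansion_diff has_fps_expansion_const
        fourier_has_fps_expansion[OF r(1) sm] fourier_has_fps_expansion[OF r(1) sm'])
  also have "(Abs_fps (\<lambda>s. (\<Sum>\<^sub>\<infinity>k. d k * (- freq k) ^ s) / fact s) - Abs_fps (\<lambda>s. (\<Sum>\<^sub>\<infinity>k. d k * freq k ^ s) / fact s)) * fps_const (1 / fact p) = Abs_fps (mu p)"
    by (intro fps_ext) (simp add: mu_def d_def diff_divide_distrib mult.commute)
  finally have 1: "(\<lambda>y. ((\<Sum>\<^sub>\<infinity>k. d k * exp (- freq k * y)) - (\<Sum>\<^sub>\<infinity>k. d k * exp (freq k * y))) * (1 / fact p)) has_fps_expansion Abs_fps (mu p)" .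
  have 2: "eventually (\<lambda>y. ((\<Sum>\<^sub>\<infinity>k. d k * exp (- freq k * y)) - (\<Sum>\<^sub>\<infinity>k. d k * exp (freq k * y))) * (1 / fact p) = phi p y) (nhds 0)"
  proof -
    have "eventually (\<lambda>x::complex. x \<in> ball 0 r) (nhds 0)"
      using r by (intro eventually_nhds_in_open) auto
    then show ?thesis
    proof eventually_elim
      case (elim y)
      then have y: "norm y < r" by simp
      have s: "(\<lambda>k. d k * exp (l k * y)) summable_on UNIV" if "\<And>k. norm (l k) = norm (freq k)" for l
      proof (rule abs_summable_summable, rule Infinite_Sum.abs_summable_on_comparison_test'[OF sm])
        fix k
        have "norm (exp (l k * y)) \<le> exp (norm (l k * y))" by (rule norm_exp)
        also have "\<dots> \<le> exp (r * norm (freq k))"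
          using that[of k] y by (simp add: norm_mult mult.commute mult_right_mono)
        finally show "norm (d k * exp (l k * y)) \<le> norm (d k) * exp (r * norm (freq k))"
          by (simp add: norm_mult mult_left_mono)
      qed
      have "(\<Sum>\<^sub>\<infinity>k. d k * exp (- freq k * y)) - (\<Sum>\<^sub>\<infinity>k. d k * exp (freq k * y)) =
          (\<Sum>\<^sub>\<infinity>k. d k * exp (- freq k * y) + - (d k * exp (freq k * y)))"
        using infsum_add[OF s[of "\<lambda>k. - freq k"] summable_on_uminus[THEN iffD2, OF s[of freq]]]
        by (simp add: infsum_uminus)
      also have "\<dots> = (\<Sum>\<^sub>\<infinity>k::int. cf k * (exp (- freq k * y) - exp (freq k * y)) * freq k ^ p)"
        by (intro infsum_cong) (simp add: d_def algebra_simps)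
      finally show ?case by (simp add: phi_def)
    qed
  qed
  show ?thesis using 1 has_fps_expansion_cong[OF 2 refl] by blast
qed

text \<open>Moment of order e at the nodes m^2 with weight m^2 \<open>lam m\<close>; the extra
  square stems from the two odd Taylor orders.\<close>

definition mom where "mom e = (\<Sum>\<^sub>\<infinity>m\<in>{m. odd m}. of_nat m ^ (2 * e + 2) * lam m)"

lemma summable_cf_freq: "(\<lambda>k. cf k * freq k ^ p) summable_on UNIV"
proof -
  obtain r where r: "r > 0" "norm w * exp (2 * r) < 1" using exists_radius by blast
  show ?thesis
    by (rule abs_summable_summable, rule Infinite_Sum.abs_summable_on_comparison_test'[OF summable_cf_freq_exp[OF r, of p]])
       (use r in \<open>simp add: mult_le_cancel_left1\<close>)
qed

lemma bij_nat_odd: "bij_betw (\<lambda>n::nat. 2 * n + 1) UNIV {m. odd m}"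
  by (rule bij_betwI[of _ _ _ "\<lambda>m. m div 2"]) auto

text \<open>The 2 counts the frequencies m and -m, the sign is
  \<open>\<i> ^ (2 * e + 2)\<close>.\<close>

lemma sum_cf_freq: "(\<Sum>\<^sub>\<infinity>k. cf k * freq k ^ (2 * e + 2)) = 2 * (-1) ^ (e + 1) * mom e"
proof -
  define f where "f k = cf k * freq k ^ (2 * e + 2)" for k
  have s: "f summable_on UNIV" unfolding f_def by (rule summable_cf_freq)
  have "freq (- 1 - k) = - freq k" "cf (- 1 - k) = cf k" for k
  proof -
    have *: "2 * (- 1 - k) + 1 = - (2 * k + 1)" by simp
    show "freq (- 1 - k) = - freq k" "cf (- 1 - k) = cf k"
      unfolding freq_def cf_def * by (simp_all only: of_int_minus mult_minus_left abs_minus_cancel)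
  qed
  then have r: "f (- 1 - k) = f k" for k by (simp add: f_def)
  have f: "f (int n) = (-1) ^ (e + 1) * (of_nat (2 * n + 1) ^ (2 * e + 2) * lam (2 * n + 1))" for n
  proof -
    have "nat \<bar>2 * int n + 1\<bar> = 2 * n + 1" by simp
    moreover have "\<i> ^ (2 * e + 2) = (-1) ^ (e + 1)"
      using power_mult[of \<i> 2 "e + 1"] by simp
    ultimately show ?thesis
      by (simp only: f_def cf_def freq_def power_mult_distrib) (simp add: add.commute)
  qed
  have "mom e = (\<Sum>\<^sub>\<infinity>n. of_nat (2 * n + 1) ^ (2 * e + 2) * lam (2 * n + 1))"
    unfolding mom_def by (rule infsum_reindex_bij_betw[OF bij_nat_odd, symmetric])
  then have "(\<Sum>\<^sub>\<infinity>n. f (int n)) = (-1) ^ (e + 1) * mom e"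
    unfolding f infsum_cmult_right' by simp
  then show "(\<Sum>\<^sub>\<infinity>k. cf k * freq k ^ (2 * e + 2)) = 2 * (-1) ^ (e + 1) * mom e"
    using infsum_int_reflect(2)[OF s r] by (simp add: f_def)
qed

text \<open>At odd order in y the two sums of \<open>mu\<close> are opposite, so their difference
  doubles; with the 2 from \<open>sum_cf_freq\<close> this gives the 4.\<close>

lemma mu_odd: "mu (2 * i + 1) (2 * k + 1) = 4 * (-1) ^ (i + k) * mom (i + k) / (fact (2 * i + 1) * fact (2 * k + 1))"
proof -
  have e: "2 * i + 1 + (2 * k + 1) = 2 * (i + k) + 2" by simp
  have "(\<Sum>\<^sub>\<infinity>j::int. cf j * freq j ^ (2 * i + 1) * freq j ^ (2 * k + 1)) = 2 * (-1) ^ (i + k + 1) * mom (i + k)"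
  proof -
    have "freq j ^ (2 * i + 1) * freq j ^ (2 * k + 1) = freq j ^ (2 * (i + k) + 2)" for j
      by (simp only: power_add[symmetric] e)
    then show ?thesis unfolding sum_cf_freq[symmetric] by (simp only: mult.assoc)
  qed
  moreover have "(\<Sum>\<^sub>\<infinity>j::int. cf j * freq j ^ (2 * i + 1) * (- freq j) ^ (2 * k + 1)) =
      - (\<Sum>\<^sub>\<infinity>j::int. cf j * freq j ^ (2 * i + 1) * freq j ^ (2 * k + 1))"
    by (simp add: infsum_uminus)
  ultimately show ?thesis by (simp add: mu_def)
qed

text \<open>In the expansion \<open>A g(x) g(y) / (1 - h(x) h(y)) = A \<Sum>j. (g h\<^sup>j)(x) (g h\<^sup>j)(y)\<close> the function
  \<open>g h\<^sup>j\<close> vanishes at \<open>0\<close> to order exactly \<open>2 j + 1\<close>, which triangularises the moment matrix.\<close>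

theorem det_mom:
  "det (mat n n (\<lambda>(i, k). mom (i + k))) =
    (\<Prod>j<n. w * (theta q 1)\<^sup>2 * Delta q ^ 4 * (16 * w\<^sup>2 * Delta q ^ 8) ^ j * (fact (2 * j + 1))\<^sup>2)"
proof -
  obtain gF hF where gF: "g has_fps_expansion gF" and hF: "h has_fps_expansion hF"
    and g0: "fps_nth gF 0 = 0" and g1: "fps_nth gF 1 = kappa * (\<i> * theta1_prime q) * theta q 1 / (theta q (-1))\<^sup>2"
    and h0: "fps_nth hF 0 = 0" and h1: "fps_nth hF 1 = 0" and h2: "fps_nth hF 2 = - w * (theta1_prime q)\<^sup>2 / (theta q (-1))\<^sup>2"
    by (rule g_h_expansions)
  obtain r where r: "r > 0" "norm w * exp (2 * r) < 1" using exists_radius by blast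
  have ball: "eventually (\<lambda>y::complex. norm y < r) (nhds 0)"
    using eventually_nhds_in_open[of "ball 0 r" "0::complex"] r by simp
  obtain F4 where F4: "(\<lambda>x. th4 (exp (\<i> * x))) has_fps_expansion F4"
    using th4_has_fps_expansion by blast
  note nz = theta_m1_nonzero[OF norm_q q_nonzero] theta_1_nonzero[OF norm_q q_nonzero] theta_self_nonzero[OF norm_q q_nonzero]
  have ev4: "eventually (\<lambda>x. th4 (exp (\<i> * x)) \<noteq> 0) (nhds 0)"
  proof -
    have "isCont (\<lambda>x. th4 (exp (\<i> * x))) 0" by (rule has_fps_expansion_imp_continuous[OF F4])
    then have "((\<lambda>x. th4 (exp (\<i> * x))) \<longlongrightarrow> th4 (exp (\<i> * 0))) (nhds 0)"
      unfolding isCont_def by (rule tendsto_at_iff_tendsto_nhds[THEN iffD1])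
    moreover have "th4 (exp (\<i> * 0)) = theta q (-1)" by (simp add: th4_def)
    ultimately have "((\<lambda>x. th4 (exp (\<i> * x))) \<longlongrightarrow> theta q (-1)) (nhds 0)" by (simp only:)
    then show ?thesis using nz(1) by (intro tendsto_imp_eventually_ne)
  qed
  define A where "A = - u 0 * (theta q (-1))\<^sup>2"
  have mu: "mu p s = A * (\<Sum>j<n. fps_nth (gF * hF ^ j) p * fps_nth (gF * hF ^ j) s)" if "p < 2 * n" for p s
  proof (rule kernel_coefficients[OF gF hF h0 h1 g0 _ phi_has_fps_expansion _ that])
    show "eventually (\<lambda>y. (\<lambda>x. Phi x y) has_fps_expansion Abs_fps (\<lambda>p. phi p y)) (nhds 0)"
      using ball by eventually_elim (rule Phi_has_fps_expansion[OF r])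
    show "eventually (\<lambda>y. eventually (\<lambda>x. Phi x y * (1 - h x * h y) = A * g x * g y) (nhds 0)) (nhds 0)"
      using ball ev4
    proof eventually_elim
      case y: (elim y)
      from ball ev4 show ?case
        by eventually_elim (use y Phi_kernel[OF r(2)] in \<open>simp add: A_def\<close>)
    qed
  qed
  \<comment> \<open>The signs and factorials of \<open>mu_odd\<close> split into a factor for i and
    one for k, so they are moved into the triangular matrix.\<close>
  define B where "B i j = (-1) ^ i * fact (2 * i + 1) * fps_nth (gF * hF ^ j) (2 * i + 1)" for i j
  have "mom (i + k) = A / 4 * (\<Sum>j<n. B i j * B k j)" if "i < n" for i k
  proof -
    have "4 * (-1) ^ (i + k) * mom (i + k) / (fact (2 * i + 1) * fact (2 * k + 1)) =
        A * (\<Sum>j<n. fps_nth (gF * hF ^ j) (2 * i + 1) * fps_nth (gF * hF ^ j) (2 * k + 1))"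
      using that unfolding mu_odd[symmetric] by (intro mu) simp
    then have "4 * (-1) ^ (i + k) * mom (i + k) =
        A * (\<Sum>j<n. fps_nth (gF * hF ^ j) (2 * i + 1) * fps_nth (gF * hF ^ j) (2 * k + 1)) * (fact (2 * i + 1) * fact (2 * k + 1))"
      by (simp only: nonzero_divide_eq_eq[of "fact (2 * i + 1) * fact (2 * k + 1) :: complex"] mult_eq_0_iff fact_nonzero simp_thms)
    then have "(-1) ^ (i + k) * (4 * (-1) ^ (i + k) * mom (i + k)) =
        A * ((-1) ^ i * (-1) ^ k * (fact (2 * i + 1) * fact (2 * k + 1)) * (\<Sum>j<n. fps_nth (gF * hF ^ j) (2 * i + 1) * fps_nth (gF * hF ^ j) (2 * k + 1)))"
      by (simp only: power_add mult_ac)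
    also have "(-1) ^ (i + k) * (4 * (-1) ^ (i + k) * mom (i + k)) = 4 * mom (i + k)"
      by (simp flip: power_mult_distrib)
    also have "(-1) ^ i * (-1) ^ k * (fact (2 * i + 1) * fact (2 * k + 1)) * (\<Sum>j<n. fps_nth (gF * hF ^ j) (2 * i + 1) * fps_nth (gF * hF ^ j) (2 * k + 1))
        = (\<Sum>j<n. B i j * B k j)"
      unfolding sum_distrib_left B_def by (intro sum.cong refl) (simp only: mult_ac)
    finally show ?thesis by (simp add: mult.commute)
  qed
  then have "mat n n (\<lambda>(i, k). mom (i + k)) = mat n n (\<lambda>(i, k). A / 4 * (\<Sum>j<n. B i j * B k j))"
    by (intro eq_matI) auto
  also have "det \<dots> = (A / 4) ^ n * (\<Prod>j<n. (B j j)\<^sup>2)"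
    by (rule det_LDL) (simp add: B_def fps_nth_mult_power_below(1)[OF g0 h0 h1])
  also have "\<dots> = (\<Prod>j<n. A / 4 * (B j j)\<^sup>2)"
    by (simp only: prod.distrib prod_constant card_lessThan)
  also have "\<dots> = (\<Prod>j<n. w * (theta q 1)\<^sup>2 * Delta q ^ 4 * (16 * w\<^sup>2 * Delta q ^ 8) ^ j * (fact (2 * j + 1))\<^sup>2)"
  proof (intro prod.cong refl)
    fix j
    have D4: "theta q q ^ 2 * theta q 1 ^ 2 = 4 * Delta q ^ 4"
      unfolding power_mult_distrib[symmetric] Delta_square[symmetric]
      by (simp add: power_mult_distrib flip: power_mult)
    \<comment> \<open>After Jacobi's formula all powers of theta_4 cancel and w theta_2^2 theta_3^4
      / 4 is left; \<open>D4\<close> then trades theta_2 for \<open>Delta\<close>.\<close>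
    have "A / 4 * (fps_nth gF 1)\<^sup>2 = w * theta q q ^ 2 * theta q 1 ^ 2 * theta q 1 ^ 2 / 4"
      unfolding A_def g1 u_0_eq power_mult_distrib power_divide kappa_square theta1_prime_eq[OF norm_q q_nonzero]
      using nz by (simp add: field_simps eval_nat_numeral)
    also have "\<dots> = w * (theta q q ^ 2 * theta q 1 ^ 2) * theta q 1 ^ 2 / 4" by simp
    also have "\<dots> = w * (theta q 1)\<^sup>2 * Delta q ^ 4" unfolding D4 by simp
    finally have a: "A / 4 * (fps_nth gF 1)\<^sup>2 = w * (theta q 1)\<^sup>2 * Delta q ^ 4" .
    have "fps_nth hF 2 = - w * (theta q q ^ 2 * theta q 1 ^ 2)"
      unfolding h2 theta1_prime_eq[OF norm_q q_nonzero] using nz by (simp add: field_simps power_mult_distrib)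
    also have "\<dots> = - (4 * w * Delta q ^ 4)" unfolding D4 by simp
    finally have b: "(fps_nth hF 2)\<^sup>2 = 16 * w\<^sup>2 * Delta q ^ 8"
      by (simp add: power_mult_distrib flip: power_mult)
    have "(B j j)\<^sup>2 = (fact (2 * j + 1))\<^sup>2 * (fps_nth gF 1)\<^sup>2 * ((fps_nth hF 2)\<^sup>2) ^ j"
      unfolding B_def fps_nth_mult_power_below(2)[OF g0 h0 h1] power_mult_distrib
      by (simp add: mult.commute flip: power_mult)
    then have "A / 4 * (B j j)\<^sup>2 = (A / 4 * (fps_nth gF 1)\<^sup>2) * ((fps_nth hF 2)\<^sup>2) ^ j * (fact (2 * j + 1))\<^sup>2"
      by simp
    then show "A / 4 * (B j j)\<^sup>2 = w * (theta q 1)\<^sup>2 * Delta q ^ 4 * (16 * w\<^sup>2 * Delta q ^ 8) ^ j * (fact (2 * j + 1))\<^sup>2"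
      unfolding a b .
  qed
  finally show ?thesis .
qed

end

section \<open>The double series over m and y\<close>

context nome
begin

text \<open>The sum over \<open>y\<close> is absorbed into the weights: tuples are indexed by pairs \<open>(m, y)\<close>, and
  summing \<^term>\<open>weight (m, y)\<close> over \<open>y\<close> gives the weight \<^term>\<open>of_nat m ^ 2 * lam m\<close> of the node \<open>m\<^sup>2\<close>.\<close>

definition weight :: "nat \<times> nat \<Rightarrow> complex" where
  "weight = (\<lambda>(m, y). (-1) ^ ((y - 1) div 2) * of_nat m ^ 2 * w ^ (m * y))"

abbreviation odds :: "nat set" where "odds \<equiv> {k. odd k}"

text \<open>For y = 2 c + 1 a geometric series of ratio -w^(2 m), the alternating sign producing the
  denominator 1 + w^(2 m). The version with norms serves absolute convergence.\<close>

lemma lam_series: "odd m \<Longrightarrow> ((\<lambda>y. (-1) ^ ((y - 1) div 2) * w ^ (m * y)) has_sum lam m) odds"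
  and lam_series_norm: "odd m \<Longrightarrow> ((\<lambda>y. norm w ^ (m * y)) has_sum (norm w ^ m / (1 - norm w ^ (2 * m)))) odds"
proof -
  assume m: "odd m"
  then have "m > 0" by (cases m) auto
  have a: "norm w ^ (2 * m) < 1"
    using \<open>m > 0\<close> norm_w by (simp add: power_less_one_iff)
  have ab: "norm (- (w ^ (2 * m))) < 1" using a by (simp add: norm_power)
  have 1: "(\<lambda>c. norm w ^ m * (norm w ^ (2 * m)) ^ c) sums (norm w ^ m * (1 / (1 - norm w ^ (2 * m))))"
    using a by (intro sums_mult geometric_sums) simp
  then have "((\<lambda>c. norm w ^ m * (norm w ^ (2 * m)) ^ c) has_sum (norm w ^ m / (1 - norm w ^ (2 * m)))) UNIV"
    by (intro sums_nonneg_imp_has_sum) simp_all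
  also have "(\<lambda>c. norm w ^ m * (norm w ^ (2 * m)) ^ c) = (\<lambda>c. norm w ^ (m * (2 * c + 1)))"
  proof
    fix c
    have "m * (2 * c + 1) = m + 2 * m * c" by (simp add: algebra_simps)
    then show "norm w ^ m * (norm w ^ (2 * m)) ^ c = norm w ^ (m * (2 * c + 1))"
      by (simp only: power_add power_mult)
  qed
  finally show "((\<lambda>y. norm w ^ (m * y)) has_sum (norm w ^ m / (1 - norm w ^ (2 * m)))) odds"
    by (subst has_sum_reindex_bij_betw[OF bij_nat_odd, symmetric])
  have "(\<lambda>c. w ^ m * (- (w ^ (2 * m))) ^ c) sums (w ^ m * (1 / (1 - (- (w ^ (2 * m))))))"
    using ab by (intro sums_mult geometric_sums)
  moreover have "summable (\<lambda>c. norm (w ^ m * (- (w ^ (2 * m))) ^ c))"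
    using sums_summable[OF 1] by (simp add: norm_mult norm_power)
  ultimately have "((\<lambda>c. w ^ m * (- (w ^ (2 * m))) ^ c) has_sum lam m) UNIV"
    unfolding lam_def by (intro norm_summable_imp_has_sum) simp_all
  also have "(\<lambda>c. w ^ m * (- (w ^ (2 * m))) ^ c) = (\<lambda>c. (-1) ^ (((2 * c + 1) - 1) div 2) * w ^ (m * (2 * c + 1)))"
  proof
    fix c
    have "(- (w ^ (2 * m))) ^ c = (-1) ^ c * w ^ (2 * m * c)"
      using power_mult_distrib[of "-1" "w ^ (2 * m)" c] by (simp add: power_mult)
    moreover have "m * (2 * c + 1) = 2 * m * c + m" by (simp add: algebra_simps)
    moreover have "((2 * c + 1) - 1) div 2 = c" by simp
    ultimately show "w ^ m * (- (w ^ (2 * m))) ^ c = (-1) ^ (((2 * c + 1) - 1) div 2) * w ^ (m * (2 * c + 1))"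
      by (simp only: power_add mult_ac)
  qed
  finally show "((\<lambda>y. (-1) ^ ((y - 1) div 2) * w ^ (m * y)) has_sum lam m) odds"
    by (subst has_sum_reindex_bij_betw[OF bij_nat_odd, symmetric])
qed

text \<open>Summing the norms over y first leaves \<open>N m\<close>, whose polynomial factor is
  absorbed by exp (r m); a geometric series in m remains.\<close>

lemma weight_summable: "(\<lambda>a. weight a * ((of_nat (fst a))\<^sup>2) ^ e) summable_on odds \<times> odds"
proof -
  define N where "N m = real m ^ (2 * e + 2) * (norm w ^ m / (1 - norm w ^ (2 * m)))" for m
  obtain r where r: "r > 0" "norm w * exp (2 * r) < 1" using exists_radius by blast
  have "exp r \<le> exp (2 * r)" using r by simp
  then have "norm w * exp r \<le> norm w * exp (2 * r)" by (rule mult_left_mono) simp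
  then have r': "norm w * exp r < 1" using r by linarith
  have "N summable_on odds"
  proof (rule summable_on_comparison_test)
    have "(\<lambda>m. (norm w * exp r) ^ m) summable_on (UNIV :: nat set)"
      using r' by (intro norm_summable_imp_summable_on) (simp add: summable_geometric abs_mult)
    then have "(\<lambda>m. (norm w * exp r) ^ m) summable_on odds"
      by (rule summable_on_subset_banach) simp
    then show "(\<lambda>m. fact (2 * e + 2) / r ^ (2 * e + 2) / (1 - (norm w)\<^sup>2) * (norm w * exp r) ^ m) summable_on odds"
      by (rule summable_on_cmult_right)
  next
    fix m assume "m \<in> odds"
    then have m: "m \<ge> 1" by (cases m) auto
    have b: "1 - (norm w)\<^sup>2 > 0" using norm_w by (simp add: power_less_one_iff)
    have "norm w ^ (2 * m) \<le> (norm w)\<^sup>2" using m norm_w by (intro power_decreasing) auto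
    then have c: "1 - norm w ^ (2 * m) \<ge> 1 - (norm w)\<^sup>2" by simp
    have "(r * real m) ^ (2 * e + 2) \<le> fact (2 * e + 2) * exp (r * real m)"
      using r by (intro power_le_fact_exp) auto
    then have "real m ^ (2 * e + 2) \<le> fact (2 * e + 2) / r ^ (2 * e + 2) * exp (r * real m)"
      using r unfolding power_mult_distrib by (simp add: field_simps)
    moreover have "norm w ^ m / (1 - norm w ^ (2 * m)) \<le> norm w ^ m / (1 - (norm w)\<^sup>2)"
      using b c by (intro divide_left_mono mult_pos_pos) auto
    ultimately have "N m \<le> (fact (2 * e + 2) / r ^ (2 * e + 2) * exp (r * real m)) * (norm w ^ m / (1 - (norm w)\<^sup>2))"
      unfolding N_def using r b c by (intro mult_mono) auto
    also have "\<dots> = fact (2 * e + 2) / r ^ (2 * e + 2) / (1 - (norm w)\<^sup>2) * (norm w * exp r) ^ m"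
      by (simp add: power_mult_distrib mult.commute flip: exp_of_nat_mult)
    finally show "N m \<le> \<dots>" .
    show "0 \<le> N m" unfolding N_def using b c by (intro mult_nonneg_nonneg divide_nonneg_nonneg) auto
  qed
  moreover have "((\<lambda>y. norm (weight (m, y) * ((of_nat (fst (m, y)))\<^sup>2) ^ e)) has_sum N m) odds" if "m \<in> odds" for m
  proof -
    have "norm (weight (m, y) * ((of_nat (fst (m, y)))\<^sup>2) ^ e) = real m ^ (2 * e + 2) * norm w ^ (m * y)" for y
      by (simp add: weight_def norm_mult norm_power power_add mult_ac flip: power_mult) (simp add: power2_eq_square)
    then show ?thesis
      using has_sum_cmult_right[OF lam_series_norm, of m "real m ^ (2 * e + 2)"] that by (simp add: N_def)
  qed
  ultimately have "(\<lambda>a. norm (weight a * ((of_nat (fst a))\<^sup>2) ^ e)) summable_on odds \<times> odds"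
    by (intro summable_on_SigmaI[where g = N]) simp_all
  then show ?thesis by (rule abs_summable_summable)
qed

lemma weight_sum: "(\<Sum>\<^sub>\<infinity>a\<in>odds \<times> odds. weight a * ((of_nat (fst a))\<^sup>2) ^ e) = mom e"
proof -
  have "(\<Sum>\<^sub>\<infinity>a\<in>odds \<times> odds. weight a * ((of_nat (fst a))\<^sup>2) ^ e) =
      (\<Sum>\<^sub>\<infinity>m\<in>odds. \<Sum>\<^sub>\<infinity>y\<in>odds. weight (m, y) * ((of_nat (fst (m, y)))\<^sup>2) ^ e)"
    using infsum_Sigma_banach[OF weight_summable] by simp
  also have "\<dots> = mom e"
    unfolding mom_def
  proof (rule infsum_cong)
    fix m :: nat assume "m \<in> odds"
    have "weight (m, y) * ((of_nat (fst (m, y)))\<^sup>2) ^ e = of_nat m ^ (2 * e + 2) * ((-1) ^ ((y - 1) div 2) * w ^ (m * y))" for y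
      by (simp add: weight_def power_add mult_ac flip: power_mult) (simp add: power2_eq_square)
    then show "(\<Sum>\<^sub>\<infinity>y\<in>odds. weight (m, y) * ((of_nat (fst (m, y)))\<^sup>2) ^ e) = of_nat m ^ (2 * e + 2) * lam m"
      using infsumI[OF lam_series, of m] \<open>m \<in> odds\<close> by (simp add: infsum_cmult_right')
  qed
  finally show ?thesis .
qed

end

section \<open>Matching indices and constants with the stated formula\<close>

lemma vandermonde_square_eq:
  fixes x :: "nat \<Rightarrow> complex"
  shows "(det (vandermonde n (\<lambda>r. x (Suc r))))\<^sup>2 =
    (\<Prod>(r, s)\<in>{(r, s). 1 \<le> r \<and> r < s \<and> s \<le> n}. (x r - x s)\<^sup>2)"
proof -
  have "(det (vandermonde n (\<lambda>r. x (Suc r))))\<^sup>2 = (\<Prod>i<n. \<Prod>j<i. (x (Suc j) - x (Suc i))\<^sup>2)"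
    by (simp add: det_vandermonde prod_power_distrib[symmetric] power2_commute)
  also have "\<dots> = (\<Prod>(i, j)\<in>Sigma {..<n} lessThan. (x (Suc j) - x (Suc i))\<^sup>2)"
    by (rule prod.Sigma) auto
  also have "\<dots> = (\<Prod>(r, s)\<in>{(r, s). 1 \<le> r \<and> r < s \<and> s \<le> n}. (x r - x s)\<^sup>2)"
    by (rule prod.reindex_bij_witness[of _ "\<lambda>(r, s). (s - 1, r - 1)" "\<lambda>(i, j). (Suc j, Suc i)"]) auto
  finally show ?thesis .
qed

lemma prod_atLeast1AtMost: "(\<Prod>r=1..n. f r) = (\<Prod>r<n. f (Suc r))" for f :: "nat \<Rightarrow> 'a :: comm_monoid_mult"
  by (rule prod.reindex_bij_witness[of _ Suc "\<lambda>r. r - 1"]) auto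

lemma minus_one_power_sum_odd:
  fixes y :: "nat \<Rightarrow> nat"
  assumes "\<And>r. r \<in> {1..n} \<Longrightarrow> odd (y r)"
  shows "(-1 :: complex) ^ (((\<Sum>r=1..n. y r) - n) div 2) = (\<Prod>r=1..n. (-1) ^ ((y r - 1) div 2))"
proof -
  have "(\<Sum>r=1..n. y r) = (\<Sum>r=1..n. 2 * ((y r - 1) div 2) + 1)"
    using assms by (intro sum.cong) (auto elim!: oddE)
  also have "\<dots> = 2 * (\<Sum>r=1..n. (y r - 1) div 2) + n"
    by (simp only: sum.distrib sum_distrib_left sum_constant card_atLeastAtMost) simp
  finally show ?thesis by (simp add: power_sum)
qed

text \<open>Since the j < n add up to n (n - 1) / 2, the exponents are n + n (n - 1) = n^2 for w, 4
  n + 4 n (n - 1) = (2 n)^2 for d, and 16^(n (n - 1) / 2) = 4^(n (n - 1)).\<close>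

lemma closed_form_product:
  fixes w t d :: complex
  shows "(\<Prod>j<n. w * t\<^sup>2 * d ^ 4 * (16 * w\<^sup>2 * d ^ 8) ^ j * (fact (2 * j + 1))\<^sup>2) =
    4 ^ (n * (n - 1)) * w ^ n\<^sup>2 * t ^ (2 * n) * d ^ ((2 * n)\<^sup>2) * (\<Prod>r=1..n. (fact (2 * r - 1))\<^sup>2)"
proof (induction n)
  case (Suc n)
  have e1: "Suc n * (Suc n - 1) = n * (n - 1) + 2 * n" by (cases n) auto
  have e2: "(Suc n)\<^sup>2 = n\<^sup>2 + 1 + 2 * n" "2 * Suc n = 2 * n + 2" "(2 * n + 2)\<^sup>2 = (2 * n)\<^sup>2 + 4 + 8 * n"
    by (simp_all add: power2_eq_square)
  have "(16 :: complex) ^ n = 4 ^ (2 * n)" by (simp add: power_mult)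
  moreover have "2 * Suc n - 1 = 2 * n + 1" by simp
  ultimately show ?case
    unfolding prod.lessThan_Suc Suc e1 e2 prod.nat_ivl_Suc'[OF Suc_leI[OF zero_less_Suc], unfolded One_nat_def[symmetric]]
    by (simp add: power_add power_mult_distrib mult_ac flip: power_mult) (simp add: power2_eq_square)
qed simp

theorem corollary7p10:
  fixes q w :: complex and n :: nat
  assumes "0 < norm q" and "norm q < 1" and "n \<ge> 1"
    and "w\<^sup>2 = q"
  shows "(\<lambda>(y, m). summand n w y m) summable_on (odd_tuples n \<times> decreasing_odd_tuples n)
    \<and> theta3_zero q ^ (2 * n) * Delta q ^ ((2 * n)\<^sup>2) =
        4 powi (- (int n * (int n - 1))) * w powi (- ((int n)\<^sup>2))
        * (\<Prod>r=1..n. (fact (2 * r - 1)) powi (-2))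
        * (\<Sum>\<^sub>\<infinity>(y, m) \<in> odd_tuples n \<times> decreasing_odd_tuples n. summand n w y m)"
proof -
  have w0: "w \<noteq> 0" using assms by auto
  have "norm w ^ 2 < 1" using assms by (metis norm_power)
  then have w1: "norm w < 1" by (simp add: power_less_one_iff)
  interpret nome w q by unfold_locales (use assms w0 w1 in auto)
  define x :: "nat \<times> nat \<Rightarrow> complex" where "x a = (of_nat (fst a))\<^sup>2" for a
  define D where "D = {p \<in> PiE {0..<n} (\<lambda>_. odds \<times> odds). \<forall>r s. r < s \<longrightarrow> s < n \<longrightarrow> fst (p s) < fst (p r)}"
  define F where "F p = (\<Prod>r<n. weight (p r)) * (det (vandermonde n (x \<circ> p)))\<^sup>2" for p
  have sm: "(\<lambda>a. weight a * x a ^ e) summable_on odds \<times> odds" for e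
    unfolding x_def by (rule weight_summable)
  have xk: "x a = x b" if "fst a = fst b" for a b using that by (simp add: x_def)
  have F_summable: "F summable_on D" and F_sum: "(\<Sum>\<^sub>\<infinity>p\<in>D. F p) = det (mat n n (\<lambda>(i, k). mom (i + k)))"
    using cauchy_binet_infsum[where key = fst and \<beta> = weight and x = x and S = "odds \<times> odds" and n = n, OF sm xk]
    by (simp_all add: F_def[abs_def] D_def x_def weight_sum)

  \<comment> \<open>Position r - 1 of \<open>p\<close> holds the pair (m_r, y_r), whereas the stated
    sum runs over (y, m).\<close>
  define i :: "(nat \<Rightarrow> nat \<times> nat) \<Rightarrow> _" where
    "i p = ((\<lambda>r\<in>{1..n}. snd (p (r - 1))), (\<lambda>r\<in>{1..n}. fst (p (r - 1))))" for p
  define j :: "(nat \<Rightarrow> nat) \<times> (nat \<Rightarrow> nat) \<Rightarrow> _" where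
    "j = (\<lambda>(y, m). \<lambda>r\<in>{0..<n}. (m (Suc r), y (Suc r)))"
  let ?R = "odd_tuples n \<times> decreasing_odd_tuples n"
  have ij: "i (j a) = a" if "a \<in> ?R" for a
    using that by (auto simp: i_def j_def odd_tuples_def decreasing_odd_tuples_def PiE_iff extensional_def restrict_def fun_eq_iff)
  have j: "j a \<in> D" if "a \<in> ?R" for a
    using that by (auto simp: D_def j_def odd_tuples_def decreasing_odd_tuples_def PiE_iff)
  have ji: "j (i p) = p" if "p \<in> D" for p
    using that by (auto simp: D_def i_def j_def PiE_iff extensional_def restrict_def fun_eq_iff)
  have i: "i p \<in> ?R" if "p \<in> D" for p
  proof -
    have p: "p r \<in> odds \<times> odds" if "r < n" for r using \<open>p \<in> D\<close> that by (auto simp: D_def PiE_iff)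
    have d: "fst (p s) < fst (p r)" if "r < s" "s < n" for r s using \<open>p \<in> D\<close> that by (simp add: D_def)
    have "odd (fst (p (r - 1)))" "odd (snd (p (r - 1)))" if "r \<in> {1..n}" for r
      using p[of "r - 1"] that by (cases r; auto simp: mem_Times_iff)+
    moreover have "fst (p (s - 1)) < fst (p (r - 1))" if "r \<in> {1..n}" "s \<in> {1..n}" "r < s" for r s
      using d[of "r - 1" "s - 1"] that by auto
    ultimately show ?thesis
      by (auto simp: i_def odd_tuples_def decreasing_odd_tuples_def PiE_iff)
  qed
  have eq: "F (j a) = (case a of (y, m) \<Rightarrow> summand n w y m)" if a: "a \<in> ?R" for a
  proof -
    obtain y m where ym: "a = (y, m)" "y \<in> odd_tuples n" by (use a in auto)
    \<comment> \<open>Outside {0..<n} the restricted tuple is \<open>undefined\<close>; the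
      Vandermonde matrix reads only the rows below n.\<close>
    have "x \<circ> j a = (\<lambda>r. if r < n then (of_nat (m (Suc r)))\<^sup>2 else x undefined)"
      by (auto simp: ym j_def x_def fun_eq_iff)
    then have "vandermonde n (x \<circ> j a) = vandermonde n (\<lambda>r. (of_nat (m (Suc r)))\<^sup>2)"
      by (auto simp: vandermonde_def intro!: eq_matI)
    then have "(det (vandermonde n (x \<circ> j a)))\<^sup>2 =
        (\<Prod>(r, s)\<in>{(r, s). 1 \<le> r \<and> r < s \<and> s \<le> n}. ((of_nat (m r))\<^sup>2 - (of_nat (m s))\<^sup>2)\<^sup>2)"
      using vandermonde_square_eq[of n "\<lambda>r. (of_nat (m r))\<^sup>2"] by simp
    moreover have "(\<Prod>r<n. weight (j a r)) = (\<Prod>r=1..n. (-1) ^ ((y r - 1) div 2) * of_nat (m r) ^ 2 * w ^ (m r * y r))"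
      unfolding prod_atLeast1AtMost by (intro prod.cong) (auto simp: ym j_def weight_def)
    moreover have "\<dots> = (-1) ^ (((\<Sum>r=1..n. y r) - n) div 2) * (\<Prod>r=1..n. of_nat (m r))\<^sup>2 * w ^ (\<Sum>r=1..n. m r * y r)"
      using minus_one_power_sum_odd[of n y] ym(2)
      by (simp add: odd_tuples_def PiE_iff prod.distrib power_sum prod_power_distrib)
    ultimately show ?thesis by (simp add: F_def ym summand_def)
  qed
  have summ: "(\<lambda>(y, m). summand n w y m) summable_on ?R \<longleftrightarrow> F summable_on D"
    by (rule summable_on_reindex_bij_witness[of ?R i j D F]) (fact ij j ji i eq)+
  have sum_eq: "(\<Sum>\<^sub>\<infinity>(y, m)\<in>?R. summand n w y m) = (\<Sum>\<^sub>\<infinity>p\<in>D. F p)"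
    by (rule infsum_reindex_bij_witness[of ?R i j D F]) (fact ij j ji i eq)+
  define P where "P = (\<Prod>r=1..n. (fact (2 * r - 1) :: complex)\<^sup>2)"
  have t: "theta3_zero q = theta q 1" by (simp add: theta3_zero_def theta_def)
  have S: "(\<Sum>\<^sub>\<infinity>(y, m)\<in>?R. summand n w y m) =
      4 ^ (n * (n - 1)) * w ^ n\<^sup>2 * theta3_zero q ^ (2 * n) * Delta q ^ ((2 * n)\<^sup>2) * P"
    unfolding sum_eq F_sum det_mom closed_form_product t P_def ..
  have e1: "(\<Prod>r=1..n. (fact (2 * r - 1) :: complex) powi (-2)) = inverse P"
    using prod_inversef[of "\<lambda>r. (fact (2 * r - 1) :: complex)\<^sup>2" "{1..n}"]
    by (simp add: P_def power_int_minus comp_def)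
  have e2: "(4 :: complex) powi (- (int n * (int n - 1))) = inverse (4 ^ (n * (n - 1)))"
  proof -
    have "int n * (int n - 1) = int (n * (n - 1))" using assms(3) by (simp add: of_nat_diff)
    then show ?thesis by (simp only: power_int_minus power_int_of_nat)
  qed
  have e3: "w powi (- ((int n)\<^sup>2)) = inverse (w ^ n\<^sup>2)"
    by (simp only: power_int_minus power_int_of_nat flip: of_nat_power)
  have "P \<noteq> 0" by (simp add: P_def)
  then show ?thesis
    unfolding S e1 e2 e3 using summ F_summable w0 by (simp add: field_simps)
qed

end
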